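(* Let $S$ be a non-decreasing function on $[0,\infty)$ with $S(x)=0$ for $x<0$ such that $\mathcal{L}\{\mathrm{d}S;s\}=\int_{0^-}^\infty e^{-sx}\,\mathrm{d}S(x)$ converges for $\Re e\, s>\alpha$, where $\alpha>0$. Suppose there are a closed null set $E\subset\mathbb{R}$ and constants $r_0,r_1,\dots,r_N\in\mathbb{R}$, $\theta_1,\dots,\theta_N\in\mathbb{R}$, $t_1,\dots,t_N>0$ such that: (I) the analytic function $$\mathcal{L}\{\mathrm{d}S;s\}-\frac{r_0}{s-\alpha}-\sum_{n=1}^Nr_n\left(\frac{e^{i\theta_n}}{s-\alpha-it_n}+\frac{e^{-i\theta_n}}{s-\alpha+it_n}\right)$$ admits local pseudofunction boundary behavior on the open subset $\alpha+i(\mathbb{R}\setminus E)$ of the line $\Re e\, s=\alpha$; (II) $E\cap\{0,t_1,\dots,t_N\}=\emptyset$; and (III) for every $t\in E$ there is $M_t>0$ with $\sup_{x>0}\left|\int_0^xe^{-\alpha u-itu}\,\mathrm{d}S(u)\right|<M_t$. Then, as $x\to\infty$, $$S(x)=e^{\alpha x}\left(\frac{r_0}{\alpha}+2\sum_{n=1}^N\frac{r_n\cos(t_nx+\theta_n-\arctan(t_n/\alpha))}{\sqrt{\alpha^2+t_n^2}}+o(1)\right).$$ Conversely, if $S$ has this asymptotic behavior, then the function in (I) has local pseudofunction boundary behavior on the whole line $\Re e\, s=\alpha$.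
   Context: Fourier transform $\hat\varphi(t)=\int e^{-itx}\varphi(x)\,\mathrm{d}x$. A tempered distribution $f$ is a pseudofunction if $\hat f\in L^\infty$ and $\hat f(x)\to0$ as $|x|\to\infty$; a distribution on an open $U$ is a local pseudofunction on $U$ if near each point of $U$ it coincides with a pseudofunction. An analytic $F$ on $\Re e\, s>\alpha$ has local pseudofunction boundary behavior on $\alpha+iU$ ($U\subseteq\mathbb{R}$ open) if $F(\sigma+it)$ converges in $\mathcal{D}'(U)$ as $\sigma\to\alpha^+$ to a local pseudofunction on $U$. *)

theory Defs
  imports "HOL-Analysis.Analysis"
begin

definition tagged_partition ::
  "real \<Rightarrow> real \<Rightarrow> (nat \<Rightarrow> real) \<Rightarrow> (nat \<Rightarrow> real) \<Rightarrow> nat \<Rightarrow> bool" where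
  "tagged_partition a b x \<xi> n \<longleftrightarrow> x 0 = a \<and> x n = b \<and>
     (\<forall>i<n. x i < x (Suc i) \<and> x i \<le> \<xi> i \<and> \<xi> i \<le> x (Suc i))"

definition rs_sum ::
  "(real \<Rightarrow> complex) \<Rightarrow> (real \<Rightarrow> real) \<Rightarrow> (nat \<Rightarrow> real) \<Rightarrow> (nat \<Rightarrow> real) \<Rightarrow> nat \<Rightarrow> complex" where
  "rs_sum f g x \<xi> n = (\<Sum>i<n. f (\<xi> i) * complex_of_real (g (x (Suc i)) - g (x i)))"

definition has_rs_integral ::
  "(real \<Rightarrow> complex) \<Rightarrow> (real \<Rightarrow> real) \<Rightarrow> real \<Rightarrow> real \<Rightarrow> complex \<Rightarrow> bool" where
  "has_rs_integral f g a b I \<longleftrightarrow>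
     (\<forall>\<epsilon>>0. \<exists>\<delta>>0. \<forall>x \<xi> n. tagged_partition a b x \<xi> n \<and> (\<forall>i<n. x (Suc i) - x i < \<delta>)
        \<longrightarrow> norm (rs_sum f g x \<xi> n - I) < \<epsilon>)"

definition rs_integral :: "(real \<Rightarrow> complex) \<Rightarrow> (real \<Rightarrow> real) \<Rightarrow> real \<Rightarrow> real \<Rightarrow> complex" where
  "rs_integral f g a b = (THE I. has_rs_integral f g a b I)"

text \<open>Integral from 0^- to X of e^{-su} dS(u); since S vanishes on the negative
  reals, this is the Riemann--Stieltjes integral over [-1, X].\<close>
definition laplace_partial :: "(real \<Rightarrow> real) \<Rightarrow> complex \<Rightarrow> real \<Rightarrow> complex" where
  "laplace_partial S s X = rs_integral (\<lambda>u. exp (- (s * complex_of_real u))) S (-1) X"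

definition laplace_converges :: "(real \<Rightarrow> real) \<Rightarrow> complex \<Rightarrow> bool" where
  "laplace_converges S s \<longleftrightarrow> (\<exists>L. ((\<lambda>X. laplace_partial S s X) \<longlongrightarrow> L) at_top)"

definition laplace_stieltjes :: "(real \<Rightarrow> real) \<Rightarrow> complex \<Rightarrow> complex" where
  "laplace_stieltjes S s = Lim at_top (\<lambda>X. laplace_partial S s X)"

definition test_fun :: "real set \<Rightarrow> (real \<Rightarrow> complex) \<Rightarrow> bool" where
  "test_fun U \<phi> \<longleftrightarrow>
     (\<exists>D :: nat \<Rightarrow> real \<Rightarrow> complex. D 0 = \<phi> \<and>
        (\<forall>k x. (D k has_vector_derivative D (Suc k) x) (at x))) \<and>
     compact (closure {x. \<phi> x \<noteq> 0}) \<and> closure {x. \<phi> x \<noteq> 0} \<subseteq> U"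

definition fourier :: "(real \<Rightarrow> complex) \<Rightarrow> real \<Rightarrow> complex" where
  "fourier \<phi> t = (LINT x|lborel. exp (- (\<i> * complex_of_real (t * x))) * \<phi> x)"

text \<open>The distribution G coincides on the test functions of V with a pseudofunction f,
  i.e. with a tempered distribution whose Fourier transform is the L^infinity function g
  tending to 0 at infinity.  For such f, <f,phi> = <hat f, psi> where hat psi = phi,
  i.e. psi(x) = hat phi(-x) / (2 pi).\<close>
definition coincides_with_pseudofunction_on ::
  "real set \<Rightarrow> ((real \<Rightarrow> complex) \<Rightarrow> complex) \<Rightarrow> bool" where
  "coincides_with_pseudofunction_on V G \<longleftrightarrow>
     (\<exists>g :: real \<Rightarrow> complex. g \<in> borel_measurable lborel \<and> bounded (range g) \<and>
        (g \<longlongrightarrow> 0) at_infinity \<and>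
        (\<forall>\<phi>. test_fun V \<phi> \<longrightarrow>
           G \<phi> = (LINT x|lborel. g x * fourier \<phi> (- x)) / complex_of_real (2 * pi)))"

definition local_pseudofunction :: "real set \<Rightarrow> ((real \<Rightarrow> complex) \<Rightarrow> complex) \<Rightarrow> bool" where
  "local_pseudofunction U G \<longleftrightarrow>
     (\<forall>t0\<in>U. \<exists>V. open V \<and> t0 \<in> V \<and> V \<subseteq> U \<and> coincides_with_pseudofunction_on V G)"

definition lpf_boundary :: "(complex \<Rightarrow> complex) \<Rightarrow> real \<Rightarrow> real set \<Rightarrow> bool" where
  "lpf_boundary F \<alpha> U \<longleftrightarrow> open U \<and>
     (\<exists>G. (\<forall>\<phi>. test_fun U \<phi> \<longrightarrow>
            ((\<lambda>\<sigma>. LINT t|lborel. F (Complex \<sigma> t) * \<phi> t) \<longlongrightarrow> G \<phi>) (at_right \<alpha>)) \<and>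
          local_pseudofunction U G)"

end

theory Submission
  imports Defs "HOL-Probability.Sinc_Integral" "HOL-Computational_Algebra.Polynomial"
begin

text \<open>
Write $S(x) = e^{\alpha x} (a(x) + \rho(x))$ with $a$ the trigonometric sum of the claim. Then
$F(s) = s R(s - \alpha) + a(0)$, where $R$ is the Laplace transform of $\rho$. Testing $F$ near the
frequency 0 with a function whose Fourier transform is non-negative bounds $\rho$, and by Fubini the
hypothesis says that the averages of $\rho$ against $\hat\psi(\cdot - h)$ vanish as
$h \to \infty$ whenever $\psi$ is supported off $E$. On the closed set $K \subseteq E$ of frequencies
where this fails locally, Baire's theorem yields a portion on which the integrals of
$e^{-i\tau u} \rho(u)$ are uniformly bounded. Cut a test function supported near that portion into
pieces of width $\delta$: a piece meeting $K$ contributes $O(\delta)$, after an integration by parts,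
and there are only $o(1/\delta)$ of these because $K$ is null. Hence $K$ is empty, and averaging
against concentrated positive kernels gives $\rho \to 0$, because $\rho$ is slowly decreasing.
As $S$ is real, frequencies may be replaced by their negatives, which deals with $-t_n \in E$.
Conversely, if $\rho \to 0$, then near each frequency the boundary distribution is the Fourier
transform of a convolution of $\rho$ with an integrable function, which tends to 0.
\<close>

section \<open>Smooth functions\<close>

text \<open>Condition (III) bounds the integrals by a constant that depends on the frequency,
  whereas summing over many pieces needs one constant for all; hence the Baire argument. Sizes are
  measured by the L^1 norm of the Fourier transform: it controls pairings with bounded functions and
  is invariant under dilation and translation, so that multiplying a piece of width delta by t - tau
  gains a factor of order delta, uniformly. Modulating a test function by exp(i h t) keeps its
  support and translates its transform, so local boundary behaviour speaks about large h. Three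
  points shape the details. No bound on rho is available at the start, so the first estimate is made
  for sigma > alpha and only an inequality is passed to the limit; this happens at the frequency 0,
  which therefore has to avoid E. On E intersected with its reflection, the frequencies 0 and t_n
  being outside E, the trigonometric sum has bounded oscillating integrals, which carries (III) over
  from S to rho. Finally S(0) may be negative, so that S can jump downwards at 0; the terms in
  |S(0)| account for this.\<close>

definition smooth :: "(real \<Rightarrow> complex) \<Rightarrow> bool" where
  "smooth f \<longleftrightarrow> (\<exists>D :: nat \<Rightarrow> real \<Rightarrow> complex. D 0 = f \<and>
     (\<forall>k x. (D k has_vector_derivative D (Suc k) x) (at x)))"

text \<open>\<open>smooth\<close> asks for a whole sequence of derivatives. Dependent choice builds
  it from any class of functions in which every member has a derivative in the class, so each
  closure property below only has to name such a class.\<close>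

lemma smooth_coinduct:
  assumes "P f"
    and step: "\<And>f. P f \<Longrightarrow> \<exists>f'. P f' \<and> (\<forall>x. (f has_vector_derivative f' x) (at x))"
  shows "smooth f"
proof -
  have "\<exists>D. \<forall>n. (P (D n) \<and> (n = 0 \<longrightarrow> D n = f)) \<and>
      (\<forall>x. (D n has_vector_derivative D (Suc n) x) (at x))"
  proof (rule dependent_nat_choice)
    show "\<exists>x. P x \<and> (0 = (0::nat) \<longrightarrow> x = f)" using assms(1) by blast
  next
    fix g :: "real \<Rightarrow> complex" and n :: nat
    assume "P g \<and> (n = 0 \<longrightarrow> g = f)"
    then show "\<exists>y. (P y \<and> (Suc n = 0 \<longrightarrow> y = f)) \<and> (\<forall>x. (g has_vector_derivative y x) (at x))"
      using step by simp
  qed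
  then show ?thesis unfolding smooth_def by blast
qed

lemma smoothE:
  assumes "smooth f"
  obtains f' where "smooth f'" "\<And>x. (f has_vector_derivative f' x) (at x)"
proof -
  from assms obtain D where D: "D 0 = f" "\<And>k x. (D k has_vector_derivative D (Suc k) x) (at x)"
    unfolding smooth_def by blast
  have "smooth (D (Suc 0))"
    unfolding smooth_def by (rule exI[of _ "\<lambda>k. D (Suc k)"]) (use D in auto)
  moreover have "(f has_vector_derivative D (Suc 0) x) (at x)" for x using D by metis
  ultimately show ?thesis using that by blast
qed

lemma smooth_continuous_on: "smooth f \<Longrightarrow> continuous_on A f"
  by (metis smoothE continuous_on_eq_continuous_within has_vector_derivative_continuous
      continuous_at_imp_continuous_at_within)

lemma smooth_const: "smooth (\<lambda>_. c)"
proof (rule smooth_coinduct[where P = "\<lambda>f. \<exists>c. f = (\<lambda>_. c)"])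
  fix f :: "real \<Rightarrow> complex" assume "\<exists>c. f = (\<lambda>_. c)"
  then show "\<exists>f'. (\<exists>c. f' = (\<lambda>_. c)) \<and> (\<forall>x. (f has_vector_derivative f' x) (at x))"
    by (auto intro!: exI[of _ "\<lambda>_. 0"])
qed auto

lemma smooth_antideriv:
  assumes "smooth f'" "\<And>x. (f has_vector_derivative f' x) (at x)"
  shows "smooth f"
  by (rule smooth_coinduct[where P = "\<lambda>h. h = f \<or> smooth h"]) (use assms in \<open>auto elim: smoothE\<close>)

lemma smooth_of_real: "smooth complex_of_real"
proof (rule smooth_antideriv)
  show "smooth (\<lambda>_. 1)" by (rule smooth_const)
  show "(complex_of_real has_vector_derivative 1) (at x)" for x
    by (auto intro!: derivative_eq_intros has_vector_derivative_of_real[of "\<lambda>x. x" 1, simplified])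
qed

lemma smooth_add:
  assumes "smooth f" "smooth g"
  shows "smooth (\<lambda>x. f x + g x)"
proof (rule smooth_coinduct[where P = "\<lambda>h. \<exists>f g. smooth f \<and> smooth g \<and> h = (\<lambda>x. f x + g x)"])
  fix h assume "\<exists>f g. smooth f \<and> smooth g \<and> h = (\<lambda>x. f x + g x)"
  then obtain f g where fg: "smooth f" "smooth g" "h = (\<lambda>x. f x + g x)" by blast
  obtain f' where f': "smooth f'" "\<And>x. (f has_vector_derivative f' x) (at x)" using smoothE fg(1) by blast
  obtain g' where g': "smooth g'" "\<And>x. (g has_vector_derivative g' x) (at x)" using smoothE fg(2) by blast
  show "\<exists>f'. (\<exists>f g. smooth f \<and> smooth g \<and> f' = (\<lambda>x. f x + g x)) \<and>
      (\<forall>x. (h has_vector_derivative f' x) (at x))"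
    using f' g' fg(3) by (intro exI[of _ "\<lambda>x. f' x + g' x"]) (auto intro!: derivative_intros)
qed (use assms in auto)

text \<open>The Leibniz rule turns one product into a sum of two, so products alone are not stable
  under differentiation; their sums are.\<close>

inductive product_span :: "(real \<Rightarrow> complex) \<Rightarrow> bool" where
  prod: "smooth f \<Longrightarrow> smooth g \<Longrightarrow> product_span (\<lambda>x. f x * g x)"
| add: "product_span f \<Longrightarrow> product_span g \<Longrightarrow> product_span (\<lambda>x. f x + g x)"

lemma smooth_mult:
  assumes "smooth f" "smooth g"
  shows "smooth (\<lambda>x. f x * g x)"
proof (rule smooth_coinduct[where P = product_span])
  fix h assume "product_span h"
  then show "\<exists>h'. product_span h' \<and> (\<forall>x. (h has_vector_derivative h' x) (at x))"
  proof (induction rule: product_span.induct)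
    case (prod f g)
    obtain f' where f': "smooth f'" "\<And>x. (f has_vector_derivative f' x) (at x)" using smoothE prod(1) by blast
    obtain g' where g': "smooth g'" "\<And>x. (g has_vector_derivative g' x) (at x)" using smoothE prod(2) by blast
    have "product_span (\<lambda>x. f x * g' x + f' x * g x)"
      using prod f'(1) g'(1) by (intro product_span.intros)
    then show ?case using f'(2) g'(2) has_vector_derivative_mult by blast
  next
    case (add f g)
    then obtain f' g' where "product_span f'" "\<forall>x. (f has_vector_derivative f' x) (at x)"
      "product_span g'" "\<forall>x. (g has_vector_derivative g' x) (at x)" by blast
    then show ?case
      by (intro exI[of _ "\<lambda>x. f' x + g' x"]) (auto intro!: derivative_intros product_span.add)
  qed
qed (use assms in \<open>auto intro: product_span.prod\<close>)

lemma smooth_cmult: "smooth f \<Longrightarrow> smooth (\<lambda>x. c * f x)"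
  using smooth_mult[OF smooth_const] .

lemma smooth_diff: "smooth f \<Longrightarrow> smooth g \<Longrightarrow> smooth (\<lambda>x. f x - g x)"
  using smooth_add[of f "\<lambda>x. (-1) * g x"] smooth_cmult[of g "-1"] by simp

text \<open>The functions \<open>f / g ^ n\<close> with smooth \<open>f\<close> form a class stable
  under differentiation: the derivative has numerator \<open>f' * g - n * f * g'\<close> over
  \<open>g ^ (n + 1)\<close>.\<close>

lemma smooth_inverse:
  assumes "smooth g" "\<And>x. g x \<noteq> 0"
  shows "smooth (\<lambda>x. inverse (g x))"
proof (rule smooth_coinduct[where P = "\<lambda>h. \<exists>f n. smooth f \<and> h = (\<lambda>x. f x * inverse (g x) ^ n)"])
  fix h assume "\<exists>f n. smooth f \<and> h = (\<lambda>x. f x * inverse (g x) ^ n)"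
  then obtain f n where f: "smooth f" and h: "h = (\<lambda>x. f x * inverse (g x) ^ n)" by blast
  obtain f' where f': "smooth f'" "\<And>x. (f has_vector_derivative f' x) (at x)" using smoothE f by blast
  obtain g' where g': "smooth g'" "\<And>x. (g has_vector_derivative g' x) (at x)" using smoothE assms(1) by blast
  let ?n = "\<lambda>x. f' x * g x - of_nat n * (f x * g' x)"
  have sm: "smooth ?n"
    using f f' g' assms(1) by (intro smooth_diff smooth_mult smooth_const)
  have "(h has_vector_derivative ?n x * inverse (g x) ^ Suc n) (at x)" for x
  proof -
    have "((\<lambda>z. inverse z ^ n) has_field_derivative - of_nat n * inverse (g x) ^ Suc n) (at (g x))"
      using DERIV_power[OF DERIV_inverse[OF assms(2)[of x]], of n UNIV]
      by (cases n) (simp_all add: algebra_simps)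
    then have "((\<lambda>x. inverse (g x) ^ n) has_vector_derivative g' x * (- of_nat n * inverse (g x) ^ Suc n)) (at x)"
      using field_vector_diff_chain_at[OF g'(2), of "\<lambda>z. inverse z ^ n"] unfolding o_def by blast
    from has_vector_derivative_mult[OF f'(2) this]
    have "(h has_vector_derivative f x * (g' x * (- of_nat n * inverse (g x) ^ Suc n)) + f' x * inverse (g x) ^ n) (at x)"
      unfolding h .
    moreover have "f x * (g' x * (- of_nat n * inverse (g x) ^ Suc n)) + f' x * inverse (g x) ^ n
       = ?n x * inverse (g x) ^ Suc n"
      using assms(2)[of x] by (simp add: algebra_simps)
    ultimately show ?thesis by simp
  qed
  then show "\<exists>h'. (\<exists>f n. smooth f \<and> h' = (\<lambda>x. f x * inverse (g x) ^ n)) \<and>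
      (\<forall>x. (h has_vector_derivative h' x) (at x))"
    using sm by blast
next
  show "\<exists>f n. smooth f \<and> (\<lambda>x. inverse (g x)) = (\<lambda>x. f x * inverse (g x) ^ n)"
    by (rule exI[of _ "\<lambda>_. 1"], rule exI[of _ 1]) (auto intro: smooth_const)
qed

lemma smooth_affine:
  assumes "smooth f"
  shows "smooth (\<lambda>x. f (p * x + q))"
proof (rule smooth_coinduct[where P = "\<lambda>h. \<exists>c f. smooth f \<and> h = (\<lambda>x. c * f (p * x + q))"])
  fix h assume "\<exists>c f. smooth f \<and> h = (\<lambda>x. c * f (p * x + q))"
  then obtain c f where f: "smooth f" and h: "h = (\<lambda>x. c * f (p * x + q))" by blast
  obtain f' where f': "smooth f'" "\<And>x. (f has_vector_derivative f' x) (at x)" using smoothE f by blast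
  have "(h has_vector_derivative c * p * f' (p * x + q)) (at x)" for x
  proof -
    have "((\<lambda>x. p * x + q) has_vector_derivative p) (at x)"
      by (auto intro!: derivative_eq_intros simp: has_real_derivative_iff_has_vector_derivative[symmetric])
    from vector_diff_chain_at[OF this f'(2)]
    have "((\<lambda>x. f (p * x + q)) has_vector_derivative p *\<^sub>R f' (p * x + q)) (at x)" by (simp add: o_def)
    from has_vector_derivative_mult_right[OF this, of c] show ?thesis
      unfolding h by (simp add: scaleR_conv_of_real mult_ac)
  qed
  then show "\<exists>h'. (\<exists>c f. smooth f \<and> h' = (\<lambda>x. c * f (p * x + q))) \<and>
      (\<forall>x. (h has_vector_derivative h' x) (at x))"
    using f'(1) by (intro exI[of _ "\<lambda>x. c * p * f' (p * x + q)"]) blast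
next
  show "\<exists>c f'. smooth f' \<and> (\<lambda>x. f (p * x + q)) = (\<lambda>x. c * f' (p * x + q))"
    by (rule exI[of _ 1], rule exI[of _ f]) (use assms in auto)
qed

lemma has_vector_derivative_cis:
  "((\<lambda>x. exp (\<i> * complex_of_real (h * x))) has_vector_derivative \<i> * h * exp (\<i> * complex_of_real (h * x))) (at x)"
proof -
  have "((\<lambda>x. \<i> * complex_of_real (h * x)) has_vector_derivative \<i> * complex_of_real h) (at x)"
    by (intro has_vector_derivative_mult_right has_vector_derivative_of_real)
       (auto intro!: derivative_eq_intros)
  from field_vector_diff_chain_at[OF this DERIV_exp]
  show ?thesis by (simp add: o_def)
qed

lemma smooth_cis: "smooth (\<lambda>x. exp (\<i> * complex_of_real (h * x)))"
proof (rule smooth_coinduct[where P = "\<lambda>f. \<exists>c. f = (\<lambda>x. c * exp (\<i> * complex_of_real (h * x)))"])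
  fix f assume "\<exists>c. f = (\<lambda>x. c * exp (\<i> * complex_of_real (h * x)))"
  then obtain c where f: "f = (\<lambda>x. c * exp (\<i> * complex_of_real (h * x)))" by blast
  have "(f has_vector_derivative (c * \<i> * h) * exp (\<i> * complex_of_real (h * x))) (at x)" for x
    using has_vector_derivative_mult_right[OF has_vector_derivative_cis[of h x], of c] unfolding f by (simp only: mult.assoc)
  then show "\<exists>f'. (\<exists>c. f' = (\<lambda>x. c * exp (\<i> * complex_of_real (h * x)))) \<and>
      (\<forall>x. (f has_vector_derivative f' x) (at x))" by blast
qed (auto intro!: exI[of _ 1])

lemma smooth_cnj:
  assumes "smooth f" shows "smooth (\<lambda>x. cnj (f x))"
proof (rule smooth_coinduct[where P = "\<lambda>h. \<exists>f. smooth f \<and> h = (\<lambda>x. cnj (f x))"])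
  fix h assume "\<exists>f. smooth f \<and> h = (\<lambda>x. cnj (f x))"
  then obtain f where f: "smooth f" and h: "h = (\<lambda>x. cnj (f x))" by blast
  obtain f' where f': "smooth f'" "\<And>x. (f has_vector_derivative f' x) (at x)" using smoothE f by blast
  show "\<exists>h'. (\<exists>f. smooth f \<and> h' = (\<lambda>x. cnj (f x))) \<and> (\<forall>x. (h has_vector_derivative h' x) (at x))"
    using f' unfolding h by (blast intro: has_vector_derivative_cnj)
qed (use assms in blast)

text \<open>The affine argument \<open>p u * x + q u\<close> covers three uses: dilations in
  Hadamard's division, translations in the autocorrelation, and exponentials in the Fourier
  transform.\<close>

lemma has_vector_derivative_param_integral:
  fixes f w :: "real \<Rightarrow> complex" and p q :: "real \<Rightarrow> real"
  assumes f': "\<And>x. (f has_vector_derivative f' x) (at x)" "continuous_on UNIV f'"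
    and w: "continuous_on {a..b} w" "continuous_on {a..b} p" "continuous_on {a..b} q"
  shows "((\<lambda>x. integral {a..b} (\<lambda>u. w u * f (p u * x + q u))) has_vector_derivative
    integral {a..b} (\<lambda>u. w u * p u * f' (p u * x + q u))) (at x)"
proof -
  let ?w = "\<lambda>u. w u * p u"
  have f: "continuous_on UNIV f"
    using f'(1) by (metis continuous_on_eq_continuous_within has_vector_derivative_continuous)
  have "((\<lambda>x. integral (cbox a b) (\<lambda>u. w u * f (p u * x + q u))) has_vector_derivative
     integral (cbox a b) (\<lambda>u. ?w u * f' (p u * x + q u))) (at x within UNIV)"
  proof (rule leibniz_rule_vector_derivative)
    fix x u :: real
    have "((\<lambda>x. p u * x + q u) has_vector_derivative p u) (at x)"
      by (auto intro!: derivative_eq_intros simp: has_real_derivative_iff_has_vector_derivative[symmetric])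
    from vector_diff_chain_at[OF this f'(1)]
    have "((\<lambda>x. f (p u * x + q u)) has_vector_derivative p u *\<^sub>R f' (p u * x + q u)) (at x)"
      by (simp add: o_def)
    from has_vector_derivative_mult_right[OF this, of "w u"]
    show "((\<lambda>x. w u * f (p u * x + q u)) has_vector_derivative ?w u * f' (p u * x + q u)) (at x within UNIV)"
      by (simp add: scaleR_conv_of_real mult_ac)
  next
    fix x
    show "(\<lambda>u. w u * f (p u * x + q u)) integrable_on cbox a b"
      unfolding cbox_interval
      by (intro integrable_continuous_interval continuous_intros w continuous_on_compose2[OF f]) auto
  next
    have c: "continuous_on (UNIV \<times> cbox a b) (\<lambda>x. k (snd x))" if "continuous_on {a..b} k" for k :: "real \<Rightarrow> 'z::topological_space"
      by (rule continuous_on_compose2[OF that]) (auto intro!: continuous_intros)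
    show "continuous_on (UNIV \<times> cbox a b) (\<lambda>(x, t). w t * complex_of_real (p t) * f' (p t * x + q t))"
      unfolding split_beta
      by (intro continuous_intros c w continuous_on_compose2[OF f'(2)]) auto
  qed auto
  then show ?thesis by simp
qed

lemma smooth_param_integral:
  fixes w :: "real \<Rightarrow> complex" and p q :: "real \<Rightarrow> real"
  assumes "smooth f" "continuous_on {a..b} w" "continuous_on {a..b} p" "continuous_on {a..b} q"
  shows "smooth (\<lambda>x. integral {a..b} (\<lambda>u. w u * f (p u * x + q u)))"
proof (rule smooth_coinduct[where P = "\<lambda>h. \<exists>w f. smooth f \<and> continuous_on {a..b} w \<and>
    h = (\<lambda>x. integral {a..b} (\<lambda>u. w u * f (p u * x + q u)))"])
  fix h assume "\<exists>w f. smooth f \<and> continuous_on {a..b} w \<and>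
    h = (\<lambda>x. integral {a..b} (\<lambda>u. w u * f (p u * x + q u)))"
  then obtain w f where f: "smooth f" and w: "continuous_on {a..b} w"
    and h: "h = (\<lambda>x. integral {a..b} (\<lambda>u. w u * f (p u * x + q u)))" by blast
  obtain f' where f': "smooth f'" "\<And>x. (f has_vector_derivative f' x) (at x)" using smoothE f by blast
  let ?w = "\<lambda>u. w u * p u"
  have w': "continuous_on {a..b} ?w" by (intro continuous_intros w assms)
  have "(h has_vector_derivative integral {a..b} (\<lambda>u. ?w u * f' (p u * x + q u))) (at x)" for x
    unfolding h
    by (rule has_vector_derivative_param_integral[OF f'(2) smooth_continuous_on[OF f'(1)] w assms(3,4)])
  then show "\<exists>h'. (\<exists>w f. smooth f \<and> continuous_on {a..b} w \<and>
    h' = (\<lambda>x. integral {a..b} (\<lambda>u. w u * f (p u * x + q u)))) \<and>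
      (\<forall>x. (h has_vector_derivative h' x) (at x))"
    using f'(1) w' by (intro exI[of _ "\<lambda>x. integral {a..b} (\<lambda>u. ?w u * f' (p u * x + q u))"]) blast
qed (use assms in blast)

text \<open>Hadamard's lemma: the quotient is the mean of \<open>f'\<close> over the segment from 0
  to \<open>x\<close>, which is smooth in \<open>x\<close> even at 0.\<close>

lemma smooth_divide_at_zero:
  assumes "smooth f" "f 0 = 0"
  obtains g where "smooth g" "\<And>x. f x = x * g x"
proof -
  obtain f' where f': "smooth f'" "\<And>x. (f has_vector_derivative f' x) (at x)" using smoothE assms by blast
  define g where "g = (\<lambda>x. integral {0..1} (\<lambda>u. 1 * f' (u * x + 0)))"
  have g: "smooth g" unfolding g_def by (rule smooth_param_integral[OF f'(1)]) (auto intro!: continuous_intros)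
  have "f x = x * g x" for x
  proof -
    have "((\<lambda>u. x *\<^sub>R f' (x * u)) has_integral (f (x * 1) - f (x * 0))) {0..1}"
    proof (rule fundamental_theorem_of_calculus)
      fix u :: real
      have "((\<lambda>u. x * u) has_vector_derivative x) (at u)"
        by (auto intro!: derivative_eq_intros simp: has_real_derivative_iff_has_vector_derivative[symmetric])
      from vector_diff_chain_at[OF this f'(2)]
      show "((\<lambda>u. f (x * u)) has_vector_derivative x *\<^sub>R f' (x * u)) (at u within {0..1})"
        by (auto simp: o_def intro: has_vector_derivative_at_within)
    qed simp
    from integral_unique[OF this] have "f x = x *\<^sub>R integral {0..1} (\<lambda>u. f' (x * u))"
      using assms(2) by simp
    then show ?thesis unfolding g_def by (simp add: scaleR_conv_of_real mult.commute)
  qed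
  with g that show ?thesis by blast
qed

section \<open>Test functions and partitions of unity\<close>

definition exp_step :: "real poly \<Rightarrow> real \<Rightarrow> real" where
  "exp_step p x = (if x > 0 then poly p (1 / x) * exp (- (1 / x)) else 0)"

lemma poly_exp_decay: "((\<lambda>y. poly p y * exp (- y)) \<longlongrightarrow> (0::real)) at_top"
proof -
  have *: "((\<lambda>y. c * (y ^ k * exp (-y))) \<longlongrightarrow> (0::real)) at_top" for k c
    using tendsto_mult_right_zero[OF tendsto_power_div_exp_0[of k], of c]
    by (simp add: exp_minus divide_inverse)
  have "((\<lambda>y. \<Sum>i\<le>degree p. coeff p i * (y ^ i * exp (-y))) \<longlongrightarrow> 0) at_top"
    by (rule tendsto_null_sum) (rule *)
  then show ?thesis by (simp add: poly_altdef sum_distrib_right mult.assoc)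
qed

text \<open>With y = 1/x the chain rule gives y^2 (p(y) - p'(y)) exp(-y), again of the same form;
  \<open>[:0, 0, 1:]\<close> is the polynomial y^2. This closes the coinduction for
  smoothness.\<close>

lemma exp_step_deriv:
  "((exp_step p) has_real_derivative exp_step ([:0, 0, 1:] * (p - pderiv p)) x) (at x)"
proof -
  consider "x > 0" | "x < 0" | "x = 0" by linarith
  then show ?thesis
  proof cases
    case 1
    have inv: "((\<lambda>x. 1 / x) has_real_derivative - (1 / x * (1 / x))) (at x)"
      using 1 by (auto intro!: derivative_eq_intros simp: field_simps)
    have "((\<lambda>x. poly p (1 / x) * exp (- (1 / x))) has_real_derivative
       exp_step ([:0, 0, 1:] * (p - pderiv p)) x) (at x)"
      using DERIV_mult[OF DERIV_chain2[OF poly_DERIV inv, of p] DERIV_chain2[OF DERIV_exp DERIV_minus[OF inv]]] 1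
      by (simp add: exp_step_def algebra_simps)
    then show ?thesis
      by (rule has_field_derivative_transform_within_open[of _ _ _ "{0<..}"]) (use 1 in \<open>auto simp: exp_step_def\<close>)
  next
    case 2
    have "((\<lambda>_. 0) has_real_derivative 0) (at x)" by simp
    then have "(exp_step p has_real_derivative 0) (at x)"
      by (rule has_field_derivative_transform_within_open[of _ _ _ "{..<0}"]) (use 2 in \<open>auto simp: exp_step_def\<close>)
    then show ?thesis using 2 by (simp add: exp_step_def)
  next
    case 3
    have "((\<lambda>y. exp_step p y / y) \<longlongrightarrow> 0) (at 0)"
    proof (rule filterlim_split_at)
      have "\<forall>\<^sub>F y in at_left 0. (0::real) = exp_step p y / y"
        by (rule eventually_at_leftI[of "-1"]) (auto simp: exp_step_def)
      then show "((\<lambda>y. exp_step p y / y) \<longlongrightarrow> 0) (at_left 0)"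
        by (rule Lim_transform_eventually[rotated]) simp
      \<comment> \<open>The difference quotient at 0 carries an extra factor 1/y, which
        \<open>pCons 0\<close> absorbs into the polynomial.\<close>
      have "((\<lambda>y. poly (pCons 0 p) (inverse y) * exp (- (inverse y))) \<longlongrightarrow> 0) (at_right (0::real))"
        by (rule filterlim_compose[OF poly_exp_decay filterlim_inverse_at_top_right])
      moreover have "\<forall>\<^sub>F y in at_right 0. poly (pCons 0 p) (inverse y) * exp (- (inverse y)) = exp_step p y / y"
        by (rule eventually_at_rightI[of _ 1]) (auto simp: exp_step_def field_simps)
      ultimately show "((\<lambda>y. exp_step p y / y) \<longlongrightarrow> 0) (at_right 0)"
        by (rule Lim_transform_eventually)
    qed
    then show ?thesis using 3 by (simp add: has_field_derivative_iff exp_step_def)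
  qed
qed

lemma smooth_exp_step: "smooth (\<lambda>x. complex_of_real (exp_step p x))"
proof (rule smooth_coinduct[where P = "\<lambda>f. \<exists>p. f = (\<lambda>x. complex_of_real (exp_step p x))"])
  fix f assume "\<exists>p. f = (\<lambda>x. complex_of_real (exp_step p x))"
  then obtain p where "f = (\<lambda>x. complex_of_real (exp_step p x))" by blast
  then show "\<exists>f'. (\<exists>p. f' = (\<lambda>x. complex_of_real (exp_step p x))) \<and>
      (\<forall>x. (f has_vector_derivative f' x) (at x))"
    using exp_step_deriv
    by (intro exI[of _ "\<lambda>x. complex_of_real (exp_step ([:0, 0, 1:] * (p - pderiv p)) x)"])
       (auto intro!: has_vector_derivative_of_real)
qed blast

definition smooth_step :: "real \<Rightarrow> real" where
  "smooth_step x = exp_step 1 x / (exp_step 1 x + exp_step 1 (1 - x))"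

lemma exp_step_1: "exp_step 1 x = (if x > 0 then exp (- (1 / x)) else 0)"
  by (simp add: exp_step_def)

lemma smooth_step_le_0: "x \<le> 0 \<Longrightarrow> smooth_step x = 0"
  and smooth_step_ge_1: "x \<ge> 1 \<Longrightarrow> smooth_step x = 1"
  by (auto simp: smooth_step_def exp_step_1)

lemma exp_step_sum_pos: "exp_step 1 x + exp_step 1 (1 - x) > 0"
  by (auto simp: exp_step_1 add_pos_pos)

lemma smooth_step_bounds: "0 \<le> smooth_step x" "smooth_step x \<le> 1"
proof -
  have nn: "exp_step 1 y \<ge> 0" for y by (simp add: exp_step_1)
  show "0 \<le> smooth_step x" unfolding smooth_step_def by (intro divide_nonneg_nonneg add_nonneg_nonneg nn)
  show "smooth_step x \<le> 1" unfolding smooth_step_def using nn exp_step_sum_pos by simp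
qed

lemma smooth_smooth_step: "smooth (\<lambda>x. complex_of_real (smooth_step x))"
proof -
  have "smooth (\<lambda>x. complex_of_real (exp_step 1 (-1 * x + 1)))"
    by (rule smooth_affine[OF smooth_exp_step])
  then have "smooth (\<lambda>x. complex_of_real (exp_step 1 x) + complex_of_real (exp_step 1 (1 - x)))"
    by (intro smooth_add smooth_exp_step) simp
  moreover have "complex_of_real (exp_step 1 x) + complex_of_real (exp_step 1 (1 - x)) \<noteq> 0" for x
    using exp_step_sum_pos[of x] by (metis of_real_add of_real_eq_0_iff less_irrefl)
  ultimately have "smooth (\<lambda>x. inverse (complex_of_real (exp_step 1 x) + complex_of_real (exp_step 1 (1 - x))))"
    by (rule smooth_inverse)
  from smooth_mult[OF smooth_exp_step[of 1] this] show ?thesis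
    unfolding smooth_step_def by (simp add: divide_inverse)
qed

text \<open>A difference of two translates of the step, so that sums over integer translates
  telescope.\<close>

definition unit_bump :: "real \<Rightarrow> real" where
  "unit_bump x = smooth_step (x + 1) - smooth_step x"

lemma smooth_unit_bump: "smooth (\<lambda>x. complex_of_real (unit_bump x))"
  using smooth_diff[OF smooth_affine[OF smooth_smooth_step, of 1 1] smooth_smooth_step]
  by (simp add: unit_bump_def)

lemma unit_bump_support: "\<bar>x\<bar> \<ge> 1 \<Longrightarrow> unit_bump x = 0"
  by (cases "x \<ge> 0") (auto simp: unit_bump_def smooth_step_le_0 smooth_step_ge_1)

lemma unit_bump_nonneg: "unit_bump x \<ge> 0"
  by (cases "x \<ge> 0") (auto simp: unit_bump_def smooth_step_le_0 smooth_step_ge_1 smooth_step_bounds)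

lemma unit_bump_0: "unit_bump 0 = 1"
  by (simp add: unit_bump_def smooth_step_le_0 smooth_step_ge_1)

text \<open>The telescoped sum is a step at an argument above 1 minus a step at an argument below
  0.\<close>

lemma sum_unit_bump:
  fixes x :: real
  assumes "\<bar>x\<bar> \<le> real n"
  shows "(\<Sum>k\<in>{- int n - 1..int n + 1}. unit_bump (x - k)) = 1"
proof -
  have *: "(\<Sum>k\<in>{a..a + int m}. unit_bump (x - k)) = smooth_step (x - a + 1) - smooth_step (x - a - m)" for a m
  proof (induction m)
    case (Suc m)
    have "{a..a + int (Suc m)} = insert (a + int (Suc m)) {a..a + int m}" by auto
    then show ?case using Suc by (simp add: unit_bump_def algebra_simps)
  qed (simp add: unit_bump_def)
  have eq: "(- int n - 1) + int (2 * n + 2) = int n + 1" by simp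
  have "(\<Sum>k\<in>{- int n - 1..int n + 1}. unit_bump (x - k)) =
    smooth_step (x - real_of_int (- int n - 1) + 1) - smooth_step (x - real_of_int (- int n - 1) - (2 * n + 2))"
    using *[of "- int n - 1" "2 * n + 2"] unfolding eq by simp
  also have "\<dots> = 1" using assms by (simp add: smooth_step_le_0 smooth_step_ge_1)
  finally show ?thesis .
qed

section \<open>Compactly supported test functions\<close>

abbreviation supp :: "(real \<Rightarrow> complex) \<Rightarrow> real set" where
  "supp \<phi> \<equiv> closure {x. \<phi> x \<noteq> 0}"

lemma test_fun_iff: "test_fun U \<phi> \<longleftrightarrow> smooth \<phi> \<and> compact (supp \<phi>) \<and> supp \<phi> \<subseteq> U"
  by (simp add: test_fun_def smooth_def)

lemma test_fun_smooth: "test_fun U \<phi> \<Longrightarrow> smooth \<phi>"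
  by (simp add: test_fun_iff)

lemma test_fun_mono: "test_fun U \<phi> \<Longrightarrow> U \<subseteq> V \<Longrightarrow> test_fun V \<phi>"
  by (auto simp: test_fun_iff)

lemma zero_outside_supp: "x \<notin> supp \<phi> \<Longrightarrow> \<phi> x = 0"
  using closure_subset[of "{x. \<phi> x \<noteq> 0}"] by blast

lemma test_funI:
  assumes "smooth \<phi>" "compact K" "K \<subseteq> U" "\<And>x. x \<notin> K \<Longrightarrow> \<phi> x = 0"
  shows "test_fun U \<phi>"
proof -
  have "supp \<phi> \<subseteq> K" using assms(2,4) by (intro closure_minimal compact_imp_closed) auto
  moreover from this have "compact (supp \<phi>)"
    using compact_Int_closed[OF assms(2) closed_closure, of "{x. \<phi> x \<noteq> 0}"] by (simp add: Int_absorb1)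
  ultimately show ?thesis using assms(1,3) unfolding test_fun_iff by blast
qed

lemma test_fun_cball:
  assumes "test_fun U \<phi>"
  obtains R where "R > 0" "\<And>x. \<bar>x\<bar> > R \<Longrightarrow> \<phi> x = 0"
proof -
  have "bounded (supp \<phi>)" using assms by (auto simp: test_fun_iff compact_imp_bounded)
  then obtain R where "R > 0" "\<forall>x\<in>supp \<phi>. norm x \<le> R" using bounded_pos by blast
  then show ?thesis using that zero_outside_supp[of _ \<phi>] by (metis not_le real_norm_def)
qed

lemma test_fun_mult:
  assumes "test_fun U \<phi>" "smooth f"
  shows "test_fun U (\<lambda>x. f x * \<phi> x)"
  using assms unfolding test_fun_iff[of U \<phi>]
  by (intro test_funI[of _ "supp \<phi>"] smooth_mult) (auto dest: zero_outside_supp[of _ \<phi>])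

lemma test_fun_cmult: "test_fun U \<phi> \<Longrightarrow> test_fun U (\<lambda>x. c * \<phi> x)"
  by (rule test_fun_mult[OF _ smooth_const])

lemma test_fun_add:
  assumes "test_fun U \<phi>" "test_fun U \<psi>"
  shows "test_fun U (\<lambda>x. \<phi> x + \<psi> x)"
proof (rule test_funI[of _ "supp \<phi> \<union> supp \<psi>"])
  show "smooth (\<lambda>x. \<phi> x + \<psi> x)" using assms by (intro smooth_add test_fun_smooth)
  show "compact (supp \<phi> \<union> supp \<psi>)" "supp \<phi> \<union> supp \<psi> \<subseteq> U"
    using assms by (simp_all add: test_fun_iff compact_Un del: compact_closure)
  fix x assume "x \<notin> supp \<phi> \<union> supp \<psi>"
  then have "\<phi> x = 0" "\<psi> x = 0" by (intro zero_outside_supp; blast)+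
  then show "\<phi> x + \<psi> x = 0" by simp
qed

lemma test_fun_diff:
  assumes "test_fun U \<phi>" "test_fun U \<psi>"
  shows "test_fun U (\<lambda>x. \<phi> x - \<psi> x)"
  using test_fun_add[OF assms(1) test_fun_cmult[OF assms(2), of "-1"]] by simp

lemma test_fun_deriv:
  assumes "test_fun U \<phi>"
  obtains \<phi>' where "test_fun U \<phi>'" "\<And>x. (\<phi> has_vector_derivative \<phi>' x) (at x)"
proof -
  obtain \<phi>' where \<phi>': "smooth \<phi>'" "\<And>x. (\<phi> has_vector_derivative \<phi>' x) (at x)"
    using smoothE test_fun_smooth[OF assms] by blast
  have "\<phi>' x = 0" if "x \<notin> supp \<phi>" for x
  proof -
    have "((\<lambda>_. 0) has_vector_derivative 0) (at x)" by simp
    then have "(\<phi> has_vector_derivative 0) (at x)"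
      by (rule has_vector_derivative_transform_within_open[of _ _ _ "- supp \<phi>"])
         (use that in \<open>auto dest: zero_outside_supp[of _ \<phi>]\<close>)
    then show ?thesis using \<phi>'(2) vector_derivative_unique_at by blast
  qed
  then have "test_fun U \<phi>'"
    using assms \<phi>'(1) by (intro test_funI[of _ "supp \<phi>"]) (auto simp: test_fun_iff)
  then show ?thesis using \<phi>'(2) that by blast
qed

lemma test_fun_scale:
  assumes "test_fun U \<phi>" "p \<noteq> 0"
  shows "test_fun {x. p * x + q \<in> U} (\<lambda>x. \<phi> (p * x + q))"
proof (rule test_funI)
  show "smooth (\<lambda>x. \<phi> (p * x + q))" by (rule smooth_affine[OF test_fun_smooth[OF assms(1)]])
  have "y = p * x + q \<longleftrightarrow> x = (y - q) / p" for x y using assms(2) by (auto simp: field_simps)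
  then have *: "x \<in> (\<lambda>y. (y - q) / p) ` A \<longleftrightarrow> p * x + q \<in> A" for x A
    unfolding image_iff by metis
  show "compact ((\<lambda>y. (y - q) / p) ` supp \<phi>)"
    using assms by (intro compact_continuous_image) (auto simp: test_fun_iff intro!: continuous_intros)
  show "(\<lambda>y. (y - q) / p) ` supp \<phi> \<subseteq> {x. p * x + q \<in> U}"
    using assms(1) * by (auto simp: test_fun_iff)
  show "\<phi> (p * x + q) = 0" if "x \<notin> (\<lambda>y. (y - q) / p) ` supp \<phi>" for x
    using that unfolding * by (rule zero_outside_supp)
qed

lemma test_fun_unit_bump: "test_fun {-1..1} (\<lambda>x. complex_of_real (unit_bump x))"
  by (rule test_funI[of _ "{-1..1}"]) (auto intro: smooth_unit_bump unit_bump_support)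

lemma test_fun_cutoff:
  obtains \<eta> where "test_fun UNIV \<eta>" "\<And>x. a \<le> x \<Longrightarrow> x \<le> b \<Longrightarrow> \<eta> x = 1"
proof
  let ?\<eta> = "\<lambda>x. complex_of_real (smooth_step (1 * x + (1 - a))) * complex_of_real (smooth_step (-1 * x + (b + 1)))"
  show "test_fun UNIV ?\<eta>"
    by (rule test_funI[of _ "{a-1..b+1}"])
       (auto intro!: smooth_mult smooth_affine[OF smooth_smooth_step, of 1, simplified]
          smooth_affine[OF smooth_smooth_step, of "-1", simplified] simp: smooth_step_le_0)
  show "?\<eta> x = 1" if "a \<le> x" "x \<le> b" for x
    using that by (simp add: smooth_step_ge_1)
qed

lemma test_fun_cnj_neg:
  assumes "test_fun U \<phi>"
  shows "test_fun (uminus ` U) (\<lambda>x. cnj (\<phi> (- x)))"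
proof -
  have "test_fun {x. -1 * x + 0 \<in> U} (\<lambda>x. \<phi> (-1 * x + 0))" by (rule test_fun_scale[OF assms]) auto
  moreover have "{x. -1 * x + 0 \<in> U} = uminus ` U"
    by (auto simp: image_iff) (metis minus_minus)
  moreover have "{x. cnj (\<phi> (- x)) \<noteq> 0} = {x. \<phi> (- x) \<noteq> 0}" by auto
  ultimately show ?thesis by (simp add: test_fun_iff smooth_cnj)
qed

section \<open>Fourier transforms of test functions\<close>

lemma test_fun_integrable:
  assumes "test_fun U \<phi>" shows "integrable lborel \<phi>"
proof -
  obtain R where R: "R > 0" "\<And>x. \<bar>x\<bar> > R \<Longrightarrow> \<phi> x = 0" using test_fun_cball[OF assms] by blast
  have "integrable lborel (\<lambda>x. indicator {-R..R} x *\<^sub>R \<phi> x)"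
    by (intro borel_integrable_compact smooth_continuous_on test_fun_smooth[OF assms]) simp
  moreover have "(\<lambda>x. indicator {-R..R} x *\<^sub>R \<phi> x) = \<phi>"
    using R by (force simp: indicator_def abs_le_iff not_le)
  ultimately show ?thesis by simp
qed

lemma norm_cis_minus [simp]: "cmod (exp (- (\<i> * complex_of_real y))) = 1"
  by (simp add: norm_exp_eq_Re)

lemma integrable_cis_mult:
  assumes "integrable lborel \<phi>"
  shows "integrable lborel (\<lambda>x. exp (\<i> * complex_of_real (t * x)) * \<phi> x)"
  by (rule Bochner_Integration.integrable_bound[OF assms])
     (use assms in \<open>auto simp: norm_mult\<close>)

lemma fourier_integrand_integrable:
  assumes "integrable lborel \<phi>"
  shows "integrable lborel (\<lambda>x. exp (- (\<i> * complex_of_real (t * x))) * \<phi> x)"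
  using integrable_cis_mult[OF assms, of "-t"] by simp

lemma norm_fourier_le: "cmod (fourier \<phi> t) \<le> (LINT x|lborel. cmod (\<phi> x))"
  unfolding fourier_def by (rule order_trans[OF integral_norm_bound]) (simp add: norm_mult)

lemma fourier_add:
  "integrable lborel \<phi> \<Longrightarrow> integrable lborel \<psi> \<Longrightarrow> fourier (\<lambda>x. \<phi> x + \<psi> x) t = fourier \<phi> t + fourier \<psi> t"
  unfolding fourier_def
  by (simp add: distrib_left fourier_integrand_integrable del: of_real_mult)

lemma fourier_diff:
  "integrable lborel \<phi> \<Longrightarrow> integrable lborel \<psi> \<Longrightarrow> fourier (\<lambda>x. \<phi> x - \<psi> x) t = fourier \<phi> t - fourier \<psi> t"
  unfolding fourier_def
  by (simp add: right_diff_distrib fourier_integrand_integrable del: of_real_mult)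

lemma fourier_cmult: "fourier (\<lambda>x. c * \<phi> x) t = c * fourier \<phi> t"
  unfolding fourier_def by (simp add: mult.left_commute[of _ c])

lemma fourier_sum:
  "(\<And>i. i \<in> I \<Longrightarrow> integrable lborel (\<phi> i)) \<Longrightarrow> fourier (\<lambda>x. \<Sum>i\<in>I. \<phi> i x) t = (\<Sum>i\<in>I. fourier (\<phi> i) t)"
  unfolding fourier_def
  by (simp add: sum_distrib_left fourier_integrand_integrable del: of_real_mult)

lemma exp_mult_exp: "exp a * (exp b * c) = exp (a + b) * (c :: complex)"
  by (simp add: exp_add)

lemma fourier_modulation:
  "fourier (\<lambda>x. exp (\<i> * complex_of_real (h * x)) * \<phi> x) t = fourier \<phi> (t - h)"
proof -
  have "- (\<i> * complex_of_real (t * x)) + \<i> * complex_of_real (h * x) = - (\<i> * complex_of_real ((t - h) * x))" for x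
    by (simp add: algebra_simps)
  then show ?thesis unfolding fourier_def exp_mult_exp by presburger
qed

lemma fourier_affine:
  assumes "p \<noteq> 0"
  shows "fourier \<phi> y = complex_of_real \<bar>p\<bar> * exp (- (\<i> * complex_of_real (y * q))) * fourier (\<lambda>x. \<phi> (p * x + q)) (p * y)"
proof -
  have "fourier \<phi> y = \<bar>p\<bar> *\<^sub>R (LINT x|lborel. exp (- (\<i> * complex_of_real (y * (q + p * x)))) * \<phi> (q + p * x))"
    unfolding fourier_def by (rule lborel_integral_real_affine[OF assms])
  also have "(LINT x|lborel. exp (- (\<i> * complex_of_real (y * (q + p * x)))) * \<phi> (q + p * x)) =
    (LINT x|lborel. exp (- (\<i> * complex_of_real (y * q))) * (exp (- (\<i> * complex_of_real (p * y * x))) * \<phi> (p * x + q)))"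
  proof -
    have "- (\<i> * complex_of_real (y * (q + p * x))) =
        - (\<i> * complex_of_real (y * q)) + - (\<i> * complex_of_real (p * y * x))" for x
      by (simp add: algebra_simps)
    then show ?thesis unfolding exp_mult_exp by (simp add: add.commute)
  qed
  also have "\<dots> = exp (- (\<i> * complex_of_real (y * q))) * fourier (\<lambda>x. \<phi> (p * x + q)) (p * y)"
    unfolding fourier_def by (rule integral_mult_right_zero)
  finally show ?thesis by (simp add: scaleR_conv_of_real mult.assoc)
qed

lemma fourier_cnj_neg: "fourier (\<lambda>x. cnj (\<phi> (- x))) t = cnj (fourier \<phi> t)"
proof -
  have "cnj (fourier \<phi> t) = (LINT x|lborel. exp (\<i> * complex_of_real (t * x)) * cnj (\<phi> x))"
    unfolding fourier_def by (subst Bochner_Integration.integral_cnj[symmetric]) (simp add: exp_cnj)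
  also have "\<dots> = (LINT x|lborel. exp (- (\<i> * complex_of_real (t * x))) * cnj (\<phi> (- x)))"
    using lborel_integral_real_affine[of "-1" "\<lambda>x. exp (\<i> * complex_of_real (t * x)) * cnj (\<phi> x)" 0] by simp
  finally show ?thesis unfolding fourier_def by simp
qed

lemma test_fun_deriv_unique:
  assumes "test_fun U \<phi>" "\<And>x. (\<phi> has_vector_derivative \<phi>' x) (at x)"
  shows "test_fun U \<phi>'"
proof -
  obtain \<psi> where \<psi>: "test_fun U \<psi>" "\<And>x. (\<phi> has_vector_derivative \<psi> x) (at x)"
    using test_fun_deriv[OF assms(1)] by blast
  have "\<psi> = \<phi>'" using vector_derivative_unique_at[OF \<psi>(2) assms(2)] by auto
  with \<psi> show ?thesis by simp
qed

lemma integral_test_fun_deriv: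
  assumes "test_fun U \<phi>" "\<And>x. (\<phi> has_vector_derivative \<phi>' x) (at x)"
  shows "(LINT x|lborel. \<phi>' x) = 0"
proof -
  have t: "test_fun U \<phi>'" by (rule test_fun_deriv_unique[OF assms])
  obtain R where R: "R > 0" "\<And>x. \<bar>x\<bar> > R \<Longrightarrow> \<phi> x = 0" using test_fun_cball[OF assms(1)] by blast
  obtain R' where R': "R' > 0" "\<And>x. \<bar>x\<bar> > R' \<Longrightarrow> \<phi>' x = 0" using test_fun_cball[OF t] by blast
  define B where "B = max R R' + 1"
  have Bgt: "B > R" "B > R'" "B > 0" using R(1) R'(1) unfolding B_def by linarith+
  have B: "\<phi> B = 0" "\<phi> (- B) = 0" using Bgt by (intro R(2); linarith)+
  have B': "\<phi>' x = 0" if "\<bar>x\<bar> > B" for x using that Bgt by (intro R'(2)) linarith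
  have "(LINT x|lborel. indicator {-B..B} x *\<^sub>R \<phi>' x) = \<phi> B - \<phi> (- B)"
    using Bgt(3) by (intro integral_FTC_Icc smooth_continuous_on test_fun_smooth[OF t]
      has_vector_derivative_at_within[OF assms(2)]) simp
  moreover have "(\<lambda>x. indicator {-B..B} x *\<^sub>R \<phi>' x) = \<phi>'"
    using B' by (intro ext) (auto simp: indicator_def abs_le_iff not_le abs_less_iff)
  ultimately show ?thesis using B by simp
qed

lemma fourier_deriv:
  assumes "test_fun U \<phi>" "\<And>x. (\<phi> has_vector_derivative \<phi>' x) (at x)"
  shows "fourier \<phi>' t = \<i> * t * fourier \<phi> t"
proof -
  let ?e = "\<lambda>x. exp (\<i> * complex_of_real (- t * x))"
  have t': "test_fun U \<phi>'" by (rule test_fun_deriv_unique[OF assms])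
  have int: "integrable lborel (\<lambda>x. ?e x * \<phi>' x)" "integrable lborel (\<lambda>x. ?e x * \<phi> x)"
    by (intro integrable_cis_mult test_fun_integrable[OF t'] test_fun_integrable[OF assms(1)])+
  have "((\<lambda>x. ?e x * \<phi> x) has_vector_derivative ?e x * \<phi>' x + \<i> * (-t) * ?e x * \<phi> x) (at x)" for x
    using has_vector_derivative_mult[OF has_vector_derivative_cis assms(2), of "-t" x] by simp
  from integral_test_fun_deriv[OF test_fun_mult[OF assms(1) smooth_cis] this]
  have "(LINT x|lborel. ?e x * \<phi>' x + (\<i> * (-t)) * (?e x * \<phi> x)) = 0"
    by (simp add: mult.assoc)
  also have "(LINT x|lborel. ?e x * \<phi>' x + (\<i> * (-t)) * (?e x * \<phi> x)) =
     (LINT x|lborel. ?e x * \<phi>' x) + (LINT x|lborel. (\<i> * (-t)) * (?e x * \<phi> x))"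
    using int by (intro Bochner_Integration.integral_add integrable_mult_right) auto
  also have "(LINT x|lborel. (\<i> * (-t)) * (?e x * \<phi> x)) = (\<i> * (-t)) * (LINT x|lborel. ?e x * \<phi> x)"
    by (rule integral_mult_right_zero)
  finally show ?thesis unfolding fourier_def by simp
qed

lemma integrable_inverse_1_plus_square': "integrable lborel (\<lambda>x::real. 1 / (1 + x\<^sup>2))"
  using integrable_inverse_1_plus_square by (simp add: set_integrable_def inverse_eq_divide)

text \<open>The transform of \<open>\<phi>\<close> minus its second derivative is (1 + t^2) times
  that of \<open>\<phi>\<close>, and every transform is bounded by the L^1 norm of the
  function.\<close>

lemma fourier_decay:
  assumes "test_fun U \<phi>"
  obtains C where "C \<ge> 0" "\<And>t. cmod (fourier \<phi> t) \<le> C / (1 + t\<^sup>2)"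
proof -
  obtain \<phi>1 where 1: "test_fun U \<phi>1" "\<And>x. (\<phi> has_vector_derivative \<phi>1 x) (at x)"
    using test_fun_deriv[OF assms] by blast
  obtain \<phi>2 where 2: "test_fun U \<phi>2" "\<And>x. (\<phi>1 has_vector_derivative \<phi>2 x) (at x)"
    using test_fun_deriv[OF 1(1)] by blast
  define C where "C = (LINT x|lborel. cmod (\<phi> x - \<phi>2 x))"
  have "cmod (fourier \<phi> t) \<le> C / (1 + t\<^sup>2)" for t
  proof -
    have "fourier (\<lambda>x. \<phi> x - \<phi>2 x) t = fourier \<phi> t - \<i> * t * (\<i> * t * fourier \<phi> t)"
      using fourier_deriv[OF assms 1(2)] fourier_deriv[OF 1(1) 2(2)]
      by (simp add: fourier_diff[OF test_fun_integrable[OF assms] test_fun_integrable[OF 2(1)]])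
    also have "\<dots> = complex_of_real (1 + t\<^sup>2) * fourier \<phi> t"
      by (simp add: algebra_simps power2_eq_square)
    finally have "complex_of_real (1 + t\<^sup>2) * fourier \<phi> t = fourier (\<lambda>x. \<phi> x - \<phi>2 x) t" by simp
    then have "cmod (complex_of_real (1 + t\<^sup>2)) * cmod (fourier \<phi> t) \<le> C"
      unfolding C_def using norm_fourier_le norm_mult by metis
    moreover have "cmod (complex_of_real (1 + t\<^sup>2)) = 1 + t\<^sup>2"
      unfolding norm_of_real by (simp add: add_nonneg_nonneg)
    ultimately have "(1 + t\<^sup>2) * cmod (fourier \<phi> t) \<le> C" by simp
    then show ?thesis by (simp add: field_simps add_pos_nonneg)
  qed
  moreover have "C \<ge> 0" unfolding C_def by simp
  ultimately show ?thesis using that by blast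
qed

lemma has_vector_derivative_fourier:
  assumes "test_fun U \<phi>"
  shows "(fourier \<phi> has_vector_derivative fourier (\<lambda>t. - (\<i> * t) * \<phi> t) x) (at x)"
proof -
  obtain R where R: "R > 0" "\<And>x. \<bar>x\<bar> > R \<Longrightarrow> \<phi> x = 0" using test_fun_cball[OF assms] by blast
  have eq: "fourier \<psi> x = integral {-R..R} (\<lambda>t. \<psi> t * exp (\<i> * complex_of_real (-1 * (t * x + 0))))"
    if \<psi>: "test_fun U \<psi>" "\<And>x. \<bar>x\<bar> > R \<Longrightarrow> \<psi> x = 0" for \<psi> x
  proof -
    have "integrable lborel (\<lambda>t. exp (\<i> * complex_of_real ((-x) * t)) * \<psi> t)"
      by (rule integrable_cis_mult[OF test_fun_integrable[OF \<psi>(1)]])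
    from integral_lborel[OF this]
    have "fourier \<psi> x = integral UNIV (\<lambda>t. exp (\<i> * complex_of_real ((-x) * t)) * \<psi> t)"
      by (simp add: fourier_def)
    also have "\<dots> = integral {-R..R} (\<lambda>t. exp (\<i> * complex_of_real ((-x) * t)) * \<psi> t)"
    proof -
      have "(\<lambda>t. exp (\<i> * complex_of_real ((-x) * t)) * \<psi> t) =
          (\<lambda>t. if t \<in> {-R..R} then exp (\<i> * complex_of_real ((-x) * t)) * \<psi> t else 0)"
        using \<psi>(2) by (intro ext) (auto simp: abs_le_iff not_le abs_less_iff)
      then show ?thesis
        using Henstock_Kurzweil_Integration.integral_restrict_UNIV[of "{-R..R}"
          "\<lambda>t. exp (\<i> * complex_of_real ((-x) * t)) * \<psi> t"] by presburger
    qed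
    finally show ?thesis by (simp add: mult_ac)
  qed
  have "((\<lambda>x. integral {-R..R} (\<lambda>t. \<phi> t * exp (\<i> * complex_of_real (-1 * (t * x + 0)))))
    has_vector_derivative integral {-R..R} (\<lambda>t. \<phi> t * t * (\<i> * complex_of_real (-1) * exp (\<i> * complex_of_real (-1 * (t * x + 0))))))
     (at x)"
    by (rule has_vector_derivative_param_integral[OF has_vector_derivative_cis])
       (intro continuous_intros smooth_continuous_on[OF test_fun_smooth[OF assms]])+
  moreover have "integral {-R..R} (\<lambda>t. \<phi> t * t * (\<i> * complex_of_real (-1) * exp (\<i> * complex_of_real (-1 * (t * x + 0)))))
     = fourier (\<lambda>t. - (\<i> * t) * \<phi> t) x"
  proof (subst eq)
    show "test_fun U (\<lambda>t. - (\<i> * t) * \<phi> t)"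
      using test_fun_mult[OF assms smooth_cmult[OF smooth_of_real, of "-\<i>"]] by simp
  qed (use R in \<open>auto simp: mult_ac\<close>)
  moreover have "fourier \<phi> = (\<lambda>x. integral {-R..R} (\<lambda>t. \<phi> t * exp (\<i> * complex_of_real (-1 * (t * x + 0)))))"
    using eq[OF assms R(2)] by blast
  ultimately show ?thesis by simp
qed

lemma fourier_continuous_on:
  assumes "test_fun U \<phi>" shows "continuous_on A (fourier \<phi>)"
  using has_vector_derivative_fourier[OF assms]
  by (meson continuous_at_imp_continuous_on has_vector_derivative_continuous)

lemma fourier_measurable [measurable]:
  assumes "test_fun U \<phi>" shows "fourier \<phi> \<in> borel_measurable borel"
  by (rule borel_measurable_continuous_onI[OF fourier_continuous_on[OF assms]])

lemma fourier_integrable: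
  assumes "test_fun U \<phi>" shows "integrable lborel (fourier \<phi>)"
proof -
  obtain C where C: "C \<ge> 0" "\<And>t. cmod (fourier \<phi> t) \<le> C / (1 + t\<^sup>2)" using fourier_decay[OF assms] by blast
  have "integrable lborel (\<lambda>x::real. C * (1 / (1 + x\<^sup>2)))"
    by (intro integrable_mult_right integrable_inverse_1_plus_square')
  then show ?thesis
    by (rule Bochner_Integration.integrable_bound) (use C fourier_measurable[OF assms] in \<open>auto intro: order_trans[OF C(2)]\<close>)
qed

lemma fourier_integrable_times:
  assumes "test_fun U \<phi>" shows "integrable lborel (\<lambda>x. complex_of_real x * fourier \<phi> x)"
proof -
  obtain \<phi>1 where 1: "test_fun U \<phi>1" "\<And>x. (\<phi> has_vector_derivative \<phi>1 x) (at x)"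
    using test_fun_deriv[OF assms] by blast
  have "(\<lambda>x. complex_of_real x * fourier \<phi> x) = (\<lambda>x. - \<i> * fourier \<phi>1 x)"
    by (auto simp: fourier_deriv[OF assms 1(2)] mult.assoc[symmetric])
  then show ?thesis using fourier_integrable[OF 1(1)] by simp
qed

lemma fourier_tendsto_0:
  assumes "test_fun U \<phi>" shows "(fourier \<phi> \<longlongrightarrow> 0) at_infinity"
proof -
  obtain C where C: "C \<ge> 0" "\<And>t. cmod (fourier \<phi> t) \<le> C / (1 + t\<^sup>2)" using fourier_decay[OF assms] by blast
  have "((\<lambda>t::real. C * (inverse (norm t))) \<longlongrightarrow> 0) at_infinity"
    by (intro tendsto_mult_right_zero tendsto_inverse_0_at_top filterlim_norm_at_top)
  then show ?thesis
  proof (rule tendsto_0_le[where K = 1])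
    have "\<forall>\<^sub>F t::real in at_infinity. norm t \<ge> 1"
      using filterlim_norm_at_top unfolding filterlim_at_top by blast
    then show "\<forall>\<^sub>F t in at_infinity. norm (fourier \<phi> t) \<le> norm (C * inverse (norm t)) * 1"
    proof eventually_elim
      case (elim t)
      have "\<bar>t\<bar> \<le> \<bar>t\<bar> * \<bar>t\<bar>" using elim mult_right_mono[of 1 "\<bar>t\<bar>" "\<bar>t\<bar>"] by simp
      then have "C / (1 + t\<^sup>2) \<le> C / \<bar>t\<bar>"
        using elim C by (intro divide_left_mono) (auto simp: power2_eq_square abs_mult_self_eq add_pos_nonneg)
      then show ?case using C(2)[of t] C(1) by (simp add: divide_inverse abs_mult)
    qed
  qed
qed

text \<open>Serves to evaluate integrals over unbounded sets as limits of integrals over compact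
  intervals, where the fundamental theorem of calculus applies.\<close>

lemma integral_exhaustion:
  fixes f :: "real \<Rightarrow> complex" and A :: "nat \<Rightarrow> real set"
  assumes int: "integrable lborel (\<lambda>x. indicator C x *\<^sub>R f x)"
    and A: "\<And>n. A n \<in> sets borel" "\<And>n. A n \<subseteq> C" "\<And>x. x \<in> C \<Longrightarrow> \<forall>\<^sub>F n in sequentially. x \<in> A n"
  shows "(\<lambda>n. LINT x|lborel. indicator (A n) x *\<^sub>R f x) \<longlonglongrightarrow> (LINT x|lborel. indicator C x *\<^sub>R f x)"
proof -
  have eq: "indicator (A n) x *\<^sub>R f x = indicator (A n) x *\<^sub>R (indicator C x *\<^sub>R f x)" for n x
    using A(2)[of n] by (auto simp: indicator_def)
  show ?thesis
  proof (rule integral_dominated_convergence)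
    show "integrable lborel (\<lambda>x. norm (indicator C x *\<^sub>R f x))" by (rule integrable_norm[OF int])
    show "(\<lambda>x. indicator C x *\<^sub>R f x) \<in> borel_measurable lborel" using int by (rule borel_measurable_integrable)
    then show "(\<lambda>x. indicator (A n) x *\<^sub>R f x) \<in> borel_measurable lborel" for n
      unfolding eq[of n] using A(1)[of n] by measurable
    show "AE x in lborel. norm (indicator (A n) x *\<^sub>R f x) \<le> norm (indicator C x *\<^sub>R f x)" for n
      unfolding eq[of n] by (intro AE_I2) (simp add: indicator_def)
    show "AE x in lborel. (\<lambda>n. indicator (A n) x *\<^sub>R f x) \<longlonglongrightarrow> indicator C x *\<^sub>R f x"
    proof (rule AE_I2)
      fix x
      show "(\<lambda>n. indicator (A n) x *\<^sub>R f x) \<longlonglongrightarrow> indicator C x *\<^sub>R f x"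
      proof (cases "x \<in> C")
        case True
        have "\<forall>\<^sub>F n in sequentially. indicator C x *\<^sub>R f x = indicator (A n) x *\<^sub>R f x"
          using A(3)[OF True] by eventually_elim (simp add: True)
        then show ?thesis by (rule Lim_transform_eventually[rotated]) simp
      next
        case False
        then have "x \<notin> A n" for n using A(2) by blast
        with False show ?thesis by simp
      qed
    qed
  qed
qed

lemma eventually_le_real_sequentially: "\<forall>\<^sub>F n in sequentially. x \<le> real n"
proof -
  obtain m :: nat where "x \<le> m" using real_arch_simple by blast
  then show ?thesis by (intro eventually_sequentiallyI[of m]) linarith
qed

text \<open>Multiplication by t is, up to a constant, differentiation of the transform, so the
  integral is a difference of limits of the transform at plus and minus infinity. This is Fourier
  inversion at 0 for functions vanishing there.\<close>

lemma integral_fourier_times_0: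
  assumes "test_fun U \<phi>"
  shows "(LINT x|lborel. fourier (\<lambda>t. complex_of_real t * \<phi> t) x) = 0"
proof -
  let ?\<psi> = "\<lambda>t. - (\<i> * complex_of_real t) * \<phi> t"
  have t: "test_fun U ?\<psi>"
    using test_fun_mult[OF assms smooth_cmult[OF smooth_of_real, of "-\<i>"]] by simp
  have fin: "(LINT x|lborel. indicator {- real n..real n} x *\<^sub>R fourier ?\<psi> x) = fourier \<phi> n - fourier \<phi> (- real n)" for n
    by (intro integral_FTC_Icc fourier_continuous_on[OF t]
         has_vector_derivative_at_within[OF has_vector_derivative_fourier[OF assms]]) auto
  have "(\<lambda>n. LINT x|lborel. indicator {- real n..real n} x *\<^sub>R fourier ?\<psi> x) \<longlonglongrightarrow> (LINT x|lborel. indicator UNIV x *\<^sub>R fourier ?\<psi> x)"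
  proof (rule integral_exhaustion)
    show "integrable lborel (\<lambda>x. indicator UNIV x *\<^sub>R fourier ?\<psi> x)" using fourier_integrable[OF t] by simp
    show "\<forall>\<^sub>F n in sequentially. x \<in> {- real n..real n}" for x
      using eventually_le_real_sequentially[of "\<bar>x\<bar>"] by eventually_elim auto
  qed auto
  then have "(\<lambda>n. LINT x|lborel. indicator {- real n..real n} x *\<^sub>R fourier ?\<psi> x) \<longlonglongrightarrow> (LINT x|lborel. fourier ?\<psi> x)"
    by simp
  moreover have "(\<lambda>n. fourier \<phi> (real n) - fourier \<phi> (- real n)) \<longlonglongrightarrow> 0 - 0"
    by (intro tendsto_diff filterlim_compose[OF fourier_tendsto_0[OF assms]])
       (simp_all add: filterlim_at_infinity_conv_norm_at_top filterlim_real_sequentially)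
  ultimately have "(LINT x|lborel. fourier ?\<psi> x) = 0"
    unfolding fin using LIMSEQ_unique by fastforce
  moreover have "fourier ?\<psi> x = (-\<i>) * fourier (\<lambda>t. complex_of_real t * \<phi> t) x" for x
    using fourier_cmult[of "-\<i>" "\<lambda>t. complex_of_real t * \<phi> t" x] by (simp add: mult.assoc)
  ultimately show ?thesis by simp
qed

section \<open>Fourier inversion and products\<close>

text \<open>One integrability statement for most later exchanges of integrals: \<open>s\<close> is 1
  for autocorrelations, 0 for plain double transforms and -1 for convolutions, while
  \<open>k\<close> is an oscillating or otherwise bounded factor.\<close>

lemma integrable_pair_shift:
  fixes F G :: "real \<Rightarrow> complex" and k :: "real \<times> real \<Rightarrow> complex"
  assumes F: "integrable lborel F" and G: "integrable lborel G"
    and k: "k \<in> borel_measurable (lborel \<Otimes>\<^sub>M lborel)" "\<And>z. cmod (k z) \<le> 1"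
  shows "integrable (lborel \<Otimes>\<^sub>M lborel) (\<lambda>(u, t). G u * F (t + s * u) * k (u, t))"
proof -
  have [measurable]: "F \<in> borel_measurable borel" "G \<in> borel_measurable borel"
    using F G by auto
  have sh: "integrable lborel (\<lambda>t. F (t + c))" for c
    using lborel_integrable_real_affine[OF F, of 1 c] by (simp add: add.commute)
  have "integrable (lborel \<Otimes>\<^sub>M lborel) (\<lambda>(u, t). G u * F (t + s * u))"
  proof (rule lborel_pair.Fubini_integrable)
    have "(LINT t|lborel. cmod (G u * F (t + s * u))) = cmod (G u) * (LINT t|lborel. cmod (F t))" for u
      using lborel_integral_real_affine[of 1 "\<lambda>t. cmod (F t)" "s * u"] by (simp add: norm_mult add.commute)
    then show "integrable lborel (\<lambda>x. LINT y|lborel. norm (case (x, y) of (u, t) \<Rightarrow> G u * F (t + s * u)))"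
      using G by simp
    show "AE x in lborel. integrable lborel (\<lambda>y. case (x, y) of (u, t) \<Rightarrow> G u * F (t + s * u))"
      using sh by simp
  qed measurable
  then show ?thesis
  proof (rule Bochner_Integration.integrable_bound)
    show "AE x in lborel \<Otimes>\<^sub>M lborel. norm (case x of (u, t) \<Rightarrow> G u * F (t + s * u) * k (u, t))
         \<le> norm (case x of (u, t) \<Rightarrow> G u * F (t + s * u))"
      using k(2) by (auto simp: norm_mult split: prod.split intro!: AE_I2 mult_left_le)
  qed (use k(1) in measurable)
qed

lemma Fubini_pair_shift:
  fixes F G :: "real \<Rightarrow> complex" and k :: "real \<times> real \<Rightarrow> complex"
  assumes F: "integrable lborel F" and G: "integrable lborel G"
    and k: "k \<in> borel_measurable (lborel \<Otimes>\<^sub>M lborel)" "\<And>z. cmod (k z) \<le> 1"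
  shows "(LINT t|lborel. LINT u|lborel. G u * F (t + s * u) * k (u, t)) =
    (LINT u|lborel. LINT t|lborel. G u * F (t + s * u) * k (u, t))"
  using lborel_pair.Fubini_integral[OF integrable_pair_shift[OF F G k, of s]] by simp

text \<open>After exchanging the integrals, translating the inner variable by \<open>u\<close>
  splits off a phase, and the double integral becomes a transform times its conjugate. This is the
  source of test functions with non-negative transforms.\<close>

lemma fourier_autocorrelation:
  fixes g :: "real \<Rightarrow> real"
  assumes g: "test_fun UNIV (\<lambda>u. complex_of_real (g u))"
  shows "fourier (\<lambda>t. LINT u|lborel. complex_of_real (g u) * complex_of_real (g (t + u))) x
     = complex_of_real ((cmod (fourier (\<lambda>u. complex_of_real (g u)) x))\<^sup>2)"
proof -
  let ?g = "\<lambda>u. complex_of_real (g u)"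
  let ?e = "\<lambda>t. exp (- (\<i> * complex_of_real (x * t)))"
  have int: "integrable lborel ?g" by (rule test_fun_integrable[OF g])
  have "fourier (\<lambda>t. LINT u|lborel. ?g u * ?g (t + u)) x = (LINT t|lborel. LINT u|lborel. ?g u * ?g (t + 1 * u) * ?e t)"
    unfolding fourier_def
    by (subst integral_mult_right_zero[symmetric]) (simp add: mult_ac)
  also have "\<dots> = (LINT u|lborel. LINT t|lborel. ?g u * ?g (t + 1 * u) * ?e t)"
    using Fubini_pair_shift[OF int int, of "\<lambda>z. ?e (snd z)" 1] by simp
  also have "\<dots> = (LINT u|lborel. cnj (?e u * ?g u) * fourier ?g x)"
  proof (intro Bochner_Integration.integral_cong refl)
    fix u
    have "(LINT t|lborel. ?g u * ?g (t + 1 * u) * ?e t) = ?g u * fourier (\<lambda>t. ?g (t + u)) x"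
      unfolding fourier_def by (subst integral_mult_right_zero[symmetric]) (simp add: mult_ac)
    also have "fourier ?g x = ?e u * fourier (\<lambda>t. ?g (t + u)) x"
      using fourier_affine[of 1 ?g x u] by simp
    then have "fourier (\<lambda>t. ?g (t + u)) x = cnj (?e u) * fourier ?g x"
      by (simp add: exp_cnj mult.assoc[symmetric] exp_add[symmetric])
    finally show "(LINT t|lborel. ?g u * ?g (t + 1 * u) * ?e t) = cnj (?e u * ?g u) * fourier ?g x"
      by (simp add: mult_ac)
  qed
  also have "\<dots> = cnj (fourier ?g x) * fourier ?g x"
  proof -
    have "(LINT u|lborel. cnj (?e u * ?g u)) = cnj (fourier ?g x)"
      unfolding fourier_def by (rule Bochner_Integration.integral_cnj)
    then show ?thesis by (subst integral_mult_left_zero) simp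
  qed
  finally show ?thesis using complex_norm_square[of "fourier ?g x"] by (simp add: mult.commute)
qed

text \<open>\<open>\<phi>\<close> is the autocorrelation of the unit bump and \<open>k\<close> the
  squared modulus of the bump's transform. Compact support allows localisation in frequency;
  positivity allows inequalities to be read off from integrals against \<open>k\<close>.\<close>

lemma positive_kernel:
  obtains \<phi> :: "real \<Rightarrow> complex" and k :: "real \<Rightarrow> real" and d \<kappa> :: real
  where "test_fun {-2..2} \<phi>" "\<And>x. fourier \<phi> x = complex_of_real (k x)" "\<And>x. k x \<ge> 0"
    "d > 0" "\<kappa> > 0" "\<And>x. \<bar>x\<bar> \<le> d \<Longrightarrow> k x \<ge> \<kappa>"
    "integrable lborel k" "(LINT x|lborel. k x) > 0"
proof -
  let ?b = "\<lambda>u. complex_of_real (unit_bump u)"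
  define \<phi> where "\<phi> = (\<lambda>t. LINT u|lborel. ?b u * ?b (t + u))"
  have b: "test_fun UNIV ?b" using test_fun_unit_bump test_fun_mono by blast
  have cont: "continuous_on UNIV unit_bump"
    using continuous_on_Re[OF smooth_continuous_on[OF smooth_unit_bump, of UNIV]] by simp
  have four: "fourier \<phi> x = complex_of_real ((cmod (fourier ?b x))\<^sup>2)" for x
    unfolding \<phi>_def by (rule fourier_autocorrelation[OF b])
  have prod: "test_fun UNIV (\<lambda>u. ?b (1 * u + t) * ?b u)" for t
    by (rule test_fun_mult[OF b smooth_affine[OF smooth_unit_bump]])
  have "\<phi> t = integral {-1..1} (\<lambda>u. ?b u * ?b (1 * t + u))" for t
  proof -
    have "\<phi> t = integral UNIV (\<lambda>u. ?b u * ?b (1 * t + u))"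
      unfolding \<phi>_def using integral_lborel[OF test_fun_integrable[OF prod[of t]]]
      by (simp add: mult.commute add.commute)
    also have "\<dots> = integral {-1..1} (\<lambda>u. ?b u * ?b (1 * t + u))"
    proof -
      have "(\<lambda>u. ?b u * ?b (1 * t + u)) = (\<lambda>u. if u \<in> {-1..1} then ?b u * ?b (1 * t + u) else 0)"
        using unit_bump_support by (intro ext) (auto simp: abs_le_iff)
      then show ?thesis
        using Henstock_Kurzweil_Integration.integral_restrict_UNIV[of "{-1..1}" "\<lambda>u. ?b u * ?b (1 * t + u)"]
        by presburger
    qed
    finally show ?thesis .
  qed
  then have "\<phi> = (\<lambda>t. integral {-1..1} (\<lambda>u. ?b u * ?b (1 * t + u)))" by blast
  then have sm: "smooth \<phi>"
    using smooth_param_integral[OF smooth_unit_bump, of "-1" 1 ?b "\<lambda>_. 1" "\<lambda>u. u"]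
    by (simp add: continuous_on_subset[OF cont])
  have zero: "\<phi> t = 0" if "t \<notin> {-2..2}" for t
  proof -
    have "unit_bump u * unit_bump (t + u) = 0" for u
    proof -
      have "\<bar>u\<bar> \<ge> 1 \<or> \<bar>t + u\<bar> \<ge> 1" using that by (auto simp: not_le)
      then show ?thesis using unit_bump_support by auto
    qed
    then have "(\<lambda>u. ?b u * ?b (t + u)) = (\<lambda>_. 0)" by auto
    then show ?thesis unfolding \<phi>_def by simp
  qed
  have tf: "test_fun {-2..2} \<phi>" by (rule test_funI[of _ "{-2..2}"]) (use sm zero in auto)
  have "cmod (fourier ?b 0) > 0"
  proof -
    have "integrable lborel unit_bump" using test_fun_integrable[OF b] by (simp add: complex_of_real_integrable_eq)
    have "fourier ?b 0 = complex_of_real (LINT u|lborel. unit_bump u)" unfolding fourier_def by simp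
    moreover have "(LINT u|lborel. unit_bump u) > 0"
    proof -
      have "isCont unit_bump 0" using cont by (simp add: continuous_on_eq_continuous_at)
      then obtain e where e: "e > 0" "\<And>u. \<bar>u\<bar> < e \<Longrightarrow> \<bar>unit_bump u - 1\<bar> < 1/2"
        unfolding continuous_at_eps_delta dist_real_def by (metis diff_zero half_gt_zero unit_bump_0 zero_less_one)
      have "integral\<^sup>L lborel (\<lambda>u. (1/2) * indicator {-e/2..e/2} u) \<le> (LINT u|lborel. unit_bump u)"
      proof (rule integral_mono)
        fix u show "(1/2) * indicator {-e/2..e/2} u \<le> unit_bump u"
        proof (cases "u \<in> {-e/2..e/2}")
          case True
          then have "\<bar>u\<bar> < e" using e(1) by auto
          from e(2)[OF this] have "1/2 \<le> unit_bump u" by linarith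
          with True show ?thesis by simp
        qed (simp add: unit_bump_nonneg)
      qed (use \<open>integrable lborel unit_bump\<close> e in auto)
      moreover have "integral\<^sup>L lborel (\<lambda>u. (1/2) * indicator {-e/2..e/2} u) = e / 2" using e by simp
      ultimately show ?thesis using e by linarith
    qed
    ultimately show ?thesis by simp
  qed
  then have pos: "(cmod (fourier ?b 0))\<^sup>2 > 0" by simp
  define \<kappa> where "\<kappa> = (cmod (fourier ?b 0))\<^sup>2 / 2"
  have "isCont (\<lambda>x. (cmod (fourier ?b x))\<^sup>2) 0"
    using fourier_continuous_on[OF b, of UNIV] by (auto intro!: continuous_intros simp: continuous_on_eq_continuous_at)
  then obtain e where e: "e > 0" "\<And>x. \<bar>x\<bar> < e \<Longrightarrow> \<bar>(cmod (fourier ?b x))\<^sup>2 - (cmod (fourier ?b 0))\<^sup>2\<bar> < \<kappa>"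
    unfolding continuous_at_eps_delta dist_real_def using pos unfolding \<kappa>_def by (metis diff_zero half_gt_zero)
  have low: "(cmod (fourier ?b x))\<^sup>2 \<ge> \<kappa>" if "\<bar>x\<bar> \<le> e / 2" for x
  proof -
    have "\<bar>x\<bar> < e" using that e(1) by linarith
    then have "\<bar>(cmod (fourier ?b x))\<^sup>2 - (cmod (fourier ?b 0))\<^sup>2\<bar> < \<kappa>" by (rule e(2))
    moreover have "(cmod (fourier ?b 0))\<^sup>2 = 2 * \<kappa>" by (simp add: \<kappa>_def)
    ultimately show ?thesis by linarith
  qed
  have \<kappa>: "\<kappa> > 0" using pos by (simp add: \<kappa>_def)
  let ?k = "\<lambda>x. (cmod (fourier ?b x))\<^sup>2"
  have ki: "integrable lborel ?k"
  proof -
    have "fourier \<phi> = (\<lambda>x. complex_of_real (?k x))" using four by blast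
    then show ?thesis using fourier_integrable[OF test_fun_mono[OF tf subset_UNIV]]
      by (simp only: complex_of_real_integrable_eq)
  qed
  have "integral\<^sup>L lborel (\<lambda>u. \<kappa> * indicator {- (e / 2)..e / 2} u) \<le> (LINT u|lborel. ?k u)"
  proof (rule integral_mono)
    fix u show "\<kappa> * indicator {- (e / 2)..e / 2} u \<le> ?k u"
      using low[of u] by (auto simp: indicator_def abs_le_iff)
  qed (use ki e(1) in auto)
  moreover have "integral\<^sup>L lborel (\<lambda>u. \<kappa> * indicator {- (e / 2)..e / 2} u) = \<kappa> * e" using e(1) by simp
  moreover have "\<kappa> * e > 0" using \<kappa> e(1) by simp
  ultimately have "(LINT u|lborel. ?k u) > 0" by linarith
  with that[of \<phi> ?k "e / 2" \<kappa>] tf four low e(1) \<kappa> ki show ?thesis by simp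
qed

text \<open>The constant is $2\pi$, but only its non-vanishing matters below.\<close>

lemma fourier_inversion:
  obtains c where "c \<noteq> 0"
    "\<And>\<phi> t. test_fun UNIV \<phi> \<Longrightarrow> (LINT x|lborel. exp (\<i> * complex_of_real (t * x)) * fourier \<phi> x) = c * \<phi> t"
proof -
  obtain \<eta> where \<eta>: "test_fun UNIV \<eta>" "\<And>x. 0 \<le> x \<Longrightarrow> x \<le> 0 \<Longrightarrow> \<eta> x = 1"
    using test_fun_cutoff[of 0 0] by metis
  define c where "c = (LINT x|lborel. fourier \<eta> x)"
  \<comment> \<open>Subtracting \<open>\<phi> 0 * \<eta>\<close> leaves a function of the form x
    g(x), whose transform has integral 0; so the integral of the transform depends on
    \<open>\<phi>\<close> only through \<open>\<phi> 0\<close>.\<close>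
  have at_0: "(LINT x|lborel. fourier \<phi> x) = c * \<phi> 0" if \<phi>: "test_fun UNIV \<phi>" for \<phi>
  proof -
    have \<eta>': "test_fun UNIV (\<lambda>t. \<phi> 0 * \<eta> t)" by (rule test_fun_cmult[OF \<eta>(1)])
    let ?f = "\<lambda>t. \<phi> t - \<phi> 0 * \<eta> t"
    have f: "test_fun UNIV ?f" by (rule test_fun_diff[OF \<phi> \<eta>'])
    obtain g where g: "smooth g" "\<And>x. ?f x = x * g x"
      using smooth_divide_at_zero[OF test_fun_smooth[OF f]] \<eta>(2) by auto
    obtain R where R: "R > 0" "\<And>x. \<bar>x\<bar> > R \<Longrightarrow> ?f x = 0" using test_fun_cball[OF f] by metis
    have "test_fun UNIV g"
    proof (rule test_funI[of _ "{-R..R}"])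
      fix x assume "x \<notin> {-R..R}"
      then have "\<bar>x\<bar> > R" by (auto simp: abs_le_iff not_le)
      then show "g x = 0" using R g(2)[of x] by fastforce
    qed (use g in auto)
    from integral_fourier_times_0[OF this] have "(LINT x|lborel. fourier ?f x) = 0"
      using g(2) by simp
    moreover have "fourier ?f x = fourier \<phi> x - \<phi> 0 * fourier \<eta> x" for x
      by (simp only: fourier_diff[OF test_fun_integrable[OF \<phi>] test_fun_integrable[OF \<eta>']] fourier_cmult)
    ultimately show ?thesis
      using fourier_integrable[OF \<phi>] fourier_integrable[OF \<eta>(1)] by (simp add: c_def)
  qed
  have "(LINT x|lborel. exp (\<i> * complex_of_real (t * x)) * fourier \<phi> x) = c * \<phi> t" if \<phi>: "test_fun UNIV \<phi>" for \<phi> t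
  proof -
    have sh: "test_fun UNIV (\<lambda>s. \<phi> (1 * s + t))" using test_fun_scale[OF \<phi>, of 1 t] by simp
    have "exp (\<i> * complex_of_real (t * x)) * fourier \<phi> x = fourier (\<lambda>s. \<phi> (1 * s + t)) x" for x
      using fourier_affine[of 1 \<phi> x t]
      by (simp add: exp_mult_exp mult.commute[of x t])
    then show ?thesis using at_0[OF sh] by simp
  qed
  \<comment> \<open>The kernel \<open>k\<close> has a non-zero integral, which equals
    \<open>c\<close> times the value of a test function at 0.\<close>
  moreover have "c \<noteq> 0"
  proof -
    obtain \<phi> k where k: "test_fun {-2..2} \<phi>" "\<And>x. fourier \<phi> x = complex_of_real (k x)" "\<And>x. k x \<ge> 0"
      "(LINT x|lborel. k x) > 0" using positive_kernel by metis
    have \<phi>: "test_fun UNIV \<phi>" by (rule test_fun_mono[OF k(1)]) simp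
    have "(LINT u|lborel. k u) \<noteq> 0" using k(4) by simp
    then show "c \<noteq> 0" using at_0[OF \<phi>] k(2) by auto
  qed
  ultimately show ?thesis using that by blast
qed

text \<open>Writing \<open>g\<close> through the inversion formula and exchanging the integrals
  turns the transform of the product into a convolution; \<open>c\<close> is the inversion
  constant.\<close>

lemma fourier_mult:
  obtains c where "c \<noteq> 0"
    "\<And>f g x. test_fun UNIV f \<Longrightarrow> test_fun UNIV g \<Longrightarrow>
       c * fourier (\<lambda>t. f t * g t) x = (LINT y|lborel. fourier f (x - y) * fourier g y)"
proof -
  obtain c where c: "c \<noteq> 0"
    "\<And>\<phi> t. test_fun UNIV \<phi> \<Longrightarrow> (LINT x|lborel. exp (\<i> * complex_of_real (t * x)) * fourier \<phi> x) = c * \<phi> t"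
    using fourier_inversion by metis
  have "c * fourier (\<lambda>t. f t * g t) x = (LINT y|lborel. fourier f (x - y) * fourier g y)"
    if f: "test_fun UNIV f" and g: "test_fun UNIV g" for f g x
  proof -
    let ?e = "\<lambda>t. exp (- (\<i> * complex_of_real (x * t)))"
    let ?k = "\<lambda>t y. exp (\<i> * complex_of_real (t * y - x * t))"
    have "c * fourier (\<lambda>t. f t * g t) x = (LINT t|lborel. c * (?e t * (f t * g t)))"
      unfolding fourier_def by (rule integral_mult_right_zero[symmetric])
    also have "\<dots> = (LINT t|lborel. ?e t * f t * (LINT y|lborel. exp (\<i> * complex_of_real (t * y)) * fourier g y))"
      unfolding c(2)[OF g] by (simp add: mult_ac)
    also have "\<dots> = (LINT t|lborel. LINT y|lborel. fourier g y * f (t + 0 * y) * ?k t y)"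
    proof (intro Bochner_Integration.integral_cong refl)
      fix t
      have k: "?k t y = ?e t * exp (\<i> * complex_of_real (t * y))" for y
      proof -
        have "\<i> * complex_of_real (t * y - x * t) = - (\<i> * complex_of_real (x * t)) + \<i> * complex_of_real (t * y)"
          by (simp add: algebra_simps)
        then show ?thesis by (simp only: exp_add)
      qed
      have "?e t * f t * (exp (\<i> * complex_of_real (t * y)) * fourier g y) = fourier g y * f (t + 0 * y) * ?k t y" for y
        unfolding k by (simp only: mult_zero_left add_0_right mult_ac)
      then show "?e t * f t * (LINT y|lborel. exp (\<i> * complex_of_real (t * y)) * fourier g y) =
          (LINT y|lborel. fourier g y * f (t + 0 * y) * ?k t y)"
        by (simp only: integral_mult_right_zero[symmetric])
    qed
    also have "\<dots> = (LINT y|lborel. LINT t|lborel. fourier g y * f (t + 0 * y) * ?k t y)"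
      using Fubini_pair_shift[OF test_fun_integrable[OF f] fourier_integrable[OF g], of "\<lambda>(y, t). ?k t y" 0]
      by (auto simp: split_beta norm_exp_eq_Re)
    also have "\<dots> = (LINT y|lborel. fourier f (x - y) * fourier g y)"
    proof (intro Bochner_Integration.integral_cong refl)
      fix y
      have "?k t y = exp (- (\<i> * complex_of_real ((x - y) * t)))" for t
        by (simp add: algebra_simps)
      then show "(LINT t|lborel. fourier g y * f (t + 0 * y) * ?k t y) = fourier f (x - y) * fourier g y"
        unfolding fourier_def[of f] integral_mult_left_zero[symmetric]
        by (simp only: mult_zero_left add_0_right mult_ac)
    qed
    finally show ?thesis .
  qed
  with c(1) that show ?thesis by blast
qed

text \<open>The Wiener algebra norm up to normalisation: it bounds pairings with bounded functions,
  is invariant under affine substitutions, and is submultiplicative up to a constant.\<close>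

definition fourier_norm :: "(real \<Rightarrow> complex) \<Rightarrow> real" where
  "fourier_norm \<phi> = (LINT x|lborel. cmod (fourier \<phi> x))"

lemma fourier_norm_nonneg: "fourier_norm \<phi> \<ge> 0"
  by (simp add: fourier_norm_def)

lemma fourier_norm_cmult: "fourier_norm (\<lambda>x. c * \<phi> x) = cmod c * fourier_norm \<phi>"
  by (simp add: fourier_norm_def fourier_cmult norm_mult)

lemma fourier_norm_add:
  assumes "test_fun UNIV f" "test_fun UNIV g"
  shows "fourier_norm (\<lambda>x. f x + g x) \<le> fourier_norm f + fourier_norm g"
proof -
  have "fourier_norm (\<lambda>x. f x + g x) \<le> (LINT x|lborel. cmod (fourier f x) + cmod (fourier g x))"
    unfolding fourier_norm_def
    using fourier_integrable[OF assms(1)] fourier_integrable[OF assms(2)] fourier_integrable[OF test_fun_add[OF assms]]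
    by (intro integral_mono)
       (auto simp: fourier_add[OF test_fun_integrable[OF assms(1)] test_fun_integrable[OF assms(2)]] norm_triangle_ineq)
  also have "\<dots> = fourier_norm f + fourier_norm g"
    unfolding fourier_norm_def
    using fourier_integrable[OF assms(1)] fourier_integrable[OF assms(2)] by simp
  finally show ?thesis .
qed

lemma fourier_norm_affine:
  assumes "p \<noteq> 0"
  shows "fourier_norm (\<lambda>x. \<phi> (p * x + q)) = fourier_norm \<phi>"
proof -
  have "fourier_norm \<phi> = (LINT y|lborel. \<bar>p\<bar> * cmod (fourier (\<lambda>x. \<phi> (p * x + q)) (p * y)))"
    unfolding fourier_norm_def by (subst fourier_affine[OF assms, of \<phi> _ q]) (simp add: norm_mult)
  also have "\<dots> = fourier_norm (\<lambda>x. \<phi> (p * x + q))"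
    using lborel_integral_real_affine[OF assms, of "\<lambda>y. cmod (fourier (\<lambda>x. \<phi> (p * x + q)) y)" 0]
    by (simp add: fourier_norm_def)
  finally show ?thesis by simp
qed

text \<open>Young's inequality for the convolution of the two transforms.\<close>

lemma fourier_norm_mult:
  obtains C where "C > 0"
    "\<And>f g. test_fun UNIV f \<Longrightarrow> test_fun UNIV g \<Longrightarrow>
       fourier_norm (\<lambda>t. f t * g t) \<le> C * fourier_norm f * fourier_norm g"
proof -
  obtain c where c: "c \<noteq> 0"
    "\<And>f g x. test_fun UNIV f \<Longrightarrow> test_fun UNIV g \<Longrightarrow>
       c * fourier (\<lambda>t. f t * g t) x = (LINT y|lborel. fourier f (x - y) * fourier g y)"
    using fourier_mult by metis
  have "fourier_norm (\<lambda>t. f t * g t) \<le> 1 / cmod c * fourier_norm f * fourier_norm g"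
    if f: "test_fun UNIV f" and g: "test_fun UNIV g" for f g
  proof -
    note [measurable] = fourier_measurable[OF f] fourier_measurable[OF g]
    have fg: "test_fun UNIV (\<lambda>t. f t * g t)" by (rule test_fun_mult[OF g test_fun_smooth[OF f]])
    have int: "integrable (lborel \<Otimes>\<^sub>M lborel) (\<lambda>(y, x). fourier g y * fourier f (x - y))"
      using integrable_pair_shift[OF fourier_integrable[OF f] fourier_integrable[OF g], of "\<lambda>_. 1" "-1"] by simp
    have int': "integrable (lborel \<Otimes>\<^sub>M lborel) (\<lambda>(y, x). cmod (fourier g y * fourier f (x - y)))"
      using integrable_norm[OF int] by (simp add: case_prod_unfold)
    have "cmod c * fourier_norm (\<lambda>t. f t * g t) = (LINT x|lborel. cmod (LINT y|lborel. fourier g y * fourier f (x - y)))"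
      unfolding fourier_norm_def integral_mult_right_zero[symmetric] norm_mult[symmetric] c(2)[OF f g]
      by (simp add: mult.commute)
    also have "\<dots> \<le> (LINT x|lborel. LINT y|lborel. cmod (fourier g y * fourier f (x - y)))"
    proof (rule integral_mono)
      have "integrable lborel (\<lambda>x. cmod (c * fourier (\<lambda>t. f t * g t) x))"
        using fourier_integrable[OF fg] by simp
      then show "integrable lborel (\<lambda>x. cmod (LINT y|lborel. fourier g y * fourier f (x - y)))"
        unfolding c(2)[OF f g] by (simp add: mult.commute)
      show "integrable lborel (\<lambda>x. LINT y|lborel. cmod (fourier g y * fourier f (x - y)))"
        using lborel_pair.integrable_snd[OF int'] by simp
    qed (rule integral_norm_bound)
    also have "\<dots> = (LINT y|lborel. LINT x|lborel. cmod (fourier g y * fourier f (x - y)))"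
      using lborel_pair.Fubini_integral[OF int'] by simp
    also have "\<dots> = (LINT y|lborel. cmod (fourier g y) * fourier_norm f)"
    proof (intro Bochner_Integration.integral_cong refl)
      fix y
      show "(LINT x|lborel. cmod (fourier g y * fourier f (x - y))) = cmod (fourier g y) * fourier_norm f"
        using lborel_integral_real_affine[of 1 "\<lambda>x. cmod (fourier f x)" "-y"]
        by (simp add: norm_mult fourier_norm_def)
    qed
    also have "\<dots> = fourier_norm f * fourier_norm g" by (simp add: fourier_norm_def)
    finally show ?thesis using c(1) by (simp add: field_simps)
  qed
  moreover have "1 / cmod c > 0" using c(1) by simp
  ultimately show ?thesis using that by blast
qed

section \<open>Removing null sets of singular frequencies\<close>

lemma fourier_shift_integrable:
  assumes "test_fun U \<phi>" shows "integrable lborel (\<lambda>x. fourier \<phi> (x - h))"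
  using lborel_integrable_real_affine[OF fourier_integrable[OF assms], of 1 "-h"] by simp

text \<open>Continuity in the frequency makes the level sets in the Baire argument closed.\<close>

lemma continuous_fourier_integrable:
  assumes "integrable lborel f" shows "continuous_on UNIV (fourier f)"
proof -
  have "isCont (fourier f) x" for x
    unfolding continuous_at_sequentially comp_def
  proof (intro allI impI)
    fix X :: "nat \<Rightarrow> real" assume X: "X \<longlonglongrightarrow> x"
    show "(\<lambda>n. fourier f (X n)) \<longlonglongrightarrow> fourier f x"
      unfolding fourier_def
    proof (rule integral_dominated_convergence)
      show "integrable lborel (\<lambda>x. cmod (f x))" using assms by simp
      show "AE u in lborel. (\<lambda>n. exp (- (\<i> * complex_of_real (X n * u))) * f u) \<longlonglongrightarrow> exp (- (\<i> * complex_of_real (x * u))) * f u"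
        by (intro AE_I2 tendsto_intros X)
      show "AE u in lborel. cmod (exp (- (\<i> * complex_of_real (X n * u))) * f u) \<le> cmod (f u)" for n
        by (simp only: norm_mult norm_cis_minus) simp
    qed (use assms in measurable)
  qed
  then show ?thesis by (simp add: continuous_at_imp_continuous_on)
qed

text \<open>For positive \<open>\<delta>\<close>, the part of \<open>\<phi>\<close> within distance
  \<open>\<delta>\<close> of \<open>\<delta> * k\<close>. The dilation is written as
  \<open>1 / \<delta> * t + - k\<close> to match the lemmas on affine substitutions.\<close>

definition bump_piece :: "real \<Rightarrow> int \<Rightarrow> (real \<Rightarrow> complex) \<Rightarrow> real \<Rightarrow> complex" where
  "bump_piece \<delta> k \<phi> = (\<lambda>t. complex_of_real (unit_bump (1 / \<delta> * t + - real_of_int k)) * \<phi> t)"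

lemma test_fun_bump_piece: "test_fun U \<phi> \<Longrightarrow> test_fun U (bump_piece \<delta> k \<phi>)"
  unfolding bump_piece_def by (rule test_fun_mult[OF _ smooth_affine[OF smooth_unit_bump]])

lemma test_fun_bump_piece_local:
  assumes "test_fun U \<phi>" "\<delta> > 0"
  shows "test_fun (supp \<phi> \<inter> {\<delta> * (real_of_int k - 1)..\<delta> * (real_of_int k + 1)}) (bump_piece \<delta> k \<phi>)"
proof (rule test_funI[of _ "supp \<phi> \<inter> {\<delta> * (real_of_int k - 1)..\<delta> * (real_of_int k + 1)}"])
  show "smooth (bump_piece \<delta> k \<phi>)" using test_fun_smooth[OF test_fun_bump_piece[OF assms(1)]] .
  show "compact (supp \<phi> \<inter> {\<delta> * (real_of_int k - 1)..\<delta> * (real_of_int k + 1)})"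
    using assms(1) unfolding test_fun_iff by (intro compact_Int_closed) auto
  show "bump_piece \<delta> k \<phi> x = 0" if "x \<notin> supp \<phi> \<inter> {\<delta> * (real_of_int k - 1)..\<delta> * (real_of_int k + 1)}" for x
  proof (cases "x \<in> supp \<phi>")
    case True
    then have "x < \<delta> * (real_of_int k - 1) \<or> x > \<delta> * (real_of_int k + 1)" using that by auto
    then have "1 / \<delta> * x + - real_of_int k < - 1 \<or> 1 / \<delta> * x + - real_of_int k > 1"
      using assms(2) by (auto simp: field_simps)
    then have "unit_bump (1 / \<delta> * x + - real_of_int k) = 0" by (intro unit_bump_support) linarith
    then show ?thesis unfolding bump_piece_def by simp
  next
    case False
    from zero_outside_supp[OF this] show ?thesis unfolding bump_piece_def by simp
  qed
qed simp

lemma bump_piece_decomposition: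
  assumes "test_fun U \<phi>" "\<delta> > 0"
  obtains J where "finite J" "\<phi> = (\<lambda>t. \<Sum>k\<in>J. bump_piece \<delta> k \<phi> t)"
proof -
  obtain R where R: "R > 0" "\<And>x. \<bar>x\<bar> > R \<Longrightarrow> \<phi> x = 0" using test_fun_cball[OF assms(1)] by blast
  obtain n :: nat where n: "R / \<delta> \<le> n" using real_arch_simple by blast
  let ?J = "{- int n - 1..int n + 1}"
  have "\<phi> t = (\<Sum>k\<in>?J. bump_piece \<delta> k \<phi> t)" for t
  proof (cases "\<bar>t\<bar> > R")
    case True
    from R(2)[OF this] show ?thesis by (simp add: bump_piece_def)
  next
    case False
    have "\<bar>t / \<delta>\<bar> \<le> R / \<delta>" using False assms(2) by (simp add: abs_divide divide_right_mono)
    then have "\<bar>t / \<delta>\<bar> \<le> n" using n by linarith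
    from sum_unit_bump[OF this] have s: "(\<Sum>k\<in>?J. unit_bump (1 / \<delta> * t + - real_of_int k)) = 1" by simp
    have "(\<Sum>k\<in>?J. bump_piece \<delta> k \<phi> t) = complex_of_real (\<Sum>k\<in>?J. unit_bump (1 / \<delta> * t + - real_of_int k)) * \<phi> t"
      unfolding bump_piece_def of_real_sum sum_distrib_right ..
    then show ?thesis unfolding s by simp
  qed
  then have "\<phi> = (\<lambda>t. \<Sum>k\<in>?J. bump_piece \<delta> k \<phi> t)" by blast
  then show ?thesis using that[of ?J] by blast
qed

section \<open>Averages of a bounded signal against translated Fourier kernels\<close>

locale bounded_signal =
  fixes \<rho> :: "real \<Rightarrow> real" and B :: real
  assumes \<rho>_measurable [measurable]: "\<rho> \<in> borel_measurable borel"
    and \<rho>_bounded: "\<bar>\<rho> x\<bar> \<le> B"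
    and \<rho>_neg: "x < 0 \<Longrightarrow> \<rho> x = 0"
begin

text \<open>This is the Fourier transform of \<open>\<rho>\<close>, as a distribution, tested on
  \<open>\<phi>\<close> times exp(i h t): the modulation appears as a translation by
  \<open>h\<close>.\<close>

definition pairing :: "(real \<Rightarrow> complex) \<Rightarrow> real \<Rightarrow> complex" where
  "pairing \<phi> h = (LINT x|lborel. complex_of_real (\<rho> x) * fourier \<phi> (x - h))"

text \<open>A Riemann-Lebesgue condition. As \<open>\<rho>\<close> lives on the half line, only the
  direction of large positive \<open>h\<close> carries information.\<close>

definition vanishing :: "(real \<Rightarrow> complex) \<Rightarrow> bool" where
  "vanishing \<phi> \<longleftrightarrow> (pairing \<phi> \<longlongrightarrow> 0) at_top"

lemma B_nonneg: "B \<ge> 0"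
  using \<rho>_bounded[of 0] by linarith

lemma pairing_integrable:
  assumes "test_fun U \<phi>"
  shows "integrable lborel (\<lambda>x. complex_of_real (\<rho> x) * fourier \<phi> (x - h))"
proof (rule Bochner_Integration.integrable_bound)
  show "integrable lborel (\<lambda>x. B * cmod (fourier \<phi> (x - h)))"
    using fourier_shift_integrable[OF assms] by simp
  show "AE x in lborel. norm (complex_of_real (\<rho> x) * fourier \<phi> (x - h)) \<le> norm (B * cmod (fourier \<phi> (x - h)))"
    using \<rho>_bounded B_nonneg by (intro AE_I2) (auto simp: norm_mult abs_mult intro!: mult_right_mono)
qed (use fourier_measurable[OF assms] in measurable)

lemma pairing_sum:
  assumes "\<And>i. i \<in> I \<Longrightarrow> test_fun U (\<phi> i)"
  shows "pairing (\<lambda>t. \<Sum>i\<in>I. \<phi> i t) h = (\<Sum>i\<in>I. pairing (\<phi> i) h)"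
proof -
  have "fourier (\<lambda>t. \<Sum>i\<in>I. \<phi> i t) (x - h) = (\<Sum>i\<in>I. fourier (\<phi> i) (x - h))" for x
    by (rule fourier_sum) (rule test_fun_integrable[OF assms])
  then show ?thesis
    unfolding pairing_def using pairing_integrable[OF assms]
    by (simp add: sum_distrib_left)
qed

lemma vanishing_sum:
  assumes "\<And>i. i \<in> I \<Longrightarrow> test_fun U (\<phi> i)" "\<And>i. i \<in> I \<Longrightarrow> vanishing (\<phi> i)"
  shows "vanishing (\<lambda>t. \<Sum>i\<in>I. \<phi> i t)"
proof -
  have "pairing (\<lambda>t. \<Sum>i\<in>I. \<phi> i t) = (\<lambda>h. \<Sum>i\<in>I. pairing (\<phi> i) h)"
    by (intro ext pairing_sum[OF assms(1)])
  then show ?thesis using assms(2) unfolding vanishing_def by (simp only: tendsto_null_sum)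
qed

lemma vanishing_zero: "test_fun {} \<phi> \<Longrightarrow> vanishing \<phi>"
proof -
  assume "test_fun {} \<phi>"
  then have "supp \<phi> = {}" by (simp add: test_fun_iff)
  then have "\<phi> x = 0" for x by (intro zero_outside_supp[of x \<phi>]) simp
  then have "\<phi> = (\<lambda>_. 0)" by (rule ext)
  then show "vanishing \<phi>" by (simp add: vanishing_def pairing_def[abs_def] fourier_def)
qed

definition regular :: "real set" where
  "regular = {t. \<exists>V. open V \<and> t \<in> V \<and> (\<forall>\<psi>. test_fun V \<psi> \<longrightarrow> vanishing \<psi>)}"

lemma open_regular: "open regular"
proof (subst open_subopen, intro ballI)
  fix t assume "t \<in> regular"
  then obtain V where "open V" "t \<in> V" "\<forall>\<psi>. test_fun V \<psi> \<longrightarrow> vanishing \<psi>" by (auto simp: regular_def)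
  then show "\<exists>T. open T \<and> t \<in> T \<and> T \<subseteq> regular" by (intro exI[of _ V]) (auto simp: regular_def)
qed

text \<open>From local to global: the cover of the compact support by good open sets has a Lebesgue
  number, and every sufficiently short piece lies in one of these sets.\<close>

lemma vanishing_if_regular:
  assumes \<phi>: "test_fun regular \<phi>"
  shows "vanishing \<phi>"
proof -
  let ?G = "{V. open V \<and> (\<forall>\<psi>. test_fun V \<psi> \<longrightarrow> vanishing \<psi>)}"
  have "compact (supp \<phi>)" "supp \<phi> \<subseteq> regular"
    using \<phi> unfolding test_fun_iff[of regular \<phi>] by blast+
  moreover have "regular \<subseteq> \<Union>?G" unfolding regular_def by blast
  ultimately have c: "compact (supp \<phi>)" "supp \<phi> \<subseteq> \<Union>?G" by blast+
  obtain e where e: "e > 0" "\<And>x. x \<in> supp \<phi> \<Longrightarrow> \<exists>G\<in>?G. ball x e \<subseteq> G"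
    by (rule Heine_Borel_lemma[OF c]) (simp, rule that)
  \<comment> \<open>A piece has length at most \<open>2 * \<delta>\<close>, hence lies in the ball
    of radius \<open>e\<close> around any of its points.\<close>
  define \<delta> where "\<delta> = e / 3"
  have \<delta>: "\<delta> > 0" using e by (simp add: \<delta>_def)
  obtain J where J: "finite J" "\<phi> = (\<lambda>t. \<Sum>k\<in>J. bump_piece \<delta> k \<phi> t)"
    using bump_piece_decomposition[OF \<phi> \<delta>] by blast
  have "vanishing (bump_piece \<delta> k \<phi>)" for k
  proof (cases "supp \<phi> \<inter> {\<delta> * (real_of_int k - 1)..\<delta> * (real_of_int k + 1)} = {}")
    case True
    then show ?thesis using test_fun_bump_piece_local[OF \<phi> \<delta>, of k] by (intro vanishing_zero) simp
  next
    case False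
    then obtain x where x: "x \<in> supp \<phi>" "x \<in> {\<delta> * (real_of_int k - 1)..\<delta> * (real_of_int k + 1)}" by blast
    obtain G where "G \<in> ?G" and G3: "ball x e \<subseteq> G" using e(2)[OF x(1)] ..
    then have G: "\<And>\<psi>. test_fun G \<psi> \<Longrightarrow> vanishing \<psi>" by simp
    have "supp \<phi> \<inter> {\<delta> * (real_of_int k - 1)..\<delta> * (real_of_int k + 1)} \<subseteq> ball x e"
    proof
      fix y assume "y \<in> supp \<phi> \<inter> {\<delta> * (real_of_int k - 1)..\<delta> * (real_of_int k + 1)}"
      then have "\<bar>x - y\<bar> \<le> 2 * \<delta>" using x(2) by (auto simp: algebra_simps abs_le_iff)
      then show "y \<in> ball x e" using e(1) by (simp add: dist_real_def \<delta>_def)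
    qed
    then have "test_fun G (bump_piece \<delta> k \<phi>)"
      using G3 by (intro test_fun_mono[OF test_fun_bump_piece_local[OF \<phi> \<delta>, of k]]) (rule order_trans)
    then show ?thesis by (rule G)
  qed
  then show ?thesis
    by (subst J(2)) (rule vanishing_sum[OF test_fun_bump_piece[OF \<phi>]])
qed

text \<open>A bounded primitive of $e^{-i\tau u} \rho(u)$ gains a factor $t - \tau$ on the Fourier side, which is
small on test functions concentrated at $\tau$.\<close>

lemma pairing_bound:
  assumes \<phi>: "test_fun UNIV \<phi>"
    and M: "\<And>x. x \<ge> 0 \<Longrightarrow> cmod (fourier (\<lambda>u. complex_of_real (indicator {0..x} u * \<rho> u)) \<tau>) \<le> M"
  shows "cmod (pairing \<phi> h) \<le> M * fourier_norm (\<lambda>t. complex_of_real (t - \<tau>) * \<phi> t)"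
proof -
  \<comment> \<open>\<open>\<psi>\<close> is chosen so that the derivative \<open>D\<close> of the
    modulated kernel \<open>P\<close> has the same modulus as the translated transform of
    \<open>\<psi>\<close>.\<close>
  define \<psi> where "\<psi> = (\<lambda>t. - \<i> * (complex_of_real (t - \<tau>) * \<phi> t))"
  have \<psi>0: "test_fun UNIV (\<lambda>t. complex_of_real (t - \<tau>) * \<phi> t)"
    using test_fun_mult[OF \<phi> smooth_diff[OF smooth_of_real smooth_const[of "complex_of_real \<tau>"]]] by simp
  have \<psi>: "test_fun UNIV \<psi>" unfolding \<psi>_def by (rule test_fun_cmult[OF \<psi>0])
  note [measurable] = fourier_measurable[OF \<phi>] fourier_measurable[OF \<psi>]
  let ?e = "\<lambda>x. exp (\<i> * complex_of_real (\<tau> * x))"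
  let ?r = "\<lambda>x. exp (- (\<i> * complex_of_real (\<tau> * x))) * complex_of_real (\<rho> x)"
  define P where "P x = ?e x * fourier \<phi> (x - h)" for x
  define D where "D x = ?e x * fourier \<psi> (x - h)" for x
  have [measurable]: "P \<in> borel_measurable borel" "D \<in> borel_measurable borel"
    unfolding P_def[abs_def] D_def[abs_def] by measurable
  have contD: "continuous_on A D" for A
    unfolding D_def[abs_def]
    by (intro continuous_intros continuous_on_compose2[OF fourier_continuous_on[OF \<psi>, of UNIV]]) auto
  have deriv: "(P has_vector_derivative D x) (at x)" for x
  proof -
    let ?\<psi>' = "\<lambda>t. - (\<i> * complex_of_real t) * \<phi> t"
    have "((\<lambda>x. x - h) has_vector_derivative 1) (at x)"
      by (auto intro!: derivative_eq_intros)
    from vector_diff_chain_at[OF this has_vector_derivative_fourier[OF \<phi>]]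
    have "((\<lambda>x. fourier \<phi> (x - h)) has_vector_derivative fourier ?\<psi>' (x - h)) (at x)"
      by (simp add: o_def)
    from has_vector_derivative_mult[OF has_vector_derivative_cis this, of \<tau>]
    have "(P has_vector_derivative ?e x * fourier ?\<psi>' (x - h) + \<i> * \<tau> * ?e x * fourier \<phi> (x - h)) (at x)"
      unfolding P_def[abs_def] .
    moreover have "fourier \<psi> (x - h) = fourier ?\<psi>' (x - h) + \<i> * \<tau> * fourier \<phi> (x - h)"
    proof -
      have 1: "test_fun UNIV ?\<psi>'"
        using test_fun_mult[OF \<phi> smooth_cmult[OF smooth_of_real, of "-\<i>"]] by simp
      have "\<psi> = (\<lambda>t. ?\<psi>' t + \<i> * \<tau> * \<phi> t)" by (auto simp: \<psi>_def algebra_simps)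
      then have "fourier \<psi> (x - h) = fourier ?\<psi>' (x - h) + fourier (\<lambda>t. \<i> * \<tau> * \<phi> t) (x - h)"
        using fourier_add[OF test_fun_integrable[OF 1] test_fun_integrable[OF test_fun_cmult[OF \<phi>]]] by simp
      then show ?thesis by (simp add: fourier_cmult)
    qed
    ultimately show ?thesis by (simp add: D_def algebra_simps)
  qed
  have normD: "cmod (D x) = cmod (fourier \<psi> (x - h))" for x by (simp add: D_def norm_mult)
  have Dint: "integrable lborel D"
    by (rule Bochner_Integration.integrable_bound[OF fourier_shift_integrable[OF \<psi>, of h]]) (simp_all add: normD)
  \<comment> \<open>The absolute integral of \<open>\<rho>\<close> over \<open>{0..y}\<close> is
    bounded only by \<open>B * y\<close>, so the exchange of integrals asks for one more power of
    \<open>y\<close>.\<close>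
  have yDint: "integrable lborel (\<lambda>y. complex_of_real y * D y)"
  proof -
    have "integrable lborel (\<lambda>x. complex_of_real (x - h) * fourier \<psi> (x - h) + complex_of_real h * fourier \<psi> (x - h))"
      using lborel_integrable_real_affine[OF fourier_integrable_times[OF \<psi>], of 1 "-h"]
      by (intro Bochner_Integration.integrable_add integrable_mult_right fourier_shift_integrable[OF \<psi>]) simp
    then have "integrable lborel (\<lambda>x. complex_of_real x * fourier \<psi> (x - h))"
      by (simp add: algebra_simps)
    then show ?thesis
      by (rule Bochner_Integration.integrable_bound) (simp_all add: norm_mult normD)
  qed
  \<comment> \<open>Inserting this tail formula into the pairing and exchanging the integrals is the
    integration by parts: \<open>D\<close> ends up multiplied by the primitives that
    \<open>M\<close> bounds.\<close>
  have P_tail: "P x = - (LINT y|lborel. indicator {x..} y *\<^sub>R D y)" for x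
  proof -
    have "(\<lambda>n. LINT y|lborel. indicator {x..x + real n} y *\<^sub>R D y) \<longlonglongrightarrow> (LINT y|lborel. indicator {x..} y *\<^sub>R D y)"
    proof (rule integral_exhaustion)
      show "integrable lborel (\<lambda>y. indicator {x..} y *\<^sub>R D y)"
        by (rule integrable_mult_indicator[OF _ Dint]) simp
      show "\<forall>\<^sub>F n in sequentially. y \<in> {x..x + real n}" if "y \<in> {x..}" for y
        using eventually_le_real_sequentially[of "y - x"] by eventually_elim (use that in auto)
    qed auto
    moreover have "(LINT y|lborel. indicator {x..x + real n} y *\<^sub>R D y) = P (x + real n) - P x" for n
      by (intro integral_FTC_Icc contD has_vector_derivative_at_within[OF deriv]) simp
    moreover have "(\<lambda>n. P (x + real n)) \<longlonglongrightarrow> 0"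
    proof (rule tendsto_norm_zero_cancel)
      have "(\<lambda>n. fourier \<phi> ((x - h) + real n)) \<longlonglongrightarrow> 0"
        by (rule filterlim_compose[OF fourier_tendsto_0[OF \<phi>]])
           (intro filterlim_at_top_imp_at_infinity filterlim_tendsto_add_at_top[OF tendsto_const] filterlim_real_sequentially)
      then show "(\<lambda>n. cmod (P (x + real n))) \<longlonglongrightarrow> 0"
        unfolding P_def by (simp add: norm_mult tendsto_norm_zero algebra_simps)
    qed
    ultimately have "(\<lambda>n. P (x + real n) - P x) \<longlonglongrightarrow> (LINT y|lborel. indicator {x..} y *\<^sub>R D y)"
      "(\<lambda>n. P (x + real n) - P x) \<longlonglongrightarrow> 0 - P x"
      using tendsto_diff[OF _ tendsto_const[of "P x"], of "\<lambda>n. P (x + real n)" 0] by simp_all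
    then show ?thesis using LIMSEQ_unique by fastforce
  qed
  have Hm: "(\<lambda>(y, x). D y * (indicator {0..y} x *\<^sub>R ?r x)) \<in> borel_measurable (lborel \<Otimes>\<^sub>M lborel)"
  proof -
    have "(\<lambda>(y, x). D y * (indicator {0..y} x *\<^sub>R ?r x)) = (\<lambda>(y, x). if 0 \<le> x \<and> x \<le> y then D y * ?r x else 0)"
      by (auto simp: indicator_def)
    also have "\<dots> \<in> borel_measurable (lborel \<Otimes>\<^sub>M lborel)" by measurable
    finally show ?thesis .
  qed
  have Hm': "(\<lambda>(y, x). cmod (D y * (indicator {0..y} x *\<^sub>R ?r x))) \<in> borel_measurable (lborel \<Otimes>\<^sub>M lborel)"
    using measurable_compose[OF Hm borel_measurable_norm] by (simp only: case_prod_unfold)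
  have H: "integrable (lborel \<Otimes>\<^sub>M lborel) (\<lambda>(y, x). D y * (indicator {0..y} x *\<^sub>R ?r x))"
  proof (rule lborel_pair.Fubini_integrable)
    show "(\<lambda>(y, x). D y * (indicator {0..y} x *\<^sub>R ?r x)) \<in> borel_measurable (lborel \<Otimes>\<^sub>M lborel)"
      by (rule Hm)
    have in_y: "integrable lborel (\<lambda>x. D y * (indicator {0..y} x *\<^sub>R ?r x))" for y
    proof (rule Bochner_Integration.integrable_bound)
      show "integrable lborel (\<lambda>x. cmod (D y) * (indicator {0..y} x * B))"
        by (intro integrable_mult_right integrable_mult_left integrable_real_indicator) (simp_all add: emeasure_lborel_Icc_eq)
      show "AE x in lborel. norm (D y * (indicator {0..y} x *\<^sub>R ?r x)) \<le> norm (cmod (D y) * (indicator {0..y} x * B))"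
        using \<rho>_bounded B_nonneg by (intro AE_I2) (auto simp: norm_mult abs_mult indicator_def intro!: mult_left_mono)
    qed measurable
    then show "AE y in lborel. integrable lborel (\<lambda>x. case (y, x) of (y, x) \<Rightarrow> D y * (indicator {0..y} x *\<^sub>R ?r x))" by simp
    have bd: "(LINT x|lborel. cmod (D y * (indicator {0..y} x *\<^sub>R ?r x))) \<le> B * cmod (complex_of_real y * D y)" for y
    proof -
      have "(LINT x|lborel. cmod (D y * (indicator {0..y} x *\<^sub>R ?r x))) \<le> (LINT x|lborel. cmod (D y) * B * indicator {0..y} x)"
      proof (rule integral_mono)
        show "integrable lborel (\<lambda>x. cmod (D y * (indicator {0..y} x *\<^sub>R ?r x)))"
          by (rule integrable_norm[OF in_y])
        show "integrable lborel (\<lambda>x. cmod (D y) * B * indicator {0..y} x)"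
          by (intro integrable_mult_right integrable_real_indicator) (simp_all add: emeasure_lborel_Icc_eq)
      qed (use \<rho>_bounded in \<open>auto simp: norm_mult indicator_def intro!: mult_left_mono\<close>)
      also have "\<dots> \<le> B * cmod (complex_of_real y * D y)"
        using B_nonneg by (cases "y \<ge> 0") (auto simp: norm_mult mult_ac mult_nonneg_nonpos mult_nonpos_nonneg)
      finally show ?thesis .
    qed
    have "integrable lborel (\<lambda>y. LINT x|lborel. cmod (D y * (indicator {0..y} x *\<^sub>R ?r x)))"
    proof (rule Bochner_Integration.integrable_bound)
      show "integrable lborel (\<lambda>y. B * cmod (complex_of_real y * D y))"
        by (rule integrable_mult_right) (rule integrable_norm[OF yDint])
      show "(\<lambda>y. LINT x|lborel. cmod (D y * (indicator {0..y} x *\<^sub>R ?r x))) \<in> borel_measurable lborel"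
        by (rule lborel.borel_measurable_lebesgue_integral[OF Hm'])
      show "AE y in lborel. norm (LINT x|lborel. cmod (D y * (indicator {0..y} x *\<^sub>R ?r x)))
          \<le> norm (B * cmod (complex_of_real y * D y))"
      proof (rule AE_I2)
        fix y
        have "0 \<le> (LINT x|lborel. cmod (D y * (indicator {0..y} x *\<^sub>R ?r x)))"
          by (rule Bochner_Integration.integral_nonneg) (rule norm_ge_zero)
        with bd[of y] show "norm (LINT x|lborel. cmod (D y * (indicator {0..y} x *\<^sub>R ?r x)))
          \<le> norm (B * cmod (complex_of_real y * D y))" by (simp only: real_norm_def)
      qed
    qed
    then show "integrable lborel (\<lambda>y. LINT x|lborel. norm (case (y, x) of (y, x) \<Rightarrow> D y * (indicator {0..y} x *\<^sub>R ?r x)))"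
      by (simp only: prod.case)
  qed
  have "pairing \<phi> h = (LINT x|lborel. LINT y|lborel. - (D y * (indicator {0..y} x *\<^sub>R ?r x)))"
    unfolding pairing_def
  proof (intro Bochner_Integration.integral_cong refl)
    fix x
    have "complex_of_real (\<rho> x) * fourier \<phi> (x - h) = ?r x * P x"
      by (simp add: P_def exp_minus field_simps)
    also have "\<dots> = (LINT y|lborel. - ?r x * (indicator {x..} y *\<^sub>R D y))"
      unfolding P_tail integral_mult_right_zero by (simp only: mult_minus_left mult_minus_right)
    also have "\<dots> = (LINT y|lborel. - (D y * (indicator {0..y} x *\<^sub>R ?r x)))"
      using \<rho>_neg[of x] by (intro Bochner_Integration.integral_cong refl) (auto simp: indicator_def not_le)
    finally show "complex_of_real (\<rho> x) * fourier \<phi> (x - h) = (LINT y|lborel. - (D y * (indicator {0..y} x *\<^sub>R ?r x)))" .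
  qed
  also have "\<dots> = - (LINT x|lborel. LINT y|lborel. D y * (indicator {0..y} x *\<^sub>R ?r x))" by simp
  also have "(LINT x|lborel. LINT y|lborel. D y * (indicator {0..y} x *\<^sub>R ?r x)) =
      (LINT y|lborel. LINT x|lborel. D y * (indicator {0..y} x *\<^sub>R ?r x))"
    using lborel_pair.Fubini_integral[OF H] by simp
  also have "\<dots> = (LINT y|lborel. D y * fourier (\<lambda>u. complex_of_real (indicator {0..y} u * \<rho> u)) \<tau>)"
    unfolding fourier_def
    by (intro Bochner_Integration.integral_cong refl)
       (simp add: scaleR_conv_of_real mult_ac)
  finally have "cmod (pairing \<phi> h) = cmod (LINT y|lborel. D y * fourier (\<lambda>u. complex_of_real (indicator {0..y} u * \<rho> u)) \<tau>)"
    by simp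
  also have "\<dots> \<le> (LINT y|lborel. cmod (D y) * M)"
  proof (rule order_trans[OF integral_norm_bound integral_mono])
    have "integrable lborel (\<lambda>y. LINT x|lborel. D y * (indicator {0..y} x *\<^sub>R ?r x))"
      using lborel_pair.integrable_fst[OF H] by simp
    then have "integrable lborel (\<lambda>y. D y * fourier (\<lambda>u. complex_of_real (indicator {0..y} u * \<rho> u)) \<tau>)"
      unfolding fourier_def by (simp add: scaleR_conv_of_real mult_ac)
    then show "integrable lborel (\<lambda>y. cmod (D y * fourier (\<lambda>u. complex_of_real (indicator {0..y} u * \<rho> u)) \<tau>))"
      by (rule integrable_norm)
    show "integrable lborel (\<lambda>y. cmod (D y) * M)" using Dint by simp
    fix y
    have "cmod (fourier (\<lambda>u. complex_of_real (indicator {0..y} u * \<rho> u)) \<tau>) \<le> M"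
    proof (cases "y \<ge> 0")
      case False
      then have "fourier (\<lambda>u. complex_of_real (indicator {0..y} u * \<rho> u)) \<tau> = 0" by (simp add: fourier_def)
      moreover have "M \<ge> 0" using M[of 0] norm_ge_zero order_trans by blast
      ultimately show ?thesis by simp
    qed (use M in auto)
    then show "cmod (D y * fourier (\<lambda>u. complex_of_real (indicator {0..y} u * \<rho> u)) \<tau>) \<le> cmod (D y) * M"
      unfolding norm_mult by (intro mult_left_mono) auto
  qed
  also have "\<dots> = M * (LINT y|lborel. cmod (fourier \<psi> (y - h)))" by (simp add: normD)
  also have "(LINT y|lborel. cmod (fourier \<psi> (y - h))) = fourier_norm \<psi>"
    using lborel_integral_real_affine[of 1 "\<lambda>y. cmod (fourier \<psi> y)" "-h"] by (simp add: fourier_norm_def)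
  also have "fourier_norm \<psi> = fourier_norm (\<lambda>t. complex_of_real (t - \<tau>) * \<phi> t)"
    unfolding \<psi>_def fourier_norm_cmult by simp
  finally show ?thesis .
qed

end

text \<open>Outer regularity encloses \<open>S\<close> in an open set of measure below
  \<open>\<epsilon>\<close>. For small \<open>\<delta>\<close> every piece meeting \<open>S\<close>
  lies inside it, and disjoint intervals of length \<open>\<delta>\<close>, one per piece, bound the
  count.\<close>

lemma null_compact_count:
  assumes S: "compact S" "S \<in> null_sets lborel" and "\<epsilon> > 0"
  obtains \<delta> :: real where "\<delta> > 0"
    "\<And>J :: int set. finite J \<Longrightarrow> (\<And>k. k \<in> J \<Longrightarrow> \<exists>\<tau>\<in>S. \<bar>\<tau> / \<delta> - real_of_int k\<bar> \<le> 1) \<Longrightarrow> \<delta> * card J \<le> \<epsilon>"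
proof -
  have "S \<in> sets borel" using S(2) by auto
  then obtain W where W: "open W" "S \<subseteq> W" "emeasure lborel (W - S) < ennreal \<epsilon>"
    using outer_regular_lborel[of S \<epsilon>] assms(3) by auto
  have W': "emeasure lborel W < ennreal \<epsilon>"
    using W(1,3) emeasure_Diff_null_set[OF S(2), of W] by auto
  obtain e where e: "e > 0" "\<And>x. x \<in> S \<Longrightarrow> \<exists>G\<in>{W}. ball x e \<subseteq> G"
    by (rule Heine_Borel_lemma[OF S(1), of "{W}"]) (use W in auto)
  define \<delta> where "\<delta> = e / 3"
  have \<delta>: "\<delta> > 0" using e(1) by (simp add: \<delta>_def)
  have "\<delta> * card J \<le> \<epsilon>" if J: "finite J" "\<And>k. k \<in> J \<Longrightarrow> \<exists>\<tau>\<in>S. \<bar>\<tau> / \<delta> - real_of_int k\<bar> \<le> 1" for J :: "int set"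
  proof -
    \<comment> \<open>Neighbouring pieces overlap; their left halves are disjoint.\<close>
    let ?I = "\<lambda>k::int. {\<delta> * (real_of_int k - 1)..<\<delta> * real_of_int k}"
    have sub: "?I k \<subseteq> W" if "k \<in> J" for k
    proof
      fix y assume y: "y \<in> ?I k"
      obtain \<tau> where \<tau>: "\<tau> \<in> S" "\<bar>\<tau> / \<delta> - real_of_int k\<bar> \<le> 1" using J(2)[OF \<open>k \<in> J\<close>] by blast
      have "\<bar>\<tau> - \<delta> * real_of_int k\<bar> \<le> \<delta>"
        using \<tau>(2) \<delta> by (simp add: abs_le_iff field_simps)
      then have "\<bar>\<tau> - y\<bar> \<le> 2 * \<delta>" using y by (auto simp: algebra_simps abs_le_iff)
      then have "y \<in> ball \<tau> e" using e(1) by (simp add: dist_real_def \<delta>_def)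
      then show "y \<in> W" using e(2)[OF \<tau>(1)] by blast
    qed
    have "disjoint_family_on ?I J"
      unfolding disjoint_family_on_def
    proof (intro ballI impI)
      fix m n :: int assume "m \<noteq> n"
      have *: "?I m \<inter> ?I n = {}" if "m < n" for m n :: int
      proof -
        have "real_of_int m \<le> real_of_int n - 1" using that by linarith
        then have "\<delta> * real_of_int m \<le> \<delta> * (real_of_int n - 1)" using \<delta> by (intro mult_left_mono) auto
        then show ?thesis by auto
      qed
      show "?I m \<inter> ?I n = {}" using *[of m n] *[of n m] \<open>m \<noteq> n\<close> by (cases "m < n") auto
    qed
    then have "(\<Sum>k\<in>J. emeasure lborel (?I k)) = emeasure lborel (\<Union>k\<in>J. ?I k)"
      using J(1) by (intro sum_emeasure) auto
    also have "\<dots> \<le> emeasure lborel W"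
      using sub W(1) by (intro emeasure_mono) auto
    also have "(\<Sum>k\<in>J. emeasure lborel (?I k)) = (\<Sum>k\<in>J. ennreal \<delta>)"
      using \<delta> by (intro sum.cong refl) (simp add: algebra_simps)
    also have "\<dots> = ennreal (\<delta> * card J)"
      using \<delta> by (simp add: ennreal_mult' ennreal_of_nat_eq_real_of_nat mult.commute)
    finally have "ennreal (\<delta> * card J) < ennreal \<epsilon>" using W' by (rule le_less_trans)
    then show ?thesis using \<delta> by (simp add: ennreal_less_iff)
  qed
  with \<delta> that show ?thesis by blast
qed

text \<open>In the variable v = t / delta - k, the factor t - tau equals delta (v + k - tau / delta)
  with |k - tau / delta| at most 1. The norm is invariant under the dilation, so only the explicit
  factor delta survives.\<close>

lemma bump_piece_fourier_norm:
  assumes \<phi>: "test_fun UNIV \<phi>"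
  obtains Q where "Q > 0" "\<And>\<delta> k \<tau>. \<delta> > 0 \<Longrightarrow> \<bar>\<tau> / \<delta> - real_of_int k\<bar> \<le> 1 \<Longrightarrow>
    fourier_norm (\<lambda>t. complex_of_real (t - \<tau>) * bump_piece \<delta> k \<phi> t) \<le> \<delta> * Q"
proof -
  obtain C where C: "C > 0" "\<And>f g. test_fun UNIV f \<Longrightarrow> test_fun UNIV g \<Longrightarrow>
       fourier_norm (\<lambda>t. f t * g t) \<le> C * fourier_norm f * fourier_norm g" using fourier_norm_mult by metis
  let ?b = "\<lambda>v. complex_of_real (unit_bump v)"
  let ?vb = "\<lambda>v. complex_of_real v * ?b v"
  have b: "test_fun UNIV ?b" by (rule test_fun_mono[OF test_fun_unit_bump]) simp
  have vb: "test_fun UNIV ?vb" by (rule test_fun_mult[OF b smooth_of_real])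
  define N where "N = fourier_norm ?vb + fourier_norm ?b"
  have N: "N \<ge> 0" unfolding N_def by (intro add_nonneg_nonneg fourier_norm_nonneg)
  \<comment> \<open>The summand 1 keeps \<open>Q\<close> positive, as it becomes a divisor
    later.\<close>
  define Q where "Q = C * N * fourier_norm \<phi> + 1"
  have Q0: "C * N * fourier_norm \<phi> \<ge> 0" using C(1) N fourier_norm_nonneg[of \<phi>] by simp
  have "fourier_norm (\<lambda>t. complex_of_real (t - \<tau>) * bump_piece \<delta> k \<phi> t) \<le> \<delta> * Q"
    if \<delta>: "\<delta> > 0" and k: "\<bar>\<tau> / \<delta> - real_of_int k\<bar> \<le> 1" for \<delta> k \<tau>
  proof -
    define g where "g = (\<lambda>v. ?vb v + complex_of_real (real_of_int k - \<tau> / \<delta>) * ?b v)"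
    have cb: "test_fun UNIV (\<lambda>v. complex_of_real (real_of_int k - \<tau> / \<delta>) * ?b v)" by (rule test_fun_cmult[OF b])
    have g: "test_fun UNIV g" unfolding g_def by (rule test_fun_add[OF vb cb])
    have "fourier_norm g \<le> fourier_norm ?vb + fourier_norm (\<lambda>v. complex_of_real (real_of_int k - \<tau> / \<delta>) * ?b v)"
      unfolding g_def by (rule fourier_norm_add[OF vb cb])
    also have "fourier_norm (\<lambda>v. complex_of_real (real_of_int k - \<tau> / \<delta>) * ?b v) = \<bar>real_of_int k - \<tau> / \<delta>\<bar> * fourier_norm ?b"
      unfolding fourier_norm_cmult norm_of_real ..
    also have "\<dots> \<le> 1 * fourier_norm ?b"
      using k by (intro mult_right_mono fourier_norm_nonneg) (simp add: abs_minus_commute)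
    finally have gN: "fourier_norm g \<le> N" by (simp add: N_def)
    define f where "f = (\<lambda>t. complex_of_real \<delta> * g (1 / \<delta> * t + - real_of_int k))"
    have "test_fun UNIV (\<lambda>t. g (1 / \<delta> * t + - real_of_int k))"
      using test_fun_scale[OF g, of "1 / \<delta>" "- real_of_int k"] \<delta> by simp
    then have f: "test_fun UNIV f" unfolding f_def by (rule test_fun_cmult)
    have "fourier_norm f = \<delta> * fourier_norm g"
      unfolding f_def fourier_norm_cmult using fourier_norm_affine[of "1 / \<delta>" g "- real_of_int k"] \<delta> by simp
    then have fN: "fourier_norm f \<le> \<delta> * N" using gN \<delta> by simp
    have "complex_of_real (t - \<tau>) * bump_piece \<delta> k \<phi> t = f t * \<phi> t" for t
    proof -
      have "\<delta> * ((1 / \<delta> * t + - real_of_int k) + (real_of_int k - \<tau> / \<delta>)) = t - \<tau>"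
        using \<delta> by (simp add: field_simps)
      then have "complex_of_real (t - \<tau>) = complex_of_real \<delta> *
          (complex_of_real (1 / \<delta> * t + - real_of_int k) + complex_of_real (real_of_int k - \<tau> / \<delta>))"
        by (metis of_real_add of_real_mult)
      then show ?thesis unfolding f_def g_def bump_piece_def by (simp only: algebra_simps)
    qed
    then have "fourier_norm (\<lambda>t. complex_of_real (t - \<tau>) * bump_piece \<delta> k \<phi> t) = fourier_norm (\<lambda>t. f t * \<phi> t)" by simp
    also have "\<dots> \<le> C * fourier_norm f * fourier_norm \<phi>" by (rule C(2)[OF f \<phi>])
    also have "\<dots> \<le> C * (\<delta> * N) * fourier_norm \<phi>"
      using C(1) fN by (intro mult_right_mono mult_left_mono fourier_norm_nonneg) auto
    also have "\<dots> \<le> \<delta> * Q" using \<delta> by (simp add: Q_def algebra_simps)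
    finally show ?thesis .
  qed
  moreover have "Q > 0" using Q0 by (simp add: Q_def)
  ultimately show ?thesis using that by blast
qed

section \<open>From null singular sets to pointwise decay\<close>

context bounded_signal
begin

lemma vanishing_uniform:
  assumes \<phi>: "test_fun UNIV \<phi>"
    and null: "supp \<phi> - regular \<in> null_sets lborel"
    and M: "\<And>\<tau> x. \<tau> \<in> supp \<phi> - regular \<Longrightarrow> x \<ge> 0 \<Longrightarrow>
       cmod (fourier (\<lambda>u. complex_of_real (indicator {0..x} u * \<rho> u)) \<tau>) \<le> M"
  shows "vanishing \<phi>"
  unfolding vanishing_def tendsto_iff
proof (intro allI impI)
  fix \<epsilon> :: real assume "\<epsilon> > 0"
  define S where "S = supp \<phi> - regular"
  have S: "compact S" "S \<in> null_sets lborel"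
    using \<phi> null open_regular unfolding test_fun_iff S_def Diff_eq
    by (blast intro: compact_Int_closed)+
  obtain Q where Q: "Q > 0" "\<And>\<delta> k \<tau>. \<delta> > 0 \<Longrightarrow> \<bar>\<tau> / \<delta> - real_of_int k\<bar> \<le> 1 \<Longrightarrow>
    fourier_norm (\<lambda>t. complex_of_real (t - \<tau>) * bump_piece \<delta> k \<phi> t) \<le> \<delta> * Q"
    using bump_piece_fourier_norm[OF \<phi>] by metis
  define M' where "M' = max M 1"
  \<comment> \<open>At most \<open>\<epsilon>' / \<delta>\<close> pieces meet \<open>S\<close>, each
    contributing at most \<open>M' * \<delta> * Q\<close>; this choice makes their sum at most
    \<open>\<epsilon> / 2\<close>.\<close>
  define \<epsilon>' where "\<epsilon>' = \<epsilon> / (2 * M' * Q)"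
  have M': "M' \<ge> 1" "M' \<ge> M" by (auto simp: M'_def)
  have \<epsilon>': "\<epsilon>' > 0" using \<open>\<epsilon> > 0\<close> M' Q by (simp add: \<epsilon>'_def)
  obtain \<delta> where \<delta>: "\<delta> > 0" "\<And>J :: int set. finite J \<Longrightarrow>
      (\<And>k. k \<in> J \<Longrightarrow> \<exists>\<tau>\<in>S. \<bar>\<tau> / \<delta> - real_of_int k\<bar> \<le> 1) \<Longrightarrow> \<delta> * card J \<le> \<epsilon>'"
    using null_compact_count[OF S \<epsilon>'] by metis
  obtain J where J: "finite J" "\<phi> = (\<lambda>t. \<Sum>k\<in>J. bump_piece \<delta> k \<phi> t)"
    using bump_piece_decomposition[OF \<phi> \<delta>(1)] by metis
  define J1 where "J1 = {k \<in> J. \<exists>\<tau>\<in>S. \<bar>\<tau> / \<delta> - real_of_int k\<bar> \<le> 1}"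
  have J1: "finite J1" "J1 \<subseteq> J" using J(1) by (auto simp: J1_def)
  have card: "\<delta> * card J1 \<le> \<epsilon>'" by (rule \<delta>(2)[OF J1(1)]) (simp add: J1_def)
  have bad: "cmod (pairing (bump_piece \<delta> k \<phi>) h) \<le> M' * (\<delta> * Q)" if k: "k \<in> J1" for k h
  proof -
    obtain \<tau> where \<tau>: "\<tau> \<in> S" "\<bar>\<tau> / \<delta> - real_of_int k\<bar> \<le> 1" using k by (auto simp: J1_def)
    have "cmod (pairing (bump_piece \<delta> k \<phi>) h) \<le> M' * fourier_norm (\<lambda>t. complex_of_real (t - \<tau>) * bump_piece \<delta> k \<phi> t)"
    proof (rule pairing_bound[OF test_fun_bump_piece[OF \<phi>]])
      fix x :: real assume "x \<ge> 0"
      then show "cmod (fourier (\<lambda>u. complex_of_real (indicator {0..x} u * \<rho> u)) \<tau>) \<le> M'"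
        using M[of \<tau> x] \<tau>(1) M'(2) unfolding S_def by linarith
    qed
    also have "\<dots> \<le> M' * (\<delta> * Q)" using Q(2)[OF \<delta>(1) \<tau>(2)] M'(1) by (intro mult_left_mono) auto
    finally show ?thesis .
  qed
  have good: "vanishing (bump_piece \<delta> k \<phi>)" if k: "k \<in> J - J1" for k
  proof (rule vanishing_if_regular)
    have "supp \<phi> \<inter> {\<delta> * (real_of_int k - 1)..\<delta> * (real_of_int k + 1)} \<subseteq> regular"
    proof
      fix y assume y: "y \<in> supp \<phi> \<inter> {\<delta> * (real_of_int k - 1)..\<delta> * (real_of_int k + 1)}"
      then have "\<bar>y / \<delta> - real_of_int k\<bar> \<le> 1" using \<delta>(1) by (auto simp: abs_le_iff field_simps)
      then have "y \<notin> S" using k by (auto simp: J1_def)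
      then show "y \<in> regular" using y by (auto simp: S_def)
    qed
    then show "test_fun regular (bump_piece \<delta> k \<phi>)"
      by (rule test_fun_mono[OF test_fun_bump_piece_local[OF \<phi> \<delta>(1)]])
  qed
  \<comment> \<open>\<open>\<delta>\<close> is fixed before \<open>h\<close> tends to infinity, so
    the good pieces form a fixed finite sum.\<close>
  have "((\<lambda>h. \<Sum>k\<in>J - J1. pairing (bump_piece \<delta> k \<phi>) h) \<longlongrightarrow> 0) at_top"
    by (rule tendsto_null_sum) (use good in \<open>simp add: vanishing_def\<close>)
  then have "\<forall>\<^sub>F h in at_top. dist (\<Sum>k\<in>J - J1. pairing (bump_piece \<delta> k \<phi>) h) 0 < \<epsilon> / 2"
    using \<open>\<epsilon> > 0\<close> by (intro tendstoD) auto
  then show "\<forall>\<^sub>F h in at_top. dist (pairing \<phi> h) 0 < \<epsilon>"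
  proof eventually_elim
    case (elim h)
    have "pairing \<phi> h = (\<Sum>k\<in>J. pairing (bump_piece \<delta> k \<phi>) h)"
      by (subst J(2)) (rule pairing_sum[OF test_fun_bump_piece[OF \<phi>]])
    also have "\<dots> = (\<Sum>k\<in>J - J1. pairing (bump_piece \<delta> k \<phi>) h) + (\<Sum>k\<in>J1. pairing (bump_piece \<delta> k \<phi>) h)"
      by (rule sum.subset_diff[OF J1(2) J(1)])
    finally have "cmod (pairing \<phi> h) \<le> cmod (\<Sum>k\<in>J - J1. pairing (bump_piece \<delta> k \<phi>) h)
        + cmod (\<Sum>k\<in>J1. pairing (bump_piece \<delta> k \<phi>) h)" by (simp add: norm_triangle_ineq)
    also have "cmod (\<Sum>k\<in>J1. pairing (bump_piece \<delta> k \<phi>) h) \<le> real (card J1) * (M' * (\<delta> * Q))"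
      by (rule sum_norm_bound) (rule bad)
    also have "\<dots> = (\<delta> * card J1) * (M' * Q)" by simp
    also have "\<dots> \<le> \<epsilon>' * (M' * Q)" using card M' Q(1) by (intro mult_right_mono) auto
    also have "\<dots> = \<epsilon> / 2" using M' Q(1) by (simp add: \<epsilon>'_def)
    finally have "cmod (pairing \<phi> h) \<le> cmod (\<Sum>k\<in>J - J1. pairing (bump_piece \<delta> k \<phi>) h) + \<epsilon> / 2" by simp
    with elim show ?case by (simp add: dist_norm)
  qed
qed

lemma null_set_removal:
  assumes E: "E \<in> null_sets lborel" and reg: "- E \<subseteq> regular"
    and bdd: "\<And>\<tau>. \<tau> \<in> E \<Longrightarrow> \<exists>M. \<forall>x\<ge>0. cmod (fourier (\<lambda>u. complex_of_real (indicator {0..x} u * \<rho> u)) \<tau>) \<le> M"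
  shows "regular = UNIV"
proof (rule ccontr)
  assume "regular \<noteq> UNIV"
  define K where "K = - regular"
  have K: "closed K" "K \<noteq> {}" "K \<subseteq> E"
    using open_regular \<open>regular \<noteq> UNIV\<close> reg unfolding K_def by (auto simp: closed_Compl)
  define R where "R x = fourier (\<lambda>u. complex_of_real (indicator {0..x} u * \<rho> u))" for x
  have cont: "continuous_on UNIV (R x)" for x
    unfolding R_def
  proof (rule continuous_fourier_integrable)
    show "integrable lborel (\<lambda>u. complex_of_real (indicator {0..x} u * \<rho> u))"
    proof (rule Bochner_Integration.integrable_bound)
      show "integrable lborel (\<lambda>u. B * indicator {0..x} u)"
        by (intro integrable_mult_right integrable_real_indicator) (simp_all add: emeasure_lborel_Icc_eq)
      show "AE u in lborel. norm (complex_of_real (indicator {0..x} u * \<rho> u)) \<le> norm (B * indicator {0..x} u)"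
        using \<rho>_bounded B_nonneg by (intro AE_I2) (auto simp: indicator_def)
    qed measurable
  qed
  \<comment> \<open>Frequencies in \<open>K\<close> whose truncated transforms are all bounded by
    \<open>n\<close>: closed by continuity in the frequency, and exhausting \<open>K\<close> by the
    pointwise bounds.\<close>
  define Kn where "Kn n = K \<inter> (\<Inter>x\<in>{0..}. {\<tau>. cmod (R x \<tau>) \<le> real n})" for n :: nat
  have closed_Kn: "closed (Kn n)" for n
    unfolding Kn_def by (intro closed_Int K(1) closed_INT ballI closed_Collect_le continuous_intros cont)
  have Kn_cover: "\<exists>n. \<tau> \<in> Kn n" if "\<tau> \<in> K" for \<tau>
  proof -
    obtain M where M: "\<forall>x\<ge>0. cmod (R x \<tau>) \<le> M" using bdd[of \<tau>] K(3) \<open>\<tau> \<in> K\<close> unfolding R_def by blast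
    obtain n :: nat where "M \<le> n" using real_arch_simple by blast
    then have "\<tau> \<in> Kn n" using M \<open>\<tau> \<in> K\<close> unfolding Kn_def by (auto intro: order_trans)
    then show ?thesis ..
  qed
  \<comment> \<open>Otherwise all the relatively open sets \<open>K - Kn n\<close> would be dense in
    \<open>K\<close>, and so would their empty intersection.\<close>
  have "\<exists>n. \<not> K \<subseteq> closure (K - Kn n)"
  proof (rule ccontr)
    assume "\<not> ?thesis"
    then have dense: "K \<subseteq> closure (K - Kn n)" for n by blast
    have "K \<subseteq> closure (\<Inter>(range (\<lambda>n. K - Kn n)))"
    proof (rule Baire[OF K(1)])
      fix T assume "T \<in> range (\<lambda>n. K - Kn n)"
      then obtain n where T: "T = K - Kn n" by blast
      have "openin (top_of_set K) (K \<inter> - Kn n)"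
        by (rule openin_open_Int) (simp add: open_Compl closed_Kn)
      then show "openin (top_of_set K) T \<and> K \<subseteq> closure T" using dense[of n] unfolding T by (simp add: Diff_eq)
    qed simp
    moreover have "\<Inter>(range (\<lambda>n. K - Kn n)) = {}" using Kn_cover by blast
    ultimately have "K \<subseteq> closure {}" by (simp only:)
    then show False using K(2) by simp
  qed
  then obtain n t0 where t0: "t0 \<in> K" "t0 \<notin> closure (K - Kn n)" by blast
  define V where "V = - closure (K - Kn n)"
  have V: "open V" "t0 \<in> V" "V \<inter> K \<subseteq> Kn n"
    using t0(2) closure_subset[of "K - Kn n"] unfolding V_def by (auto simp: open_Compl)
  \<comment> \<open>In \<open>V\<close> all singular frequencies share the bound \<open>n\<close>,
    so the uniform case applies and makes \<open>t0\<close> regular, against its choice.\<close>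
  have "vanishing \<phi>" if \<phi>: "test_fun V \<phi>" for \<phi>
  proof (rule vanishing_uniform)
    show "test_fun UNIV \<phi>" by (rule test_fun_mono[OF \<phi>]) simp
    have c: "compact (supp \<phi>)" "supp \<phi> \<subseteq> V" using \<phi> unfolding test_fun_iff by blast+
    have sub: "supp \<phi> - regular \<subseteq> V \<inter> K" using c(2) unfolding K_def by blast
    show "supp \<phi> - regular \<in> null_sets lborel"
    proof (rule null_sets_subset[OF E])
      show "supp \<phi> - regular \<in> sets lborel" using open_regular by auto
      show "supp \<phi> - regular \<subseteq> E" using sub K(3) by blast
    qed
    fix \<tau> x :: real assume "\<tau> \<in> supp \<phi> - regular" "x \<ge> 0"
    then have "\<tau> \<in> Kn n" using sub V(3) by blast
    then show "cmod (fourier (\<lambda>u. complex_of_real (indicator {0..x} u * \<rho> u)) \<tau>) \<le> real n"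
      using \<open>x \<ge> 0\<close> unfolding Kn_def R_def by blast
  qed
  then have "t0 \<in> regular" using V unfolding regular_def by blast
  then show False using t0(1) unfolding K_def by simp
qed

text \<open>A large positive value persists to the right, and a large negative value must already
  have been present to the left, each on an interval of length \<open>2 * \<eta>\<close>. A positive
  kernel concentrated there would keep the pairing away from 0.\<close>

lemma one_sided_tauberian:
  assumes van: "\<And>\<phi>. test_fun UNIV \<phi> \<Longrightarrow> vanishing \<phi>"
    and L: "L > 0" "\<And>x y. 0 \<le> x \<Longrightarrow> x \<le> y \<Longrightarrow> \<rho> y - \<rho> x \<ge> - L * (y - x)"
  shows "(\<rho> \<longlongrightarrow> 0) at_top"
  unfolding tendsto_iff
proof (intro allI impI)
  fix \<epsilon>0 :: real assume "\<epsilon>0 > 0"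
  define \<epsilon> where "\<epsilon> = \<epsilon>0 / 2"
  have \<epsilon>: "\<epsilon> > 0" using \<open>\<epsilon>0 > 0\<close> by (simp add: \<epsilon>_def)
  \<comment> \<open>Over length \<open>2 * \<eta>\<close> the slope bound allows a drop of at most
    \<open>\<epsilon>\<close>, so of an initial excess \<open>2 * \<epsilon>\<close> at least
    \<open>\<epsilon>\<close> remains.\<close>
  define \<eta> where "\<eta> = \<epsilon> / (2 * L)"
  have \<eta>: "\<eta> > 0" "2 * \<eta> * L = \<epsilon>" using \<epsilon> L(1) by (auto simp: \<eta>_def)
  obtain \<phi> k where k: "test_fun {-2..2} \<phi>" "\<And>x. fourier \<phi> x = complex_of_real (k x)" "\<And>x. k x \<ge> 0"
    and ki: "integrable lborel k" and k_pos: "(LINT x|lborel. k x) > 0" using positive_kernel by metis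
  have \<phi>: "test_fun UNIV \<phi>" by (rule test_fun_mono[OF k(1)]) simp
  have [measurable]: "k \<in> borel_measurable borel" using ki by auto
  define I where "I = (LINT u|lborel. k u)"
  have I: "I > 0" unfolding I_def by (rule k_pos)
  have "(\<lambda>n. LINT u|lborel. k u * indicator {u. \<bar>u\<bar> > real n} u) \<longlonglongrightarrow> (LINT u|(lborel :: real measure). 0)"
  proof (rule integral_dominated_convergence[where w = k])
    show "AE u in lborel. (\<lambda>n. k u * indicator {u. \<bar>u\<bar> > real n} u) \<longlonglongrightarrow> 0"
    proof (rule AE_I2)
      fix u :: real
      obtain m :: nat where m: "\<bar>u\<bar> \<le> m" using real_arch_simple by blast
      have "\<forall>\<^sub>F n in sequentially. 0 = k u * indicator {u. \<bar>u\<bar> > real n} u"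
        using eventually_ge_at_top[of m] by eventually_elim (use m in \<open>auto simp: indicator_def\<close>)
      then show "(\<lambda>n. k u * indicator {u. \<bar>u\<bar> > real n} u) \<longlonglongrightarrow> 0"
        by (rule Lim_transform_eventually[rotated]) simp
    qed
    show "AE u in lborel. norm (k u * indicator {u. \<bar>u\<bar> > real n} u) \<le> k u" for n
      using k(3) by (auto simp: indicator_def)
  qed (use ki in measurable)
  moreover have "\<epsilon> * I / (2 * (B + \<epsilon>)) > 0" using \<epsilon> I B_nonneg by simp
  ultimately have "\<forall>\<^sub>F n in sequentially. (LINT u|lborel. k u * indicator {u. \<bar>u\<bar> > real n} u) < \<epsilon> * I / (2 * (B + \<epsilon>))"
    by (intro order_tendstoD) auto
  \<comment> \<open>\<open>n\<close> makes the tail mass of \<open>k\<close> so small that, weighted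
    with the worst value \<open>B + \<epsilon>\<close>, it costs at most half of
    \<open>\<epsilon> * I\<close>.\<close>
  then obtain n where n: "(LINT u|lborel. k u * indicator {u. \<bar>u\<bar> > real n} u) < \<epsilon> * I / (2 * (B + \<epsilon>))"
    unfolding eventually_sequentially by blast
  define T where "T = (LINT u|lborel. k u * indicator {u. \<bar>u\<bar> > real n} u)"
  have T: "(B + \<epsilon>) * T \<le> \<epsilon> * I / 2"
  proof -
    have "(B + \<epsilon>) * T \<le> (B + \<epsilon>) * (\<epsilon> * I / (2 * (B + \<epsilon>)))"
      using n B_nonneg \<epsilon> unfolding T_def by (intro mult_left_mono) auto
    also have "\<dots> = \<epsilon> * I / 2" using B_nonneg \<epsilon> by (simp add: field_simps)
    finally show ?thesis .
  qed
  \<comment> \<open>The dilation sends points at distance more than \<open>\<eta>\<close> from the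
    centre to arguments beyond \<open>n\<close>; the extra 1 makes this inequality strict.\<close>
  define \<mu> where "\<mu> = (real n + 1) / \<eta>"
  have \<mu>: "\<mu> > 0" "\<mu> * \<eta> = real n + 1" using \<eta>(1) by (auto simp: \<mu>_def)
  define \<psi> where "\<psi> = (\<lambda>t. \<phi> (1 / \<mu> * t + 0))"
  have \<psi>: "test_fun UNIV \<psi>" unfolding \<psi>_def using test_fun_scale[OF \<phi>, of "1 / \<mu>" 0] \<mu>(1) by simp
  have four: "fourier \<psi> y = complex_of_real (\<mu> * k (\<mu> * y))" for y
    using fourier_affine[of "1 / \<mu>" \<phi> "\<mu> * y" 0] \<mu>(1) k(2)[of "\<mu> * y"]
    by (simp add: \<psi>_def field_simps)
  have subst_k: "(LINT x|lborel. f (\<mu> * (x - h)) * \<mu>) = (LINT u|lborel. f u)" for f :: "real \<Rightarrow> real" and h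
    using lborel_integral_real_affine[of \<mu> f "- \<mu> * h"] \<mu>(1)
    by (simp add: algebra_simps)
  have int_k: "integrable lborel (\<lambda>x. f (\<mu> * (x - h)))" if "integrable lborel f" for f :: "real \<Rightarrow> real" and h
    using lborel_integrable_real_affine[OF that, of \<mu> "- \<mu> * h"] \<mu>(1) by (simp add: algebra_simps)
  \<comment> \<open>The sign \<open>s\<close> treats both cases at once. Inside the window the
    integrand is at least \<open>\<epsilon>\<close> times the kernel; outside it is at least
    \<open>- B\<close> times the kernel, which the term with \<open>B + \<epsilon>\<close> accounts
    for.\<close>
  have low: "\<epsilon> * I / 2 \<le> cmod (pairing \<psi> h)" if s: "\<bar>s\<bar> = 1" "\<And>x. \<bar>x - h\<bar> \<le> \<eta> \<Longrightarrow> s * \<rho> x \<ge> \<epsilon>" for s h :: real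
  proof -
    let ?t = "\<lambda>u. k u * indicator {u. \<bar>u\<bar> > real n} u"
    have ti: "integrable lborel ?t"
      by (rule Bochner_Integration.integrable_bound[OF ki]) (auto simp: indicator_def)
    have rint: "integrable lborel (\<lambda>x. \<rho> x * (\<mu> * k (\<mu> * (x - h))))"
      using pairing_integrable[OF \<psi>, of h] unfolding four of_real_mult[symmetric]
      by (simp add: complex_of_real_integrable_eq del: of_real_mult)
    have "\<epsilon> * I / 2 \<le> \<epsilon> * I - (B + \<epsilon>) * T" using T by linarith
    also have "\<dots> = (LINT x|lborel. \<epsilon> * (k (\<mu> * (x - h)) * \<mu>) - (B + \<epsilon>) * (?t (\<mu> * (x - h)) * \<mu>))"
      using int_k[OF ki, of h] int_k[OF ti, of h] subst_k[of k h] subst_k[of ?t h]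
      by (simp add: I_def T_def)
    also have "\<dots> \<le> (LINT x|lborel. s * (\<rho> x * (\<mu> * k (\<mu> * (x - h)))))"
    proof (rule integral_mono)
      show "integrable lborel (\<lambda>x. \<epsilon> * (k (\<mu> * (x - h)) * \<mu>) - (B + \<epsilon>) * (?t (\<mu> * (x - h)) * \<mu>))"
        using int_k[OF ki, of h] int_k[OF ti, of h] by simp
      show "integrable lborel (\<lambda>x. s * (\<rho> x * (\<mu> * k (\<mu> * (x - h)))))" using rint by simp
      fix x
      have km: "k (\<mu> * (x - h)) * \<mu> \<ge> 0" using k(3) \<mu>(1) by simp
      show "\<epsilon> * (k (\<mu> * (x - h)) * \<mu>) - (B + \<epsilon>) * (?t (\<mu> * (x - h)) * \<mu>) \<le> s * (\<rho> x * (\<mu> * k (\<mu> * (x - h))))"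
      proof (cases "\<bar>x - h\<bar> \<le> \<eta>")
        case True
        have "\<epsilon> * (k (\<mu> * (x - h)) * \<mu>) \<le> (s * \<rho> x) * (k (\<mu> * (x - h)) * \<mu>)"
          by (rule mult_right_mono[OF s(2)[OF True] km])
        moreover have "(B + \<epsilon>) * (?t (\<mu> * (x - h)) * \<mu>) \<ge> 0"
          using k(3) \<mu>(1) B_nonneg \<epsilon> by (simp add: indicator_def)
        ultimately show ?thesis by (simp add: mult_ac)
      next
        case False
        then have "\<mu> * \<eta> \<le> \<mu> * \<bar>x - h\<bar>" using \<mu>(1) by (intro mult_left_mono) auto
        then have "\<bar>\<mu> * (x - h)\<bar> > real n" using \<mu> by (simp add: abs_mult)
        then have t: "?t (\<mu> * (x - h)) = k (\<mu> * (x - h))" by simp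
        have "\<bar>s * \<rho> x\<bar> \<le> B" using s(1) \<rho>_bounded by (simp add: abs_mult)
        then have "- B * (k (\<mu> * (x - h)) * \<mu>) \<le> (s * \<rho> x) * (k (\<mu> * (x - h)) * \<mu>)"
          by (intro mult_right_mono km) auto
        then show ?thesis unfolding t by (simp add: algebra_simps)
      qed
    qed
    also have "\<dots> = s * (LINT x|lborel. \<rho> x * (\<mu> * k (\<mu> * (x - h))))" by simp
    also have "\<dots> \<le> \<bar>s\<bar> * \<bar>LINT x|lborel. \<rho> x * (\<mu> * k (\<mu> * (x - h)))\<bar>" by (metis abs_ge_self abs_mult)
    also have "\<dots> = cmod (complex_of_real (LINT x|lborel. \<rho> x * (\<mu> * k (\<mu> * (x - h)))))" by (simp only: s(1) norm_of_real mult_1)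
    also have "complex_of_real (LINT x|lborel. \<rho> x * (\<mu> * k (\<mu> * (x - h)))) = pairing \<psi> h"
      unfolding pairing_def four of_real_mult[symmetric] by (rule integral_complex_of_real[symmetric])
    finally show ?thesis .
  qed
  have "\<forall>\<^sub>F h in at_top. dist (pairing \<psi> h) 0 < \<epsilon> * I / 2"
    using van[OF \<psi>] \<epsilon> I unfolding vanishing_def by (intro tendstoD) auto
  then obtain h0 where h0: "\<And>h. h \<ge> h0 \<Longrightarrow> cmod (pairing \<psi> h) < \<epsilon> * I / 2"
    unfolding eventually_at_top_linorder by auto
  show "\<forall>\<^sub>F x in at_top. dist (\<rho> x) 0 < \<epsilon>0"
    \<comment> \<open>The threshold keeps both window centres \<open>x + \<eta>\<close> and
      \<open>x - \<eta>\<close> beyond \<open>h0\<close> and the windows inside the half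
      line.\<close>
    using eventually_ge_at_top[of "\<bar>h0\<bar> + 2 * \<eta>"]
  proof eventually_elim
    case (elim x)
    have "\<rho> x < \<epsilon>0"
    proof (rule ccontr)
      assume "\<not> \<rho> x < \<epsilon>0"
      then have big: "\<rho> x \<ge> 2 * \<epsilon>" by (simp add: \<epsilon>_def)
      have "\<epsilon> * I / 2 \<le> cmod (pairing \<psi> (x + \<eta>))"
      proof (rule low[of 1])
        fix y assume "\<bar>y - (x + \<eta>)\<bar> \<le> \<eta>"
        then have y: "x \<le> y" "y - x \<le> 2 * \<eta>" by (auto simp: abs_le_iff)
        then have "\<rho> y - \<rho> x \<ge> - L * (y - x)" using elim \<eta>(1) by (intro L(2)) auto
        moreover have "L * (y - x) \<le> L * (2 * \<eta>)" using y(2) L(1) by (intro mult_left_mono) auto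
        moreover have "L * (2 * \<eta>) = \<epsilon>" using \<eta>(2) by (simp add: mult_ac)
        ultimately show "1 * \<rho> y \<ge> \<epsilon>" using big by linarith
      qed simp
      moreover have "cmod (pairing \<psi> (x + \<eta>)) < \<epsilon> * I / 2" using elim \<eta>(1) by (intro h0) linarith
      ultimately show False by linarith
    qed
    moreover have "\<rho> x > - \<epsilon>0"
    proof (rule ccontr)
      assume "\<not> \<rho> x > - \<epsilon>0"
      then have big: "\<rho> x \<le> - 2 * \<epsilon>" by (simp add: \<epsilon>_def)
      have "\<epsilon> * I / 2 \<le> cmod (pairing \<psi> (x - \<eta>))"
      proof (rule low[of "-1"])
        fix y assume "\<bar>y - (x - \<eta>)\<bar> \<le> \<eta>"
        then have y: "y \<le> x" "x - y \<le> 2 * \<eta>" "0 \<le> y" using elim by (auto simp: abs_le_iff)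
        then have "\<rho> x - \<rho> y \<ge> - L * (x - y)" by (intro L(2)) auto
        moreover have "L * (x - y) \<le> L * (2 * \<eta>)" using y(2) L(1) by (intro mult_left_mono) auto
        moreover have "L * (2 * \<eta>) = \<epsilon>" using \<eta>(2) by (simp add: mult_ac)
        ultimately show "-1 * \<rho> y \<ge> \<epsilon>" using big by linarith
      qed simp
      moreover have "cmod (pairing \<psi> (x - \<eta>)) < \<epsilon> * I / 2" using elim \<eta>(1) by (intro h0) linarith
      ultimately show False by linarith
    qed
    ultimately show ?case by (simp add: dist_real_def abs_less_iff)
  qed
qed

end

section \<open>Riemann--Stieltjes integration by parts\<close>

text \<open>\<open>rs_integral\<close> is a definite description; uniqueness holds because
  equidistant partitions of arbitrarily small mesh exist when \<open>a < b\<close>.\<close>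

lemma has_rs_integral_unique:
  assumes "a < b" "has_rs_integral f g a b I" "has_rs_integral f g a b J"
  shows "I = J"
proof (rule ccontr)
  assume "I \<noteq> J"
  define \<epsilon> where "\<epsilon> = norm (I - J) / 2"
  have \<epsilon>: "\<epsilon> > 0" using \<open>I \<noteq> J\<close> by (simp add: \<epsilon>_def)
  obtain d1 where d1: "d1 > 0" "\<And>x \<xi> n. tagged_partition a b x \<xi> n \<Longrightarrow> (\<forall>i<n. x (Suc i) - x i < d1)
        \<Longrightarrow> norm (rs_sum f g x \<xi> n - I) < \<epsilon>"
    using assms(2) \<epsilon> unfolding has_rs_integral_def by meson
  obtain d2 where d2: "d2 > 0" "\<And>x \<xi> n. tagged_partition a b x \<xi> n \<Longrightarrow> (\<forall>i<n. x (Suc i) - x i < d2)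
        \<Longrightarrow> norm (rs_sum f g x \<xi> n - J) < \<epsilon>"
    using assms(3) \<epsilon> unfolding has_rs_integral_def by meson
  obtain n0 :: nat where n0: "(b - a) / min d1 d2 < n0" using reals_Archimedean2 by blast
  have pos: "(b - a) / min d1 d2 > 0" using assms(1) d1(1) d2(1) by simp
  have n: "real n0 > 0" using n0 pos by linarith
  define h where "h = (b - a) / n0"
  define x where "x = (\<lambda>i. a + real i * h)"
  have "b - a < n0 * min d1 d2" using n0 d1(1) d2(1) by (simp add: pos_divide_less_eq)
  then have h: "h > 0" "h < min d1 d2"
    using assms(1) n unfolding h_def by (simp_all only: pos_divide_less_eq zero_less_divide_iff mult.commute) auto
  have xs: "x (Suc i) - x i = h" for i by (simp add: x_def algebra_simps)
  have tp: "tagged_partition a b x x n0"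
    unfolding tagged_partition_def
  proof (intro conjI allI impI)
    show "x 0 = a" by (simp add: x_def)
    show "x n0 = b" using n by (simp add: x_def h_def)
    fix i show "x i < x (Suc i)" "x i \<le> x (Suc i)" using xs[of i] h(1) by linarith+
  qed simp
  have "norm (rs_sum f g x x n0 - I) < \<epsilon>" "norm (rs_sum f g x x n0 - J) < \<epsilon>"
    using d1(2)[OF tp] d2(2)[OF tp] xs h(2) by simp_all
  then have "norm (I - J) < \<epsilon> + \<epsilon>"
    using norm_triangle_ineq4[of "rs_sum f g x x n0 - J" "rs_sum f g x x n0 - I"] by simp
  then show False by (simp add: \<epsilon>_def)
qed

lemma rs_integral_eqI:
  assumes "a < b" "has_rs_integral f g a b I"
  shows "rs_integral f g a b = I"
  unfolding rs_integral_def
  by (rule the_equality[where P = "has_rs_integral f g a b", OF assms(2)]) (rule has_rs_integral_unique[OF assms(1) _ assms(2)])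

text \<open>The tag splits the cell. Integrating by parts with \<open>S - S c\<close> to its left
  and \<open>S - S d\<close> to its right, the boundary terms combine exactly to
  \<open>f \<xi> * (S d - S c)\<close>, and only integrals controlled by the oscillation of
  \<open>S\<close> remain.\<close>

lemma rs_interval_estimate:
  fixes f f' :: "real \<Rightarrow> complex" and S :: "real \<Rightarrow> real"
  assumes f: "\<And>x. (f has_vector_derivative f' x) (at x)"
    and L: "\<And>x. c \<le> x \<Longrightarrow> x \<le> d \<Longrightarrow> cmod (f' x) \<le> L"
    and V: "\<And>x. c \<le> x \<Longrightarrow> x \<le> d \<Longrightarrow> \<bar>S x - S c\<bar> \<le> V" "\<And>x. c \<le> x \<Longrightarrow> x \<le> d \<Longrightarrow> \<bar>S x - S d\<bar> \<le> V"
    and int: "(\<lambda>u. complex_of_real (S u) * f' u) integrable_on {c..d}"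
    and \<xi>: "c \<le> \<xi>" "\<xi> \<le> d"
  shows "cmod (f \<xi> * complex_of_real (S d - S c) -
    (f d * complex_of_real (S d) - f c * complex_of_real (S c) - integral {c..d} (\<lambda>u. complex_of_real (S u) * f' u)))
     \<le> L * V * (d - c)"
proof -
  let ?h = "\<lambda>u. complex_of_real (S u) * f' u"
  have LV: "L \<ge> 0" "V \<ge> 0"
    using L[of c] V(1)[of c] \<xi> norm_ge_zero[of "f' c"] abs_ge_zero[of "S c - S c"] by linarith+
  have piece: "((\<lambda>u. complex_of_real (S u - q) * f' u) has_integral
      integral {x..y} ?h - complex_of_real q * (f y - f x)) {x..y}"
    if "c \<le> x" "x \<le> y" "y \<le> d" for x y q
  proof -
    have "?h integrable_on {x..y}" using int that by (intro integrable_subinterval_real[OF int]) auto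
    then have "(?h has_integral integral {x..y} ?h) {x..y}" by (rule integrable_integral)
    moreover have "(f' has_integral (f y - f x)) {x..y}"
      using that by (intro fundamental_theorem_of_calculus has_vector_derivative_at_within[OF f])
    ultimately have "((\<lambda>u. ?h u - complex_of_real q * f' u) has_integral
      integral {x..y} ?h - complex_of_real q * (f y - f x)) {x..y}"
      by (intro has_integral_diff has_integral_mult_right)
    then show ?thesis by (simp add: algebra_simps)
  qed
  have b1: "cmod (integral {c..\<xi>} ?h - complex_of_real (S c) * (f \<xi> - f c)) \<le> (V * L) * measure lborel {c..\<xi>}"
  proof (rule has_integral_bound_real[OF _ _ piece])
    fix u assume "u \<in> {c..\<xi>} - {}"
    then show "cmod (complex_of_real (S u - S c) * f' u) \<le> V * L"
      using V(1)[of u] L[of u] \<xi> LV unfolding norm_mult norm_of_real by (intro mult_mono) auto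
  qed (use LV \<xi> in auto)
  have b2: "cmod (integral {\<xi>..d} ?h - complex_of_real (S d) * (f d - f \<xi>)) \<le> (V * L) * measure lborel {\<xi>..d}"
  proof (rule has_integral_bound_real[OF _ _ piece])
    fix u assume "u \<in> {\<xi>..d} - {}"
    then show "cmod (complex_of_real (S u - S d) * f' u) \<le> V * L"
      using V(2)[of u] L[of u] \<xi> LV unfolding norm_mult norm_of_real by (intro mult_mono) auto
  qed (use LV \<xi> in auto)
  have "integral {c..d} ?h = integral {c..\<xi>} ?h + integral {\<xi>..d} ?h"
    using Henstock_Kurzweil_Integration.integral_combine[OF \<xi> int] by simp
  then have "f \<xi> * complex_of_real (S d - S c) - (f d * complex_of_real (S d) - f c * complex_of_real (S c) - integral {c..d} ?h)
    = (integral {c..\<xi>} ?h - complex_of_real (S c) * (f \<xi> - f c)) + (integral {\<xi>..d} ?h - complex_of_real (S d) * (f d - f \<xi>))"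
    by (simp add: algebra_simps)
  also have "cmod \<dots> \<le> (V * L) * measure lborel {c..\<xi>} + (V * L) * measure lborel {\<xi>..d}"
    by (rule order_trans[OF norm_triangle_ineq add_mono[OF b1 b2]])
  also have "\<dots> = L * V * (d - c)" using \<xi> by (simp add: algebra_simps)
  finally show ?thesis .
qed

text \<open>\<open>W\<close> plays the role of a variation function. Summing the cell estimates, the
  error is at most the mesh times a bound for \<open>f'\<close> times the increment of
  \<open>W\<close>, so jumps of \<open>S\<close> do no harm.\<close>

lemma rs_integral_by_parts:
  fixes f f' :: "real \<Rightarrow> complex" and S W :: "real \<Rightarrow> real"
  assumes ab: "a < b"
    and f: "\<And>x. (f has_vector_derivative f' x) (at x)" "continuous_on UNIV f'"
    and W: "\<And>x y. a \<le> x \<Longrightarrow> x \<le> y \<Longrightarrow> y \<le> b \<Longrightarrow> \<bar>S y - S x\<bar> \<le> W y - W x"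
    and int: "(\<lambda>u. complex_of_real (S u) * f' u) integrable_on {a..b}"
  shows "rs_integral f S a b = f b * complex_of_real (S b) - f a * complex_of_real (S a)
    - integral {a..b} (\<lambda>u. complex_of_real (S u) * f' u)"
proof (rule rs_integral_eqI[OF ab])
  let ?h = "\<lambda>u. complex_of_real (S u) * f' u"
  let ?I = "f b * complex_of_real (S b) - f a * complex_of_real (S a) - integral {a..b} ?h"
  have "bounded (f' ` {a..b})"
    using f(2) by (intro compact_imp_bounded compact_continuous_image continuous_on_subset[OF f(2)]) auto
  then obtain L where L: "L > 0" "\<And>x. a \<le> x \<Longrightarrow> x \<le> b \<Longrightarrow> cmod (f' x) \<le> L"
    unfolding bounded_pos by auto
  have Wab: "W b - W a \<ge> 0" using W[of a b] ab by linarith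
  show "has_rs_integral f S a b ?I"
    unfolding has_rs_integral_def
  proof (intro allI impI)
    fix \<epsilon> :: real assume \<epsilon>: "\<epsilon> > 0"
    define \<delta> where "\<delta> = \<epsilon> / (L * (W b - W a) + 1)"
    have LW: "L * (W b - W a) \<ge> 0" using L(1) Wab by simp
    have \<delta>: "\<delta> > 0" "\<delta> * (L * (W b - W a)) < \<epsilon>"
      using \<epsilon> LW by (auto simp: \<delta>_def field_simps)
    show "\<exists>\<delta>>0. \<forall>x \<xi> n. tagged_partition a b x \<xi> n \<and> (\<forall>i<n. x (Suc i) - x i < \<delta>)
        \<longrightarrow> norm (rs_sum f S x \<xi> n - ?I) < \<epsilon>"
    proof (intro exI[of _ \<delta>] conjI allI impI \<delta>(1))
      fix x \<xi> n assume "tagged_partition a b x \<xi> n \<and> (\<forall>i<n. x (Suc i) - x i < \<delta>)"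
      then have x0: "x 0 = a" and xn: "x n = b"
        and step: "\<And>i. i < n \<Longrightarrow> x i < x (Suc i)"
        and tag: "\<And>i. i < n \<Longrightarrow> x i \<le> \<xi> i" "\<And>i. i < n \<Longrightarrow> \<xi> i \<le> x (Suc i)"
        and mesh: "\<And>i. i < n \<Longrightarrow> x (Suc i) - x i < \<delta>"
        unfolding tagged_partition_def by blast+
      have ge: "a \<le> x i" if "i \<le> n" for i
        using that by (induction i) (use x0 step in \<open>auto simp: Suc_le_eq intro: order_trans less_imp_le\<close>)
      have le: "x i \<le> b" if "i \<le> n" for i
        using that by (induction i rule: inc_induct) (use xn step in \<open>auto intro: order_trans less_imp_le\<close>)
      have tele: "integral {a..x m} ?h = (\<Sum>i<m. integral {x i..x (Suc i)} ?h)" if "m \<le> n" for m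
        using that
      proof (induction m)
        case 0
        then show ?case by (simp add: x0)
      next
        case (Suc m)
        have "?h integrable_on {a..x (Suc m)}"
          by (rule integrable_subinterval_real[OF int]) (use ge[of "Suc m"] le[of "Suc m"] Suc.prems in auto)
        then have "integral {a..x (Suc m)} ?h = integral {a..x m} ?h + integral {x m..x (Suc m)} ?h"
          using ge[of m] step[of m] Suc.prems
          by (intro Henstock_Kurzweil_Integration.integral_combine[symmetric]) auto
        then show ?case using Suc by simp
      qed
      have "rs_sum f S x \<xi> n - ?I = (\<Sum>i<n. f (\<xi> i) * complex_of_real (S (x (Suc i)) - S (x i)))
        - ((\<Sum>i<n. f (x (Suc i)) * complex_of_real (S (x (Suc i))) - f (x i) * complex_of_real (S (x i)))
         - (\<Sum>i<n. integral {x i..x (Suc i)} ?h))"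
        unfolding rs_sum_def sum_lessThan_telescope[of "\<lambda>i. f (x i) * complex_of_real (S (x i))"]
        using tele[of n] by (simp add: x0 xn)
      also have "\<dots> = (\<Sum>i<n. f (\<xi> i) * complex_of_real (S (x (Suc i)) - S (x i)) -
         (f (x (Suc i)) * complex_of_real (S (x (Suc i))) - f (x i) * complex_of_real (S (x i)) - integral {x i..x (Suc i)} ?h))"
        by (simp only: sum_subtractf)
      finally have eq: "rs_sum f S x \<xi> n - ?I = (\<Sum>i<n. f (\<xi> i) * complex_of_real (S (x (Suc i)) - S (x i)) -
         (f (x (Suc i)) * complex_of_real (S (x (Suc i))) - f (x i) * complex_of_real (S (x i)) - integral {x i..x (Suc i)} ?h))" .
      have "norm (rs_sum f S x \<xi> n - ?I) \<le> (\<Sum>i<n. \<delta> * L * (W (x (Suc i)) - W (x i)))"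
        unfolding eq
      proof (rule sum_norm_le)
        fix i assume "i \<in> {..<n}"
        then have i: "i < n" by simp
        have rng: "a \<le> x i" "x (Suc i) \<le> b" "x i \<le> x (Suc i)" using ge[of i] le[of "Suc i"] step[OF i] i by auto
        let ?V = "W (x (Suc i)) - W (x i)"
        have mono: "W u \<le> W v" if "a \<le> u" "u \<le> v" "v \<le> b" for u v
          using W[OF that] abs_ge_zero[of "S v - S u"] by linarith
        have "cmod (f (\<xi> i) * complex_of_real (S (x (Suc i)) - S (x i)) -
         (f (x (Suc i)) * complex_of_real (S (x (Suc i))) - f (x i) * complex_of_real (S (x i)) - integral {x i..x (Suc i)} ?h))
          \<le> L * ?V * (x (Suc i) - x i)"
        proof (rule rs_interval_estimate[where f = f and S = S and f' = f' and L = L and V = ?V, OF f(1) _ _ _ _ tag[OF i]])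
          fix u assume u: "x i \<le> u" "u \<le> x (Suc i)"
          show "cmod (f' u) \<le> L" using u rng by (intro L(2)) auto
          have "\<bar>S u - S (x i)\<bar> \<le> W u - W (x i)" using u rng by (intro W) auto
          moreover have "W u \<le> W (x (Suc i))" using u rng by (intro mono) auto
          ultimately show "\<bar>S u - S (x i)\<bar> \<le> ?V" by linarith
          have "\<bar>S (x (Suc i)) - S u\<bar> \<le> W (x (Suc i)) - W u" using u rng by (intro W) auto
          moreover have "W (x i) \<le> W u" using u rng by (intro mono) auto
          ultimately show "\<bar>S u - S (x (Suc i))\<bar> \<le> ?V" by linarith
        next
          show "?h integrable_on {x i..x (Suc i)}"
            by (rule integrable_subinterval_real[OF int]) (use rng in auto)
        qed
        also have "\<dots> \<le> L * ?V * \<delta>"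
          using mesh[OF i] L(1) mono[of "x i" "x (Suc i)"] rng by (intro mult_left_mono) auto
        finally show "cmod (f (\<xi> i) * complex_of_real (S (x (Suc i)) - S (x i)) -
         (f (x (Suc i)) * complex_of_real (S (x (Suc i))) - f (x i) * complex_of_real (S (x i)) - integral {x i..x (Suc i)} ?h))
          \<le> \<delta> * L * ?V" by (simp add: mult_ac)
      qed
      also have "\<dots> = \<delta> * L * (W b - W a)"
        unfolding sum_distrib_left[symmetric] sum_lessThan_telescope[of "\<lambda>i. W (x i)"] by (simp add: x0 xn)
      also have "\<dots> < \<epsilon>" using \<delta>(2) by (simp add: mult_ac)
      finally show "norm (rs_sum f S x \<xi> n - ?I) < \<epsilon>" .
    qed
  qed
qed

section \<open>Laplace integrals of exponentials on the half line\<close>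

lemma integrable_exp_half_line:
  assumes "c > 0" shows "integrable lborel (\<lambda>x::real. indicator {0..} x * exp (- (c * x)))"
proof -
  have "integrable lborel (\<lambda>x::real. indicator {0<..} x *\<^sub>R exp (- (x * c)))"
    using integrable_I0i_exp_mscale[OF assms] unfolding set_integrable_def .
  moreover have "integrable lborel (\<lambda>x::real. indicator {0<..} x *\<^sub>R exp (- (x * c))) \<longleftrightarrow>
      integrable lborel (\<lambda>x::real. indicator {0..} x * exp (- (c * x)))"
    by (rule integrable_discrete_difference[where X = "{0}"]) (auto simp: indicator_def mult.commute)
  ultimately show ?thesis by simp
qed

lemma integrable_cexp_half_line:
  assumes "Re z > 0" shows "integrable lborel (\<lambda>x. indicator {0..} x *\<^sub>R exp (- (z * complex_of_real x)))"
proof (rule Bochner_Integration.integrable_bound[OF integrable_exp_half_line[OF assms]])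
  show "AE x in lborel. norm (indicator {0..} x *\<^sub>R exp (- (z * complex_of_real x))) \<le> norm (indicator {0..} x * exp (- (Re z * x)))"
    by (intro AE_I2) (simp add: norm_exp_eq_Re indicator_def)
qed measurable

lemma integral_cexp_half_line:
  assumes "Re z > 0" shows "(LINT x|lborel. indicator {0..} x *\<^sub>R exp (- (z * complex_of_real x))) = 1 / z"
proof -
  let ?e = "\<lambda>x. exp (- (z * complex_of_real x))"
  have z: "z \<noteq> 0" using assms by auto
  have der: "((\<lambda>x. - (1 / z) * ?e x) has_vector_derivative ?e x) (at x)" for x
  proof -
    have "((\<lambda>w. - (1 / z) * exp (- (z * w))) has_field_derivative ?e x) (at (complex_of_real x))"
      using z by (auto intro!: derivative_eq_intros)
    from has_vector_derivative_real_field[OF this] show ?thesis .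
  qed
  have fin: "(LINT x|lborel. indicator {0..real n} x *\<^sub>R ?e x) = - (1 / z) * ?e n - - (1 / z) * ?e 0" for n
    by (intro integral_FTC_Icc has_vector_derivative_at_within[OF der] continuous_intros) simp
  have "(\<lambda>n. LINT x|lborel. indicator {0..real n} x *\<^sub>R ?e x) \<longlonglongrightarrow> (LINT x|lborel. indicator {0..} x *\<^sub>R ?e x)"
  proof (rule integral_exhaustion[OF integrable_cexp_half_line[OF assms]])
    show "\<forall>\<^sub>F n in sequentially. x \<in> {0..real n}" if "x \<in> {0..}" for x
      using eventually_le_real_sequentially[of x] by eventually_elim (use that in auto)
  qed auto
  moreover have "(\<lambda>n. - (1 / z) * ?e (real n) - - (1 / z) * ?e 0) \<longlonglongrightarrow> - (1 / z) * 0 - - (1 / z) * ?e 0"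
  proof (intro tendsto_intros)
    have "(\<lambda>n. exp (- (Re z * real n))) \<longlonglongrightarrow> 0"
      using assms by (intro filterlim_compose[OF exp_at_bot] filterlim_uminus_at_bot_at_top[THEN filterlim_compose]
          filterlim_tendsto_pos_mult_at_top[OF tendsto_const] filterlim_real_sequentially)
    then show "(\<lambda>n. ?e (real n)) \<longlonglongrightarrow> 0"
      using tendsto_norm_zero_cancel[of "\<lambda>n. ?e (real n)" sequentially] by (simp add: norm_exp_eq_Re)
  qed
  ultimately have "(LINT x|lborel. indicator {0..} x *\<^sub>R ?e x) = - (1 / z) * 0 - - (1 / z) * ?e 0"
    unfolding fin by (rule LIMSEQ_unique)
  then show ?thesis by simp
qed

section \<open>Laplace--Stieltjes transforms\<close>

lemma integral_exp_half_line:
  assumes "c > 0" shows "(LINT x|lborel. indicator {0..} x * exp (- (c * x))) = 1 / (c::real)"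
proof -
  have "complex_of_real (LINT x|lborel. indicator {0..} x * exp (- (c * x))) =
      (LINT x|lborel. indicator {0..} x *\<^sub>R exp (- (complex_of_real c * complex_of_real x)))"
    unfolding integral_complex_of_real[symmetric]
    by (intro Bochner_Integration.integral_cong refl) (simp add: scaleR_conv_of_real exp_of_real[symmetric])
  also have "\<dots> = complex_of_real (1 / c)"
    using integral_cexp_half_line[of "complex_of_real c"] assms by simp
  finally show ?thesis by (simp only: of_real_eq_iff)
qed

locale laplace_signal =
  fixes S :: "real \<Rightarrow> real" and \<alpha> :: real
  assumes S_mono: "mono_on {0..} S"
    and S_neg: "\<And>x. x < 0 \<Longrightarrow> S x = 0"
    and alpha_pos: "\<alpha> > 0"
    and S_conv: "\<And>s. Re s > \<alpha> \<Longrightarrow> laplace_converges S s"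
begin

lemma S_le: "0 \<le> x \<Longrightarrow> x \<le> y \<Longrightarrow> S x \<le> S y"
  using S_mono by (rule mono_onD) auto

lemma S_measurable [measurable]: "S \<in> borel_measurable borel"
proof -
  have "mono (\<lambda>x. S (max x 0))" by (intro monoI S_le) auto
  then have [measurable]: "(\<lambda>x. S (max x 0)) \<in> borel_measurable borel" by (rule borel_measurable_mono)
  have "S = (\<lambda>x. if x < 0 then 0 else S (max x 0))" using S_neg by (auto simp: max_def)
  also have "\<dots> \<in> borel_measurable borel" by measurable
  finally show ?thesis .
qed

text \<open>The total variation of \<open>S\<close> up to \<open>x\<close>. Since \<open>S 0\<close>
  may be negative, the jump at 0 counts with its absolute value.\<close>

definition S_var :: "real \<Rightarrow> real" where
  "S_var x = (if x < 0 then 0 else S x - S 0 + \<bar>S 0\<bar>)"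

lemma S_var_diff: "x \<le> y \<Longrightarrow> \<bar>S y - S x\<bar> \<le> S_var y - S_var x"
  using S_le[of x y] S_le[of 0 y] S_neg[of x] S_neg[of y] by (auto simp: S_var_def abs_if)

lemma S_var_mono: "x \<le> y \<Longrightarrow> S_var x \<le> S_var y"
  using S_var_diff[of x y] by linarith

lemma abs_S_le: "x \<le> y \<Longrightarrow> \<bar>S x\<bar> \<le> S_var y"
  using S_var_mono[of x y] S_le[of 0 x] S_neg[of x] by (auto simp: S_var_def abs_if split: if_splits)

lemma S_lower: "S x \<ge> - \<bar>S 0\<bar>"
  using S_le[of 0 x] S_neg[of x] by (cases "x < 0") auto

lemma S_exp_integrable_on:
  "integrable lborel (\<lambda>u. indicator {a..b} u *\<^sub>R (complex_of_real (S u) * exp (- (w * complex_of_real u))))"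
proof (rule Bochner_Integration.integrable_bound)
  have "integrable lborel (\<lambda>u. indicator {a..b} u *\<^sub>R exp (- (w * complex_of_real u)))"
    by (intro borel_integrable_compact continuous_intros) simp
  then show "integrable lborel (\<lambda>u. S_var b * cmod (indicator {a..b} u *\<^sub>R exp (- (w * complex_of_real u))))"
    by (intro integrable_mult_right integrable_norm)
  show "AE u in lborel. norm (indicator {a..b} u *\<^sub>R (complex_of_real (S u) * exp (- (w * complex_of_real u))))
     \<le> norm (S_var b * cmod (indicator {a..b} u *\<^sub>R exp (- (w * complex_of_real u))))"
  proof (rule AE_I2)
    fix u
    show "norm (indicator {a..b} u *\<^sub>R (complex_of_real (S u) * exp (- (w * complex_of_real u))))
     \<le> norm (S_var b * cmod (indicator {a..b} u *\<^sub>R exp (- (w * complex_of_real u))))"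
    proof (cases "u \<in> {a..b}")
      case True
      then have "\<bar>S u\<bar> \<le> \<bar>S_var b\<bar>" using abs_S_le[of u b] by auto
      then show ?thesis using True by (simp add: norm_mult abs_mult mult_right_mono)
    qed simp
  qed
qed measurable

lemma rs_integral_exp:
  assumes "a < b"
  shows "rs_integral (\<lambda>u. exp (- (w * complex_of_real u))) S a b =
    exp (- (w * complex_of_real b)) * complex_of_real (S b) - exp (- (w * complex_of_real a)) * complex_of_real (S a)
    + w * (LINT u|lborel. indicator {a..b} u *\<^sub>R (complex_of_real (S u) * exp (- (w * complex_of_real u))))"
proof -
  let ?f = "\<lambda>u. exp (- (w * complex_of_real u))"
  let ?h = "\<lambda>u. complex_of_real (S u) * ?f u"
  have si: "set_integrable lborel {a..b} ?h"
    unfolding set_integrable_def by (rule S_exp_integrable_on)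
  have int: "?h integrable_on {a..b}" by (rule set_borel_integral_eq_integral(1)[OF si])
  have val: "integral {a..b} ?h = (LINT u|lborel. indicator {a..b} u *\<^sub>R ?h u)"
    using set_borel_integral_eq_integral(2)[OF si] unfolding set_lebesgue_integral_def by simp
  have eq: "(\<lambda>u. complex_of_real (S u) * (- w * ?f u)) = (\<lambda>u. - w * ?h u)" by auto
  have "rs_integral ?f S a b = ?f b * complex_of_real (S b) - ?f a * complex_of_real (S a)
    - integral {a..b} (\<lambda>u. complex_of_real (S u) * (- w * ?f u))"
  proof (rule rs_integral_by_parts[OF assms, where W = S_var])
    fix x
    have "((\<lambda>z. exp (- (w * z))) has_field_derivative - w * ?f x) (at (complex_of_real x))"
      by (auto intro!: derivative_eq_intros)
    from has_vector_derivative_real_field[OF this]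
    show "(?f has_vector_derivative - w * ?f x) (at x)" .
  next
    show "continuous_on UNIV (\<lambda>u. - w * ?f u)" by (intro continuous_intros)
    show "(\<lambda>u. complex_of_real (S u) * (- w * ?f u)) integrable_on {a..b}"
      unfolding eq by (rule integrable_on_mult_right[OF int])
  qed (rule S_var_diff)
  then show ?thesis unfolding eq by (simp add: val)
qed

definition partial_transform :: "complex \<Rightarrow> real \<Rightarrow> complex" where
  "partial_transform w X = (LINT u|lborel. indicator {..X} u *\<^sub>R (complex_of_real (S u) * exp (- (w * complex_of_real u))))"

lemma partial_transform_eq:
  assumes "a \<le> 0"
  shows "(LINT u|lborel. indicator {a..X} u *\<^sub>R (complex_of_real (S u) * exp (- (w * complex_of_real u)))) = partial_transform w X"
  unfolding partial_transform_def
proof (intro Bochner_Integration.integral_cong refl)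
  fix u
  show "indicator {a..X} u *\<^sub>R (complex_of_real (S u) * exp (- (w * complex_of_real u))) =
      indicator {..X} u *\<^sub>R (complex_of_real (S u) * exp (- (w * complex_of_real u)))"
    using S_neg[of u] assms by (cases "u < 0") (simp_all add: indicator_def)
qed

lemma laplace_partial_eq:
  assumes "X \<ge> 0"
  shows "laplace_partial S s X = exp (- (s * complex_of_real X)) * complex_of_real (S X) + s * partial_transform s X"
  unfolding laplace_partial_def
  using rs_integral_exp[of "-1" X s] assms partial_transform_eq[of "-1" X s] S_neg[of "-1"] by simp

lemma rs_integral_0_eq:
  assumes "X > 0"
  shows "rs_integral (\<lambda>u. exp (- (w * complex_of_real u))) S 0 X =
    exp (- (w * complex_of_real X)) * complex_of_real (S X) - complex_of_real (S 0) + w * partial_transform w X"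
  using rs_integral_exp[of 0 X w] assms partial_transform_eq[of 0 X w] by simp

text \<open>By parts, convergence at the real point \<open>\<sigma>\<close> bounds, for large X,
  \<open>exp (- (\<sigma> * X)) * S X\<close> plus \<open>\<sigma>\<close> times a truncated
  integral of \<open>S\<close>. The latter is bounded below because \<open>S\<close> is, so the
  former is bounded above.\<close>

lemma S_growth:
  assumes "\<sigma> > \<alpha>"
  obtains C where "C \<ge> 0" "\<And>x. \<bar>S x\<bar> \<le> C * exp (\<sigma> * x)"
proof -
  have \<sigma>: "\<sigma> > 0" using assms alpha_pos by linarith
  obtain l where "((\<lambda>X. laplace_partial S (complex_of_real \<sigma>) X) \<longlongrightarrow> l) at_top"
    using S_conv[of "complex_of_real \<sigma>"] assms unfolding laplace_converges_def by auto
  then have "\<forall>\<^sub>F X in at_top. dist (laplace_partial S (complex_of_real \<sigma>) X) l < 1" by (rule tendstoD) simp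
  then obtain X0 where X0: "\<And>X. X \<ge> X0 \<Longrightarrow> cmod (laplace_partial S (complex_of_real \<sigma>) X - l) < 1"
    unfolding eventually_at_top_linorder dist_norm by blast
  define X1 where "X1 = max X0 0"
  have up: "exp (- (\<sigma> * X)) * S X \<le> cmod l + 1 + \<bar>S 0\<bar>" if X: "X \<ge> X1" for X
  proof -
    let ?J = "LINT u|lborel. indicator {..X} u * (S u * exp (- (\<sigma> * u)))"
    have "X \<ge> 0" "X \<ge> X0" using X by (auto simp: X1_def)
    have eq: "indicator {..X} u *\<^sub>R (complex_of_real (S u) * exp (- (complex_of_real \<sigma> * complex_of_real u))) =
        complex_of_real (indicator {..X} u * (S u * exp (- (\<sigma> * u))))" for u
      by (simp add: scaleR_conv_of_real exp_of_real[symmetric])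
    have "partial_transform (complex_of_real \<sigma>) X = complex_of_real ?J"
      unfolding partial_transform_def eq by (rule integral_complex_of_real)
    then have pe: "laplace_partial S (complex_of_real \<sigma>) X = complex_of_real (exp (- (\<sigma> * X)) * S X + \<sigma> * ?J)"
      unfolding laplace_partial_eq[OF \<open>X \<ge> 0\<close>] by (simp add: exp_of_real[symmetric])
    have "cmod (laplace_partial S (complex_of_real \<sigma>) X) \<le> cmod l + 1"
      using X0[OF \<open>X \<ge> X0\<close>] norm_triangle_ineq2[of "laplace_partial S (complex_of_real \<sigma>) X" l] by linarith
    then have "exp (- (\<sigma> * X)) * S X + \<sigma> * ?J \<le> cmod l + 1"
      using abs_ge_self[of "exp (- (\<sigma> * X)) * S X + \<sigma> * ?J"] unfolding pe norm_of_real by linarith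
    moreover have "?J \<ge> - \<bar>S 0\<bar> * (1 / \<sigma>)"
    proof -
      have "integrable lborel (\<lambda>u. indicator {0..X} u *\<^sub>R (complex_of_real (S u) * exp (- (complex_of_real \<sigma> * complex_of_real u))))"
        by (rule S_exp_integrable_on)
      moreover have "indicator {0..X} u *\<^sub>R (complex_of_real (S u) * exp (- (complex_of_real \<sigma> * complex_of_real u))) =
        complex_of_real (indicator {..X} u * (S u * exp (- (\<sigma> * u))))" for u
        using S_neg[of u] by (cases "u < 0") (simp_all add: indicator_def exp_of_real[symmetric])
      ultimately have i1: "integrable lborel (\<lambda>u. indicator {..X} u * (S u * exp (- (\<sigma> * u))))"
        by (simp only: complex_of_real_integrable_eq)
      have "(LINT u|lborel. - \<bar>S 0\<bar> * (indicator {0..} u * exp (- (\<sigma> * u)))) \<le> ?J"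
      proof (rule integral_mono)
        show "integrable lborel (\<lambda>u. - \<bar>S 0\<bar> * (indicator {0..} u * exp (- (\<sigma> * u))))"
          by (intro integrable_mult_right integrable_exp_half_line \<sigma>)
        show "- \<bar>S 0\<bar> * (indicator {0..} u * exp (- (\<sigma> * u))) \<le> indicator {..X} u * (S u * exp (- (\<sigma> * u)))" for u
        proof (cases "u < 0")
          case False
          have "- \<bar>S 0\<bar> * exp (- (\<sigma> * u)) \<le> S u * exp (- (\<sigma> * u))"
            using S_lower[of u] by (intro mult_right_mono) auto
          moreover have "- \<bar>S 0\<bar> * exp (- (\<sigma> * u)) \<le> 0" by simp
          ultimately show ?thesis using False by (auto simp: indicator_def)
        qed (simp add: S_neg)
      qed (rule i1)
      then show ?thesis by (simp only: integral_mult_right_zero integral_exp_half_line[OF \<sigma>])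
    qed
    then have "\<sigma> * ?J \<ge> \<sigma> * (- \<bar>S 0\<bar> * (1 / \<sigma>))" using \<sigma> by (intro mult_left_mono) auto
    moreover have "\<sigma> * (- \<bar>S 0\<bar> * (1 / \<sigma>)) = - \<bar>S 0\<bar>" using \<sigma> by simp
    ultimately show ?thesis by linarith
  qed
  \<comment> \<open>The last summand covers the initial interval up to \<open>X1\<close>, where
    monotonicity alone bounds \<open>S\<close>.\<close>
  define C where "C = cmod l + 1 + \<bar>S 0\<bar> + S_var X1"
  have W: "S_var X1 \<ge> 0" using abs_S_le[of X1 X1] by linarith
  have Cge: "C \<ge> 0" "cmod l + 1 + \<bar>S 0\<bar> \<le> C" using W norm_ge_zero[of l] unfolding C_def by linarith+
  have "\<bar>S x\<bar> \<le> C * exp (\<sigma> * x)" for x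
  proof -
    consider "x < 0" | "0 \<le> x" "x \<le> X1" | "x \<ge> X1" by linarith
    then show ?thesis
    proof cases
      case 1
      then show ?thesis using S_neg[of x] Cge by simp
    next
      case 2
      have "\<bar>S x\<bar> \<le> C * 1"
        using abs_S_le[OF 2(2)] norm_ge_zero[of l] abs_ge_zero[of "S 0"] unfolding C_def mult_1_right by linarith
      also have "\<dots> \<le> C * exp (\<sigma> * x)" using Cge 2(1) \<sigma> by (intro mult_left_mono) auto
      finally show ?thesis .
    next
      case 3
      then have x: "x \<ge> 0" by (simp add: X1_def)
      have e: "exp (\<sigma> * x) * exp (- (\<sigma> * x)) = 1" by (simp add: exp_minus)
      have "S x = exp (\<sigma> * x) * (exp (- (\<sigma> * x)) * S x)" unfolding mult.assoc[symmetric] e by simp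
      also have "\<dots> \<le> exp (\<sigma> * x) * C" using up[OF 3] Cge by (intro mult_left_mono) (linarith, simp)
      finally have "S x \<le> C * exp (\<sigma> * x)" by (simp add: mult.commute)
      moreover have "- S x \<le> C * exp (\<sigma> * x)"
      proof -
        have "- S x \<le> C * 1" using S_lower[of x] W norm_ge_zero[of l] unfolding C_def mult_1_right by linarith
        also have "\<dots> \<le> C * exp (\<sigma> * x)" using Cge x \<sigma> by (intro mult_left_mono) auto
        finally show ?thesis .
      qed
      ultimately show ?thesis by (simp add: abs_le_iff)
    qed
  qed
  moreover note Cge(1)
  ultimately show ?thesis using that by blast
qed

lemma transform_integrable:
  assumes "Re s > \<alpha>"
  shows "integrable lborel (\<lambda>u. complex_of_real (S u) * exp (- (s * complex_of_real u)))"
proof -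
  \<comment> \<open>A growth exponent strictly between \<open>\<alpha>\<close> and
    \<open>Re s\<close> leaves the integrand exponential decay.\<close>
  define \<sigma> where "\<sigma> = (\<alpha> + Re s) / 2"
  have \<sigma>: "\<sigma> > \<alpha>" "Re s - \<sigma> > 0" using assms by (auto simp: \<sigma>_def field_simps)
  obtain C where C: "C \<ge> 0" "\<And>x. \<bar>S x\<bar> \<le> C * exp (\<sigma> * x)" using S_growth[OF \<sigma>(1)] by metis
  show ?thesis
  proof (rule Bochner_Integration.integrable_bound)
    show "integrable lborel (\<lambda>u. C * (indicator {0..} u * exp (- ((Re s - \<sigma>) * u))))"
      by (intro integrable_mult_right integrable_exp_half_line \<sigma>)
    show "AE u in lborel. norm (complex_of_real (S u) * exp (- (s * complex_of_real u)))
       \<le> norm (C * (indicator {0..} u * exp (- ((Re s - \<sigma>) * u))))"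
    proof (rule AE_I2)
      fix u
      show "norm (complex_of_real (S u) * exp (- (s * complex_of_real u)))
       \<le> norm (C * (indicator {0..} u * exp (- ((Re s - \<sigma>) * u))))"
      proof (cases "u < 0")
        case False
        have "norm (complex_of_real (S u) * exp (- (s * complex_of_real u))) = \<bar>S u\<bar> * exp (- (Re s * u))"
          by (simp add: norm_mult norm_exp_eq_Re)
        also have "\<dots> \<le> (C * exp (\<sigma> * u)) * exp (- (Re s * u))" using C(2) by (intro mult_right_mono) auto
        also have "\<dots> = C * exp (- ((Re s - \<sigma>) * u))" by (simp add: exp_add[symmetric] algebra_simps)
        finally show ?thesis using False C(1) by simp
      qed (simp add: S_neg)
    qed
  qed measurable
qed

lemma laplace_stieltjes_eq:
  assumes "Re s > \<alpha>"
  shows "laplace_stieltjes S s = s * (LINT u|lborel. complex_of_real (S u) * exp (- (s * complex_of_real u)))"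
proof -
  let ?h = "\<lambda>u. complex_of_real (S u) * exp (- (s * complex_of_real u))"
  define \<sigma> where "\<sigma> = (\<alpha> + Re s) / 2"
  have \<sigma>: "\<sigma> > \<alpha>" "Re s - \<sigma> > 0" using assms by (auto simp: \<sigma>_def field_simps)
  obtain C where C: "C \<ge> 0" "\<And>x. \<bar>S x\<bar> \<le> C * exp (\<sigma> * x)" using S_growth[OF \<sigma>(1)] by metis
  have 1: "((\<lambda>X. exp (- (s * complex_of_real X)) * complex_of_real (S X)) \<longlongrightarrow> 0) at_top"
  proof (rule Lim_null_comparison)
    show "\<forall>\<^sub>F X in at_top. norm (exp (- (s * complex_of_real X)) * complex_of_real (S X)) \<le> C * exp (- ((Re s - \<sigma>) * X))"
    proof (rule always_eventually, rule allI)
      fix u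
      have "norm (exp (- (s * complex_of_real u)) * complex_of_real (S u)) = \<bar>S u\<bar> * exp (- (Re s * u))"
        by (simp add: norm_mult norm_exp_eq_Re)
      also have "\<dots> \<le> (C * exp (\<sigma> * u)) * exp (- (Re s * u))" using C(2) by (intro mult_right_mono) auto
      also have "\<dots> = C * exp (- ((Re s - \<sigma>) * u))" by (simp add: exp_add[symmetric] algebra_simps)
      finally show "norm (exp (- (s * complex_of_real u)) * complex_of_real (S u)) \<le> C * exp (- ((Re s - \<sigma>) * u))" .
    qed
    have "filterlim (\<lambda>X. (Re s - \<sigma>) * X) at_top at_top"
      by (rule filterlim_tendsto_pos_mult_at_top[OF tendsto_const \<sigma>(2) filterlim_ident])
    then have "filterlim (\<lambda>X. - ((Re s - \<sigma>) * X)) at_bot at_top" by (simp add: filterlim_uminus_at_bot)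
    then have "((\<lambda>X. exp (- ((Re s - \<sigma>) * X))) \<longlongrightarrow> 0) at_top" by (rule filterlim_compose[OF exp_at_bot])
    then show "((\<lambda>X. C * exp (- ((Re s - \<sigma>) * X))) \<longlongrightarrow> 0) at_top" by (rule tendsto_mult_right_zero)
  qed
  have 2: "((\<lambda>X. partial_transform s X) \<longlongrightarrow> (LINT u|lborel. ?h u)) at_top"
    unfolding partial_transform_def
  proof (rule integral_dominated_convergence_at_top)
    show "integrable lborel (\<lambda>u. norm (?h u))" by (rule integrable_norm[OF transform_integrable[OF assms]])
    show "AE u in lborel. ((\<lambda>X. indicator {..X} u *\<^sub>R ?h u) \<longlongrightarrow> ?h u) at_top"
    proof (rule AE_I2)
      fix u :: real
      have "\<forall>\<^sub>F X in at_top. ?h u = indicator {..X} u *\<^sub>R ?h u"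
        using eventually_ge_at_top[of u] by eventually_elim simp
      then show "((\<lambda>X. indicator {..X} u *\<^sub>R ?h u) \<longlongrightarrow> ?h u) at_top"
        by (rule Lim_transform_eventually[rotated]) simp
    qed
    show "\<forall>\<^sub>F X in at_top. AE u in lborel. norm (indicator {..X} u *\<^sub>R ?h u) \<le> norm (?h u)"
      by (intro always_eventually allI AE_I2) (simp add: indicator_def)
  qed measurable
  have "((\<lambda>X. exp (- (s * complex_of_real X)) * complex_of_real (S X) + s * partial_transform s X)
      \<longlongrightarrow> 0 + s * (LINT u|lborel. ?h u)) at_top"
    by (intro tendsto_add 1 tendsto_mult_left 2)
  moreover have "\<forall>\<^sub>F X in at_top. exp (- (s * complex_of_real X)) * complex_of_real (S X) + s * partial_transform s X
      = laplace_partial S s X"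
    using eventually_ge_at_top[of 0] by eventually_elim (simp add: laplace_partial_eq)
  ultimately have "((\<lambda>X. laplace_partial S s X) \<longlongrightarrow> 0 + s * (LINT u|lborel. ?h u)) at_top"
    by (rule Lim_transform_eventually)
  then show ?thesis unfolding laplace_stieltjes_def by (simp add: tendsto_Lim)
qed

end

text \<open>The arctangent is the argument and the square root the modulus of alpha + i omega; this
  is the origin of phase and amplitude in the asymptotic formula.\<close>

lemma inverse_polar:
  assumes "\<alpha> > 0"
  shows "exp (- (\<i> * complex_of_real (arctan (\<omega> / \<alpha>)))) / complex_of_real (sqrt (\<alpha>\<^sup>2 + \<omega>\<^sup>2)) = 1 / (complex_of_real \<alpha> + \<i> * complex_of_real \<omega>)"
proof -
  define R where "R = sqrt (\<alpha>\<^sup>2 + \<omega>\<^sup>2)"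
  define y where "y = arctan (\<omega> / \<alpha>)"
  have R: "R > 0" unfolding R_def using assms by (simp add: add_pos_nonneg)
  have "sqrt (1 + (\<omega> / \<alpha>)\<^sup>2) = sqrt ((\<alpha>\<^sup>2 + \<omega>\<^sup>2) / \<alpha>\<^sup>2)"
    using assms by (simp add: field_simps)
  also have "\<dots> = R / \<alpha>" using assms by (simp add: R_def real_sqrt_divide)
  finally have q: "sqrt (1 + (\<omega> / \<alpha>)\<^sup>2) = R / \<alpha>" .
  have "cos y = \<alpha> / R" "sin y = \<omega> / R"
    using assms R unfolding y_def cos_arctan sin_arctan q by auto
  then have "exp (\<i> * complex_of_real y) = complex_of_real (\<alpha> / R) + \<i> * complex_of_real (\<omega> / R)"
    unfolding cis_conv_exp[symmetric] by (simp add: complex_eq_iff)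
  then have e: "complex_of_real R * exp (\<i> * complex_of_real y) = complex_of_real \<alpha> + \<i> * complex_of_real \<omega>"
    using R by (simp add: field_simps)
  have "exp (- (\<i> * complex_of_real y)) / complex_of_real R = 1 / (complex_of_real R * exp (\<i> * complex_of_real y))"
    by (simp add: exp_minus divide_inverse mult.commute)
  then show ?thesis unfolding e unfolding R_def y_def .
qed

section \<open>The trigonometric main term and its remainder\<close>

locale laplace_asymptotics = laplace_signal S \<alpha> for S \<alpha> +
  fixes N :: nat and r \<theta> t :: "nat \<Rightarrow> real"
begin

definition trend :: "real \<Rightarrow> real" where
  "trend x = r 0 / \<alpha> + 2 * (\<Sum>n=1..N. r n * cos (t n * x + \<theta> n - arctan (t n / \<alpha>)) / sqrt (\<alpha>\<^sup>2 + (t n)\<^sup>2))"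

definition remainder :: "real \<Rightarrow> real" where
  "remainder x = (if x < 0 then 0 else exp (- \<alpha> * x) * S x - trend x)"

text \<open>A pole at s0 with residue A corresponds to the term (A / s0) exp(s0 x) of S; here s0 is
  alpha or alpha plus or minus i t_n. With one coefficient per frequency, integrals of
  \<open>trend\<close> become combinations of integrals of exponentials.\<close>

lemma trend_complex:
  "complex_of_real (trend x) = complex_of_real (r 0) / complex_of_real \<alpha> + (\<Sum>n=1..N. complex_of_real (r n) *
     (exp (\<i> * complex_of_real (\<theta> n)) * (exp (\<i> * complex_of_real (t n * x)) / (complex_of_real \<alpha> + \<i> * complex_of_real (t n)))
     + exp (- (\<i> * complex_of_real (\<theta> n))) * (exp (\<i> * complex_of_real (- t n * x)) / (complex_of_real \<alpha> + \<i> * complex_of_real (- t n)))))"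
proof -
  have "complex_of_real (2 * (r n * cos (t n * x + \<theta> n - arctan (t n / \<alpha>)) / sqrt (\<alpha>\<^sup>2 + (t n)\<^sup>2))) = complex_of_real (r n) *
     (exp (\<i> * complex_of_real (\<theta> n)) * (exp (\<i> * complex_of_real (t n * x)) / (complex_of_real \<alpha> + \<i> * complex_of_real (t n)))
     + exp (- (\<i> * complex_of_real (\<theta> n))) * (exp (\<i> * complex_of_real (- t n * x)) / (complex_of_real \<alpha> + \<i> * complex_of_real (- t n))))" for n
  proof -
    define y where "y = arctan (t n / \<alpha>)"
    define R where "R = complex_of_real (sqrt (\<alpha>\<^sup>2 + (t n)\<^sup>2))"
    define A where "A = t n * x + \<theta> n - y"
    have i1: "1 / (complex_of_real \<alpha> + \<i> * complex_of_real (t n)) = exp (- (\<i> * complex_of_real y)) / R"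
      unfolding y_def R_def using inverse_polar[OF alpha_pos] by simp
    have i2: "1 / (complex_of_real \<alpha> + \<i> * complex_of_real (- t n)) = exp (\<i> * complex_of_real y) / R"
      unfolding y_def R_def using inverse_polar[OF alpha_pos, of "- t n"] by (simp add: arctan_minus)
    have e1: "exp (\<i> * complex_of_real A) = exp (\<i> * complex_of_real (\<theta> n)) * exp (\<i> * complex_of_real (t n * x)) * exp (- (\<i> * complex_of_real y))"
      unfolding exp_add[symmetric] by (rule arg_cong[where f = exp]) (simp add: A_def algebra_simps)
    have e2: "exp (- (\<i> * complex_of_real A)) = exp (- (\<i> * complex_of_real (\<theta> n))) * exp (\<i> * complex_of_real (- t n * x)) * exp (\<i> * complex_of_real y)"
      unfolding exp_add[symmetric] by (rule arg_cong[where f = exp]) (simp add: A_def algebra_simps)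
    have c: "complex_of_real (2 * (r n * cos A / sqrt (\<alpha>\<^sup>2 + (t n)\<^sup>2))) = complex_of_real (r n) *
        ((exp (\<i> * complex_of_real A) + exp (- (\<i> * complex_of_real A))) / R)"
      by (simp add: R_def cos_of_real[symmetric] cos_exp_eq)
    have "complex_of_real (2 * (r n * cos A / sqrt (\<alpha>\<^sup>2 + (t n)\<^sup>2))) = complex_of_real (r n) *
      (exp (\<i> * complex_of_real (\<theta> n)) * (exp (\<i> * complex_of_real (t n * x)) * (exp (- (\<i> * complex_of_real y)) / R))
      + exp (- (\<i> * complex_of_real (\<theta> n))) * (exp (\<i> * complex_of_real (- t n * x)) * (exp (\<i> * complex_of_real y) / R)))"
      unfolding c e1 e2 by (simp only: add_divide_distrib mult.assoc times_divide_eq_right)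
    then show ?thesis unfolding i1[symmetric] i2[symmetric] unfolding A_def y_def by (simp only: times_divide_eq_right mult_1_right)
  qed
  note E = this
  have "complex_of_real (trend x) = complex_of_real (r 0 / \<alpha>) +
      (\<Sum>n=1..N. complex_of_real (2 * (r n * cos (t n * x + \<theta> n - arctan (t n / \<alpha>)) / sqrt (\<alpha>\<^sup>2 + (t n)\<^sup>2))))"
    unfolding trend_def sum_distrib_left by (simp only: of_real_add of_real_sum)
  then show ?thesis by (simp only: E of_real_divide)
qed

end

section \<open>Boundary behaviour\<close>

lemma abs_cos_diff_le: "\<bar>cos x - cos y\<bar> \<le> \<bar>x - y\<bar>" for x y :: real
proof -
  have "cos x - cos y = 2 * sin ((x + y) / 2) * sin ((y - x) / 2)" by (rule cos_diff_cos)
  then have "\<bar>cos x - cos y\<bar> = 2 * (\<bar>sin ((x + y) / 2)\<bar> * \<bar>sin ((y - x) / 2)\<bar>)" by (simp add: abs_mult)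
  also have "\<bar>sin ((x + y) / 2)\<bar> * \<bar>sin ((y - x) / 2)\<bar> \<le> 1 * \<bar>(y - x) / 2\<bar>"
    by (intro mult_mono abs_sin_le_one abs_sin_x_le_abs_x) auto
  finally show ?thesis by simp
qed

text \<open>Applied with z = s - alpha, a = alpha and w = i omega, so that z + a is s. The first
  summand on the right is a pole that F subtracts; the constants from all poles add up to
  \<open>trend 0\<close>.\<close>

lemma pole_identity:
  fixes z a w A :: complex
  assumes "z \<noteq> w" "a + w \<noteq> 0"
  shows "(z + a) * (A / (a + w) * (1 / (z - w))) = A / (z - w) + A / (a + w)"
proof -
  have d: "z - w \<noteq> 0" using assms by simp
  have "A / (z - w) + A / (a + w) = (A * (a + w) + A * (z - w)) / ((z - w) * (a + w))"
    by (rule add_frac_eq[OF d assms(2)])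
  also have "A * (a + w) + A * (z - w) = (z + a) * A" by (simp add: algebra_simps)
  finally show ?thesis by (simp add: mult.commute)
qed

context laplace_asymptotics
begin

lemma trend_bounded: obtains T where "T \<ge> 0" "\<And>x. \<bar>trend x\<bar> \<le> T"
proof -
  define T where "T = \<bar>r 0 / \<alpha>\<bar> + 2 * (\<Sum>n=1..N. \<bar>r n\<bar> / sqrt (\<alpha>\<^sup>2 + (t n)\<^sup>2))"
  have "\<bar>trend x\<bar> \<le> T" for x
  proof -
    have "\<bar>\<Sum>n=1..N. r n * cos (t n * x + \<theta> n - arctan (t n / \<alpha>)) / sqrt (\<alpha>\<^sup>2 + (t n)\<^sup>2)\<bar>
      \<le> (\<Sum>n=1..N. \<bar>r n\<bar> / sqrt (\<alpha>\<^sup>2 + (t n)\<^sup>2))"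
      by (rule order_trans[OF sum_abs sum_mono])
         (auto simp: abs_mult abs_divide mult_left_le intro!: divide_right_mono)
    then show ?thesis unfolding trend_def T_def by linarith
  qed
  moreover have "T \<ge> 0" unfolding T_def by (intro add_nonneg_nonneg mult_nonneg_nonneg sum_nonneg) auto
  ultimately show ?thesis using that by blast
qed

lemma trend_lipschitz: obtains L where "L \<ge> 0" "\<And>x y. \<bar>trend x - trend y\<bar> \<le> L * \<bar>x - y\<bar>"
proof -
  define q where "q n = r n / sqrt (\<alpha>\<^sup>2 + (t n)\<^sup>2)" for n
  define L where "L = 2 * (\<Sum>n=1..N. \<bar>q n\<bar> * \<bar>t n\<bar>)"
  have "\<bar>trend x - trend y\<bar> \<le> L * \<bar>x - y\<bar>" for x y
  proof -
    let ?c = "\<lambda>n x. cos (t n * x + \<theta> n - arctan (t n / \<alpha>))"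
    have "trend x - trend y = 2 * (\<Sum>n=1..N. q n * (?c n x - ?c n y))"
      by (simp add: trend_def q_def sum_subtractf right_diff_distrib mult.commute)
    then have "\<bar>trend x - trend y\<bar> = 2 * \<bar>\<Sum>n=1..N. q n * (?c n x - ?c n y)\<bar>" by simp
    also have "\<bar>\<Sum>n=1..N. q n * (?c n x - ?c n y)\<bar> \<le> (\<Sum>n=1..N. (\<bar>q n\<bar> * \<bar>t n\<bar>) * \<bar>x - y\<bar>)"
    proof (rule order_trans[OF sum_abs sum_mono])
      fix n
      have "\<bar>?c n x - ?c n y\<bar> \<le> \<bar>(t n * x + \<theta> n - arctan (t n / \<alpha>)) - (t n * y + \<theta> n - arctan (t n / \<alpha>))\<bar>"
        by (rule abs_cos_diff_le)
      also have "\<dots> = \<bar>t n * (x - y)\<bar>" by (simp add: algebra_simps)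
      finally have "\<bar>?c n x - ?c n y\<bar> \<le> \<bar>t n\<bar> * \<bar>x - y\<bar>" by (simp only: abs_mult)
      then show "\<bar>q n * (?c n x - ?c n y)\<bar> \<le> (\<bar>q n\<bar> * \<bar>t n\<bar>) * \<bar>x - y\<bar>"
        unfolding abs_mult mult.assoc by (rule mult_left_mono) simp
    qed
    finally show ?thesis unfolding L_def sum_distrib_right[symmetric] by simp
  qed
  moreover have "L \<ge> 0" unfolding L_def by (intro mult_nonneg_nonneg sum_nonneg) auto
  ultimately show ?thesis using that by blast
qed

lemma trend_measurable [measurable]: "trend \<in> borel_measurable borel"
  unfolding trend_def[abs_def] by measurable

lemma remainder_measurable [measurable]: "remainder \<in> borel_measurable borel"
  unfolding remainder_def[abs_def] by measurable

lemma remainder_neg: "x < 0 \<Longrightarrow> remainder x = 0"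
  by (simp add: remainder_def)

text \<open>All that is known before boundedness: growth slower than every increasing
  exponential.\<close>

lemma remainder_growth:
  assumes "\<delta> > 0"
  obtains C where "C \<ge> 0" "\<And>x. \<bar>remainder x\<bar> \<le> C * (indicator {0..} x * exp (\<delta> * x))"
proof -
  obtain C where C: "C \<ge> 0" "\<And>x. \<bar>S x\<bar> \<le> C * exp ((\<alpha> + \<delta>) * x)" using S_growth[of "\<alpha> + \<delta>"] assms by auto
  obtain T where T: "T \<ge> 0" "\<And>x. \<bar>trend x\<bar> \<le> T" using trend_bounded by blast
  have "\<bar>remainder x\<bar> \<le> (C + T) * (indicator {0..} x * exp (\<delta> * x))" for x
  proof (cases "x < 0")
    case False
    have "\<bar>exp (- \<alpha> * x) * S x\<bar> \<le> exp (- \<alpha> * x) * (C * exp ((\<alpha> + \<delta>) * x))"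
      unfolding abs_mult using C(2) by (intro mult_mono) auto
    also have "\<dots> = C * exp (\<delta> * x)" by (simp add: exp_add[symmetric] algebra_simps)
    finally have 1: "\<bar>exp (- \<alpha> * x) * S x\<bar> \<le> C * exp (\<delta> * x)" .
    have "T * 1 \<le> T * exp (\<delta> * x)" using T(1) False assms by (intro mult_left_mono) auto
    then have "\<bar>trend x\<bar> \<le> T * exp (\<delta> * x)" using T(2)[of x] by linarith
    then have "\<bar>exp (- \<alpha> * x) * S x - trend x\<bar> \<le> C * exp (\<delta> * x) + T * exp (\<delta> * x)" using 1 by linarith
    then show ?thesis using False by (simp add: remainder_def algebra_simps)
  qed (simp add: remainder_def)
  moreover have "C + T \<ge> 0" using C T by simp
  ultimately show ?thesis using that by blast
qed

lemma remainder_exp_integrable: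
  assumes "Re z > 0"
  shows "integrable lborel (\<lambda>u. complex_of_real (remainder u) * exp (- (z * complex_of_real u)))"
proof -
  obtain C where C: "C \<ge> 0" "\<And>x. \<bar>remainder x\<bar> \<le> C * (indicator {0..} x * exp (Re z / 2 * x))"
    using remainder_growth[of "Re z / 2"] assms by auto
  show ?thesis
  proof (rule Bochner_Integration.integrable_bound)
    show "integrable lborel (\<lambda>u. C * (indicator {0..} u * exp (- (Re z / 2 * u))))"
      using assms by (intro integrable_mult_right integrable_exp_half_line) simp
    show "AE u in lborel. norm (complex_of_real (remainder u) * exp (- (z * complex_of_real u)))
       \<le> norm (C * (indicator {0..} u * exp (- (Re z / 2 * u))))"
    proof (rule AE_I2)
      fix u
      have "norm (complex_of_real (remainder u) * exp (- (z * complex_of_real u))) = \<bar>remainder u\<bar> * exp (- (Re z * u))"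
        by (simp add: norm_mult norm_exp_eq_Re)
      also have "\<dots> \<le> (C * (indicator {0..} u * exp (Re z / 2 * u))) * exp (- (Re z * u))"
        using C(2) by (intro mult_right_mono) auto
      also have "\<dots> = C * (indicator {0..} u * (exp (Re z / 2 * u) * exp (- (Re z * u))))" by simp
      also have "exp (Re z / 2 * u) * exp (- (Re z * u)) = exp (- (Re z / 2 * u))"
        unfolding exp_add[symmetric] by (rule arg_cong[where f = exp]) (simp add: field_simps)
      finally show "norm (complex_of_real (remainder u) * exp (- (z * complex_of_real u)))
       \<le> norm (C * (indicator {0..} u * exp (- (Re z / 2 * u))))" using C(1) by simp
    qed
  qed measurable
qed

section \<open>The transform F in terms of the remainder\<close>

definition F :: "complex \<Rightarrow> complex" where
  "F s = laplace_stieltjes S s - complex_of_real (r 0) / (s - complex_of_real \<alpha>)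
      - (\<Sum>n=1..N. complex_of_real (r n) *
           (exp (\<i> * complex_of_real (\<theta> n)) / (s - complex_of_real \<alpha> - \<i> * complex_of_real (t n))
          + exp (- (\<i> * complex_of_real (\<theta> n))) / (s - complex_of_real \<alpha> + \<i> * complex_of_real (t n))))"

text \<open>The weight \<open>i\<close> and the factor \<open>m\<close> are arbitrary so that the
  statement serves twice: for Laplace integrals on the half line and for oscillating integrals
  truncated to \<open>{0..x}\<close>.\<close>

lemma trend_combination:
  assumes J: "\<And>\<omega>. has_bochner_integral lborel (\<lambda>u. i u *\<^sub>R (exp (\<i> * complex_of_real (\<omega> * u)) * m u)) (J \<omega>)"
  shows "has_bochner_integral lborel (\<lambda>u. i u *\<^sub>R (complex_of_real (trend u) * m u))
   (complex_of_real (r 0) / complex_of_real \<alpha> * J 0 + (\<Sum>n=1..N. complex_of_real (r n) *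
     (exp (\<i> * complex_of_real (\<theta> n)) / (complex_of_real \<alpha> + \<i> * complex_of_real (t n)) * J (t n)
     + exp (- (\<i> * complex_of_real (\<theta> n))) / (complex_of_real \<alpha> + \<i> * complex_of_real (- t n)) * J (- t n))))"
proof -
  let ?e = "\<lambda>\<omega> u. i u *\<^sub>R (exp (\<i> * complex_of_real (\<omega> * u)) * m u)"
  have "has_bochner_integral lborel (\<lambda>u. complex_of_real (r 0) / complex_of_real \<alpha> * ?e 0 u + (\<Sum>n=1..N. complex_of_real (r n) *
     (exp (\<i> * complex_of_real (\<theta> n)) / (complex_of_real \<alpha> + \<i> * complex_of_real (t n)) * ?e (t n) u
     + exp (- (\<i> * complex_of_real (\<theta> n))) / (complex_of_real \<alpha> + \<i> * complex_of_real (- t n)) * ?e (- t n) u)))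
   (complex_of_real (r 0) / complex_of_real \<alpha> * J 0 + (\<Sum>n=1..N. complex_of_real (r n) *
     (exp (\<i> * complex_of_real (\<theta> n)) / (complex_of_real \<alpha> + \<i> * complex_of_real (t n)) * J (t n)
     + exp (- (\<i> * complex_of_real (\<theta> n))) / (complex_of_real \<alpha> + \<i> * complex_of_real (- t n)) * J (- t n))))"
    by (intro has_bochner_integral_add has_bochner_integral_mult_right has_bochner_integral_sum J)
  moreover have "complex_of_real (r 0) / complex_of_real \<alpha> * ?e 0 u + (\<Sum>n=1..N. complex_of_real (r n) *
     (exp (\<i> * complex_of_real (\<theta> n)) / (complex_of_real \<alpha> + \<i> * complex_of_real (t n)) * ?e (t n) u
     + exp (- (\<i> * complex_of_real (\<theta> n))) / (complex_of_real \<alpha> + \<i> * complex_of_real (- t n)) * ?e (- t n) u))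
    = i u *\<^sub>R (complex_of_real (trend u) * m u)" for u
  proof -
    have m': "A / D * (c *\<^sub>R (E * m u)) = c *\<^sub>R ((A * (E / D)) * m u)" for A D E :: complex and c :: real
      by (simp add: scaleR_conv_of_real)
    show ?thesis
      unfolding trend_complex m' distrib_right scaleR_add_right sum_distrib_right scaleR_sum_right
      by (simp add: scaleR_conv_of_real algebra_simps)
  qed
  ultimately show ?thesis by simp
qed

text \<open>Splitting S into trend and remainder, the trend contributes exactly the subtracted poles
  and the constant, by partial fractions.\<close>

lemma F_eq:
  assumes s: "Re s > \<alpha>"
  shows "F s = s * (LINT u|lborel. complex_of_real (remainder u) * exp (- ((s - complex_of_real \<alpha>) * complex_of_real u)))
     + complex_of_real (trend 0)"
proof -
  define z where "z = s - complex_of_real \<alpha>"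
  have z: "Re z > 0" using s by (simp add: z_def)
  have sz: "s = z + complex_of_real \<alpha>" by (simp add: z_def)
  let ?A = "LINT u|lborel. complex_of_real (remainder u) * exp (- (z * complex_of_real u))"
  let ?B = "(complex_of_real (r 0) / complex_of_real \<alpha> * (1 / (z - \<i> * complex_of_real 0)) + (\<Sum>n=1..N. complex_of_real (r n) *
     (exp (\<i> * complex_of_real (\<theta> n)) / (complex_of_real \<alpha> + \<i> * complex_of_real (t n)) * (1 / (z - \<i> * complex_of_real (t n)))
     + exp (- (\<i> * complex_of_real (\<theta> n))) / (complex_of_real \<alpha> + \<i> * complex_of_real (- t n)) * (1 / (z - \<i> * complex_of_real (- t n))))))"
  have pt: "complex_of_real (S u) * exp (- (s * complex_of_real u)) =
      complex_of_real (remainder u) * exp (- (z * complex_of_real u))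
      + indicator {0..} u *\<^sub>R (complex_of_real (trend u) * exp (- (z * complex_of_real u)))" for u
  proof (cases "u < 0")
    case False
    have "exp (- (s * complex_of_real u)) = complex_of_real (exp (- \<alpha> * u)) * exp (- (z * complex_of_real u))"
      unfolding exp_of_real[symmetric] exp_add[symmetric] sz by (rule arg_cong[where f = exp]) (simp add: algebra_simps)
    then show ?thesis using False by (simp add: remainder_def algebra_simps)
  qed (simp add: S_neg remainder_def)
  have "has_bochner_integral lborel (\<lambda>u. indicator {0..} u *\<^sub>R (exp (\<i> * complex_of_real (\<omega> * u)) * exp (- (z * complex_of_real u))))
      (1 / (z - \<i> * complex_of_real \<omega>))" for \<omega>
  proof -
    have w: "Re (z - \<i> * complex_of_real \<omega>) > 0" using z by simp
    have "exp (\<i> * complex_of_real (\<omega> * u)) * exp (- (z * complex_of_real u)) = exp (- ((z - \<i> * complex_of_real \<omega>) * complex_of_real u))" for u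
      unfolding exp_add[symmetric] by (rule arg_cong[where f = exp]) (simp add: algebra_simps)
    then show ?thesis
      using has_bochner_integral_integrable[OF integrable_cexp_half_line[OF w]]
      unfolding integral_cexp_half_line[OF w] by simp
  qed
  note trend_transform = trend_combination[OF this]
  have "(LINT u|lborel. complex_of_real (S u) * exp (- (s * complex_of_real u))) = ?A + ?B"
    unfolding pt
    using has_bochner_integral_add[OF has_bochner_integral_integrable[OF remainder_exp_integrable[OF z]] trend_transform]
    by (rule has_bochner_integral_integral_eq)
  then have L: "laplace_stieltjes S s = s * ?A + s * ?B"
    unfolding laplace_stieltjes_eq[OF s] by (simp add: distrib_left)
  have a0: "complex_of_real \<alpha> + \<i> * complex_of_real \<omega> \<noteq> 0" for \<omega> using alpha_pos by (simp add: complex_eq_iff)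
  have z0: "z \<noteq> \<i> * complex_of_real \<omega>" for \<omega> using z by (auto simp: complex_eq_iff)
  have p: "s * (A / (complex_of_real \<alpha> + \<i> * complex_of_real \<omega>) * (1 / (z - \<i> * complex_of_real \<omega>))) =
      A / (z - \<i> * complex_of_real \<omega>) + A / (complex_of_real \<alpha> + \<i> * complex_of_real \<omega>)" for A \<omega>
    unfolding sz by (rule pole_identity[OF z0 a0])
  have p0: "s * (complex_of_real (r 0) / complex_of_real \<alpha> * (1 / (z - \<i> * complex_of_real 0))) = complex_of_real (r 0) / z + complex_of_real (r 0) / complex_of_real \<alpha>"
    using p[of "complex_of_real (r 0)" 0] by simp
  have "s * ?B = s * (complex_of_real (r 0) / complex_of_real \<alpha> * (1 / (z - \<i> * complex_of_real 0))) + (\<Sum>n=1..N. complex_of_real (r n) *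
     (s * (exp (\<i> * complex_of_real (\<theta> n)) / (complex_of_real \<alpha> + \<i> * complex_of_real (t n)) * (1 / (z - \<i> * complex_of_real (t n))))
     + s * (exp (- (\<i> * complex_of_real (\<theta> n))) / (complex_of_real \<alpha> + \<i> * complex_of_real (- t n)) * (1 / (z - \<i> * complex_of_real (- t n))))))"
    unfolding distrib_left[of s] sum_distrib_left mult.left_commute[of s "complex_of_real (r _)"] ..
  also have "\<dots> = complex_of_real (r 0) / z + complex_of_real (r 0) / complex_of_real \<alpha> + (\<Sum>n=1..N. complex_of_real (r n) *
     ((exp (\<i> * complex_of_real (\<theta> n)) / (z - \<i> * complex_of_real (t n)) + exp (\<i> * complex_of_real (\<theta> n)) / (complex_of_real \<alpha> + \<i> * complex_of_real (t n)))
     + (exp (- (\<i> * complex_of_real (\<theta> n))) / (z - \<i> * complex_of_real (- t n)) + exp (- (\<i> * complex_of_real (\<theta> n))) / (complex_of_real \<alpha> + \<i> * complex_of_real (- t n)))))"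
    unfolding p p0 ..
  also have "\<dots> = complex_of_real (trend 0) + complex_of_real (r 0) / z + (\<Sum>n=1..N. complex_of_real (r n) *
     (exp (\<i> * complex_of_real (\<theta> n)) / (z - \<i> * complex_of_real (t n)) + exp (- (\<i> * complex_of_real (\<theta> n))) / (z + \<i> * complex_of_real (t n))))"
    unfolding trend_complex[of 0] by (simp add: sum.distrib[symmetric] algebra_simps)
  finally show ?thesis unfolding F_def L z_def[symmetric] by simp
qed

text \<open>Testing $F$ against $\psi(t) / (\alpha + i t)$ cancels the factor $s$ of $F$ on the boundary line.\<close>

definition boundary_mult :: "(real \<Rightarrow> complex) \<Rightarrow> real \<Rightarrow> complex" where
  "boundary_mult \<phi> = (\<lambda>x. (complex_of_real \<alpha> + \<i> * complex_of_real x) * \<phi> x)"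

definition boundary_div :: "(real \<Rightarrow> complex) \<Rightarrow> real \<Rightarrow> complex" where
  "boundary_div \<phi> = (\<lambda>x. inverse (complex_of_real \<alpha> + \<i> * complex_of_real x) * \<phi> x)"

lemma alpha_plus_ne_0: "complex_of_real \<alpha> + \<i> * complex_of_real x \<noteq> 0"
  using alpha_pos by (simp add: complex_eq_iff)

lemma smooth_alpha_plus: "smooth (\<lambda>x. complex_of_real \<alpha> + \<i> * complex_of_real x)"
  by (intro smooth_add smooth_const smooth_cmult smooth_of_real)

lemma test_fun_boundary_mult: "test_fun U \<phi> \<Longrightarrow> test_fun U (boundary_mult \<phi>)"
  unfolding boundary_mult_def by (rule test_fun_mult[OF _ smooth_alpha_plus])

lemma test_fun_boundary_div: "test_fun U \<phi> \<Longrightarrow> test_fun U (boundary_div \<phi>)"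
  unfolding boundary_div_def by (rule test_fun_mult[OF _ smooth_inverse[OF smooth_alpha_plus alpha_plus_ne_0]])

lemma boundary_mult_div: "boundary_mult (boundary_div \<phi>) = \<phi>"
  unfolding boundary_mult_def boundary_div_def using alpha_plus_ne_0 by (simp add: mult.assoc[symmetric])

lemma boundary_mult_modulation:
  "boundary_mult (\<lambda>x. exp (\<i> * complex_of_real (h * x)) * \<phi> x) = (\<lambda>x. exp (\<i> * complex_of_real (h * x)) * boundary_mult \<phi> x)"
  unfolding boundary_mult_def by (simp add: mult.left_commute)

text \<open>On the line Re s = sigma the factor s is (alpha + i x) + (sigma - alpha), which gives
  the two transforms. For sigma > alpha the damping makes the integrals absolutely convergent
  although the remainder is not yet known to be bounded.\<close>

lemma boundary_pairing:
  assumes \<phi>: "test_fun UNIV \<phi>" and \<sigma>: "\<sigma> > \<alpha>"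
  shows "(LINT x|lborel. F (Complex \<sigma> x) * \<phi> x) =
    (LINT u|lborel. complex_of_real (exp (- ((\<sigma> - \<alpha>) * u)) * remainder u) *
        (fourier (boundary_mult \<phi>) u + complex_of_real (\<sigma> - \<alpha>) * fourier \<phi> u))
    + complex_of_real (trend 0) * fourier \<phi> 0"
proof -
  let ?G = "\<lambda>u. complex_of_real (exp (- ((\<sigma> - \<alpha>) * u)) * remainder u)"
  let ?k = "\<lambda>u x. exp (- (\<i> * complex_of_real (u * x)))"
  define \<psi> where "\<psi> = (\<lambda>x. boundary_mult \<phi> x + complex_of_real (\<sigma> - \<alpha>) * \<phi> x)"
  have c\<phi>: "test_fun UNIV (\<lambda>x. complex_of_real (\<sigma> - \<alpha>) * \<phi> x)" by (rule test_fun_cmult[OF \<phi>])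
  have \<psi>: "test_fun UNIV \<psi>" unfolding \<psi>_def by (rule test_fun_add[OF test_fun_boundary_mult[OF \<phi>] c\<phi>])
  have \<psi>_four: "fourier \<psi> u = fourier (boundary_mult \<phi>) u + complex_of_real (\<sigma> - \<alpha>) * fourier \<phi> u" for u
    unfolding \<psi>_def fourier_add[OF test_fun_integrable[OF test_fun_boundary_mult[OF \<phi>]] test_fun_integrable[OF c\<phi>]] fourier_cmult ..
  have ex: "complex_of_real (remainder u) * exp (- ((Complex \<sigma> x - complex_of_real \<alpha>) * complex_of_real u)) = ?G u * ?k u x" for u x
  proof -
    have "exp (- ((Complex \<sigma> x - complex_of_real \<alpha>) * complex_of_real u)) = complex_of_real (exp (- ((\<sigma> - \<alpha>) * u))) * ?k u x"
      unfolding exp_of_real[symmetric] exp_add[symmetric] by (rule arg_cong[where f = exp]) (simp add: complex_eq_iff algebra_simps)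
    then show ?thesis by simp
  qed
  have Gint: "integrable lborel ?G"
    using remainder_exp_integrable[of "complex_of_real (\<sigma> - \<alpha>)"] \<sigma>
    by (simp add: exp_of_real[symmetric] mult.commute)
  \<comment> \<open>The vacuous shift \<open>0 * u\<close> gives the integrand the shape required by
    the Fubini lemma for shifts.\<close>
  have Fx: "F (Complex \<sigma> x) * \<phi> x = (LINT u|lborel. ?G u * \<psi> (x + 0 * u) * ?k u x) + complex_of_real (trend 0) * \<phi> x" for x
  proof -
    have f1: "F (Complex \<sigma> x) = Complex \<sigma> x * (LINT u|lborel. ?G u * ?k u x) + complex_of_real (trend 0)"
      using F_eq[of "Complex \<sigma> x"] \<sigma> unfolding ex by simp
    have f2: "\<psi> x = Complex \<sigma> x * \<phi> x"
      by (simp add: \<psi>_def boundary_mult_def Complex_eq algebra_simps)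
    have "F (Complex \<sigma> x) * \<phi> x = \<psi> x * (LINT u|lborel. ?G u * ?k u x) + complex_of_real (trend 0) * \<phi> x"
      unfolding f1 f2 distrib_right by (simp only: mult_ac)
    also have "\<psi> x * (LINT u|lborel. ?G u * ?k u x) = (LINT u|lborel. ?G u * \<psi> (x + 0 * u) * ?k u x)"
      unfolding integral_mult_right_zero[symmetric] by (simp add: mult_ac)
    finally show ?thesis .
  qed
  have k: "(\<lambda>z. ?k (fst z) (snd z)) \<in> borel_measurable (lborel \<Otimes>\<^sub>M lborel)" by measurable
  have i1: "integrable lborel (\<lambda>x. LINT u|lborel. ?G u * \<psi> (x + 0 * u) * ?k u x)"
    using lborel_pair.integrable_snd[of "\<lambda>u x. ?G u * \<psi> (x + 0 * u) * ?k u x"]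
      integrable_pair_shift[OF test_fun_integrable[OF \<psi>] Gint k, of 0]
    by (simp add: norm_cis_minus del: of_real_mult)
  have "(LINT x|lborel. F (Complex \<sigma> x) * \<phi> x) = (LINT x|lborel. LINT u|lborel. ?G u * \<psi> (x + 0 * u) * ?k u x)
      + (LINT x|lborel. complex_of_real (trend 0) * \<phi> x)"
    unfolding Fx by (rule Bochner_Integration.integral_add[OF i1]) (intro integrable_mult_right test_fun_integrable[OF \<phi>])
  also have "(LINT x|lborel. complex_of_real (trend 0) * \<phi> x) = complex_of_real (trend 0) * fourier \<phi> 0"
    by (simp add: fourier_def)
  also have "(LINT x|lborel. LINT u|lborel. ?G u * \<psi> (x + 0 * u) * ?k u x) = (LINT u|lborel. LINT x|lborel. ?G u * \<psi> (x + 0 * u) * ?k u x)"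
    using Fubini_pair_shift[OF test_fun_integrable[OF \<psi>] Gint k, of 0]
    by (simp add: norm_cis_minus del: of_real_mult)
  also have "\<dots> = (LINT u|lborel. ?G u * fourier \<psi> u)"
    unfolding fourier_def integral_mult_right_zero[symmetric] by (simp add: mult_ac)
  finally show ?thesis unfolding \<psi>_four .
qed

text \<open>Dominated convergence: the damping factor is at most 1 where the remainder lives, and
  the term carrying sigma - alpha disappears in the limit.\<close>

lemma boundary_limit:
  assumes \<phi>: "test_fun UNIV \<phi>" and B: "\<And>x. \<bar>remainder x\<bar> \<le> B"
  shows "((\<lambda>\<sigma>. LINT x|lborel. F (Complex \<sigma> x) * \<phi> x) \<longlongrightarrow>
    (LINT u|lborel. complex_of_real (remainder u) * fourier (boundary_mult \<phi>) u) + complex_of_real (trend 0) * fourier \<phi> 0) (at_right \<alpha>)"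
proof (rule tendsto_at_right_sequentially[of \<alpha> "\<alpha> + 1"])
  fix X :: "nat \<Rightarrow> real"
  assume X: "\<And>n. \<alpha> < X n" "\<And>n. X n < \<alpha> + 1" "X \<longlonglongrightarrow> \<alpha>"
  have B0: "B \<ge> 0" using B[of 0] by linarith
  let ?m = "boundary_mult \<phi>"
  have m: "test_fun UNIV ?m" by (rule test_fun_boundary_mult[OF \<phi>])
  note [measurable] = fourier_measurable[OF \<phi>] fourier_measurable[OF m]
  let ?f = "\<lambda>n u. complex_of_real (exp (- ((X n - \<alpha>) * u)) * remainder u) *
        (fourier ?m u + complex_of_real (X n - \<alpha>) * fourier \<phi> u)"
  have "(\<lambda>n. LINT u|lborel. ?f n u) \<longlonglongrightarrow> (LINT u|lborel. complex_of_real (remainder u) * fourier ?m u)"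
  proof (rule integral_dominated_convergence)
    show "integrable lborel (\<lambda>u. B * (cmod (fourier ?m u) + cmod (fourier \<phi> u)))"
      using fourier_integrable[OF m] fourier_integrable[OF \<phi>] by simp
    show "AE u in lborel. (\<lambda>n. ?f n u) \<longlonglongrightarrow> complex_of_real (remainder u) * fourier ?m u"
    proof (rule AE_I2)
      fix u
      have d: "(\<lambda>n. X n - \<alpha>) \<longlonglongrightarrow> 0" using tendsto_diff[OF X(3) tendsto_const[of \<alpha>]] by simp
      have "(\<lambda>n. ?f n u) \<longlonglongrightarrow> complex_of_real (exp (- (0 * u)) * remainder u) * (fourier ?m u + complex_of_real 0 * fourier \<phi> u)"
        by (intro tendsto_intros d)
      then show "(\<lambda>n. ?f n u) \<longlonglongrightarrow> complex_of_real (remainder u) * fourier ?m u" by simp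
    qed
    show "AE u in lborel. norm (?f n u) \<le> B * (cmod (fourier ?m u) + cmod (fourier \<phi> u))" for n
    proof (rule AE_I2)
      fix u
      have "\<bar>exp (- ((X n - \<alpha>) * u)) * remainder u\<bar> \<le> B"
      proof (cases "u < 0")
        case False
        then have "exp (- ((X n - \<alpha>) * u)) \<le> 1" using X(1)[of n] by simp
        then have "exp (- ((X n - \<alpha>) * u)) * \<bar>remainder u\<bar> \<le> 1 * B" using B B0 by (intro mult_mono) auto
        then show ?thesis by (simp add: abs_mult)
      qed (simp add: remainder_neg B0)
      moreover have "cmod (fourier ?m u + complex_of_real (X n - \<alpha>) * fourier \<phi> u) \<le> cmod (fourier ?m u) + cmod (fourier \<phi> u)"
      proof -
        have "cmod (complex_of_real (X n - \<alpha>) * fourier \<phi> u) \<le> 1 * cmod (fourier \<phi> u)"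
          unfolding norm_mult norm_of_real using X(1,2)[of n] by (intro mult_right_mono) auto
        then show ?thesis using norm_triangle_ineq[of "fourier ?m u" "complex_of_real (X n - \<alpha>) * fourier \<phi> u"] by linarith
      qed
      ultimately show "norm (?f n u) \<le> B * (cmod (fourier ?m u) + cmod (fourier \<phi> u))"
        unfolding norm_mult norm_of_real using B0 by (intro mult_mono) auto
    qed
  qed measurable
  then show "(\<lambda>n. LINT x|lborel. F (Complex (X n) x) * \<phi> x) \<longlonglongrightarrow>
    (LINT u|lborel. complex_of_real (remainder u) * fourier ?m u) + complex_of_real (trend 0) * fourier \<phi> 0"
    unfolding boundary_pairing[OF \<phi> X(1)] by (intro tendsto_add tendsto_const)
qed simp

end

section \<open>Consequences of local pseudofunction behaviour\<close>

context laplace_asymptotics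
begin

text \<open>Modulation preserves supports and translates the transform. A pseudofunction with
  transform \<open>g\<close> therefore yields, up to a constant, the convolution of \<open>g\<close>
  with an integrable function at \<open>- h\<close>: bounded, and tending to 0 by dominated
  convergence.\<close>

lemma lpf_boundary_local:
  assumes "lpf_boundary F \<alpha> U" "t0 \<in> U"
  obtains V G where "open V" "t0 \<in> V" "V \<subseteq> U"
    "\<And>\<phi> h. test_fun V \<phi> \<Longrightarrow>
       ((\<lambda>\<sigma>. LINT x|lborel. F (Complex \<sigma> x) * (exp (\<i> * complex_of_real (h * x)) * \<phi> x)) \<longlongrightarrow> G \<phi> h) (at_right \<alpha>)"
    "\<And>\<phi>. test_fun V \<phi> \<Longrightarrow> \<exists>C. \<forall>h. cmod (G \<phi> h) \<le> C"
    "\<And>\<phi>. test_fun V \<phi> \<Longrightarrow> (G \<phi> \<longlongrightarrow> 0) at_top"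
proof -
  obtain G0 where G0: "\<And>\<phi>. test_fun U \<phi> \<Longrightarrow> ((\<lambda>\<sigma>. LINT x|lborel. F (Complex \<sigma> x) * \<phi> x) \<longlongrightarrow> G0 \<phi>) (at_right \<alpha>)"
    "local_pseudofunction U G0"
    using assms(1) unfolding lpf_boundary_def by metis
  obtain V where V: "open V" "t0 \<in> V" "V \<subseteq> U" "coincides_with_pseudofunction_on V G0"
    using G0(2) assms(2) unfolding local_pseudofunction_def by metis
  obtain g where g: "g \<in> borel_measurable lborel" "bounded (range g)" "(g \<longlongrightarrow> 0) at_infinity"
    "\<And>\<phi>. test_fun V \<phi> \<Longrightarrow> G0 \<phi> = (LINT x|lborel. g x * fourier \<phi> (- x)) / complex_of_real (2 * pi)"
    using V(4) unfolding coincides_with_pseudofunction_on_def by metis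
  have [measurable]: "g \<in> borel_measurable borel" using g(1) by simp
  obtain b where b: "b > 0" "\<And>x. cmod (g x) \<le> b" using g(2) unfolding bounded_pos by auto
  define G where "G \<phi> h = (LINT y|lborel. g (- h - y) * fourier \<phi> y) / complex_of_real (2 * pi)" for \<phi> h
  have lim: "((\<lambda>\<sigma>. LINT x|lborel. F (Complex \<sigma> x) * (exp (\<i> * complex_of_real (h * x)) * \<phi> x)) \<longlongrightarrow> G \<phi> h) (at_right \<alpha>)"
    if \<phi>: "test_fun V \<phi>" for \<phi> h
  proof -
    let ?\<phi> = "\<lambda>x. exp (\<i> * complex_of_real (h * x)) * \<phi> x"
    have t: "test_fun V ?\<phi>" by (rule test_fun_mult[OF \<phi> smooth_cis])
    have "G0 ?\<phi> = (LINT x|lborel. g x * fourier \<phi> (- x - h)) / complex_of_real (2 * pi)"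
      unfolding g(4)[OF t] fourier_modulation ..
    also have "(LINT x|lborel. g x * fourier \<phi> (- x - h)) = (LINT y|lborel. g (- h - y) * fourier \<phi> y)"
      using lborel_integral_real_affine[of "-1" "\<lambda>x. g x * fourier \<phi> (- x - h)" "-h"] by simp
    finally have "G0 ?\<phi> = G \<phi> h" unfolding G_def .
    then show ?thesis using G0(1)[OF test_fun_mono[OF t V(3)]] by simp
  qed
  have bdd: "\<exists>C. \<forall>h. cmod (G \<phi> h) \<le> C" if \<phi>: "test_fun V \<phi>" for \<phi>
  proof (intro exI allI)
    fix h
    note [measurable] = fourier_measurable[OF \<phi>]
    have dom: "integrable lborel (\<lambda>y. b * cmod (fourier \<phi> y))" using fourier_integrable[OF \<phi>] by simp
    have pt: "cmod (g (- h - y) * fourier \<phi> y) \<le> b * cmod (fourier \<phi> y)" for y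
      unfolding norm_mult using b(2) by (intro mult_right_mono) auto
    have gi: "integrable lborel (\<lambda>y. g (- h - y) * fourier \<phi> y)"
      by (rule Bochner_Integration.integrable_bound[OF dom]) (use pt b(1) in \<open>auto simp: abs_mult\<close>)
    have "cmod (LINT y|lborel. g (- h - y) * fourier \<phi> y) \<le> (LINT y|lborel. b * cmod (fourier \<phi> y))"
      by (rule order_trans[OF integral_norm_bound integral_mono[OF integrable_norm[OF gi] dom pt]])
    then have "cmod (G \<phi> h) \<le> (LINT y|lborel. b * cmod (fourier \<phi> y)) / (2 * pi)"
      unfolding G_def norm_divide norm_of_real by (simp add: divide_right_mono)
    then show "cmod (G \<phi> h) \<le> (LINT y|lborel. b * cmod (fourier \<phi> y)) / (2 * pi)" .
  qed
  have van: "(G \<phi> \<longlongrightarrow> 0) at_top" if \<phi>: "test_fun V \<phi>" for \<phi>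
  proof -
    note [measurable] = fourier_measurable[OF \<phi>]
    have "((\<lambda>h. LINT y|lborel. g (- h - y) * fourier \<phi> y) \<longlongrightarrow> (LINT y|(lborel :: real measure). 0)) at_top"
    proof (rule integral_dominated_convergence_at_top)
      show "integrable lborel (\<lambda>y. b * cmod (fourier \<phi> y))" using fourier_integrable[OF \<phi>] by simp
      show "\<forall>\<^sub>F h in at_top. AE y in lborel. cmod (g (- h - y) * fourier \<phi> y) \<le> b * cmod (fourier \<phi> y)"
        unfolding norm_mult using b(2) by (intro always_eventually allI AE_I2 mult_right_mono) auto
      show "AE y in lborel. ((\<lambda>h. g (- h - y) * fourier \<phi> y) \<longlongrightarrow> 0) at_top"
      proof (rule AE_I2)
        fix y :: real
        have "filterlim (\<lambda>h. y + h) at_top at_top"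
          by (rule filterlim_tendsto_add_at_top[OF tendsto_const filterlim_ident])
        then have "filterlim (\<lambda>h. - (y + h)) at_bot at_top" unfolding filterlim_uminus_at_bot minus_minus .
        moreover have "(\<lambda>h. - (y + h)) = (\<lambda>h. - h - y)" by auto
        ultimately have "filterlim (\<lambda>h. - h - y) at_bot at_top" by simp
        then have "filterlim (\<lambda>h. - h - y) at_infinity at_top" by (rule filterlim_at_bot_imp_at_infinity)
        then have "((\<lambda>h. g (- h - y)) \<longlongrightarrow> 0) at_top" by (rule filterlim_compose[OF g(3)])
        then show "((\<lambda>h. g (- h - y) * fourier \<phi> y) \<longlongrightarrow> 0) at_top" by (rule tendsto_mult_left_zero)
      qed
    qed measurable
    then have "((\<lambda>h. (LINT y|lborel. g (- h - y) * fourier \<phi> y) / complex_of_real (2 * pi)) \<longlongrightarrow> 0 / complex_of_real (2 * pi)) at_top"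
      by (intro tendsto_divide tendsto_const) auto
    then show ?thesis unfolding G_def[abs_def] by simp
  qed
  show ?thesis by (rule that[OF V(1-3) lim bdd van])
qed

text \<open>In particular the Fourier transform of $\psi(t)/(\alpha + i t)$ is non-negative if that of $\psi$ is.\<close>

lemma fourier_boundary_div:
  assumes \<psi>: "test_fun UNIV \<psi>"
  shows "fourier (boundary_div \<psi>) y =
    (LINT w|lborel. indicator {0..} w *\<^sub>R exp (- (complex_of_real \<alpha> * complex_of_real w)) * fourier \<psi> (y + w))"
proof -
  let ?E = "\<lambda>w. indicator {0..} w *\<^sub>R exp (- (complex_of_real \<alpha> * complex_of_real w))"
  let ?k = "\<lambda>w x. exp (- (\<i> * complex_of_real ((y + w) * x)))"
  have Eint: "integrable lborel ?E" by (rule integrable_cexp_half_line) (simp add: alpha_pos)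
  have k: "(\<lambda>z. ?k (fst z) (snd z)) \<in> borel_measurable (lborel \<Otimes>\<^sub>M lborel)" by measurable
  have "fourier (boundary_div \<psi>) y = (LINT x|lborel. LINT w|lborel. ?E w * \<psi> (x + 0 * w) * ?k w x)"
    unfolding fourier_def
  proof (intro Bochner_Integration.integral_cong refl)
    fix x
    let ?z = "complex_of_real \<alpha> + \<i> * complex_of_real x"
    have z: "Re ?z > 0" by (simp add: alpha_pos)
    have "exp (- (\<i> * complex_of_real (y * x))) * boundary_div \<psi> x =
        exp (- (\<i> * complex_of_real (y * x))) * \<psi> x * (LINT w|lborel. indicator {0..} w *\<^sub>R exp (- (?z * complex_of_real w)))"
      unfolding integral_cexp_half_line[OF z] boundary_div_def by (simp add: divide_inverse)
    also have "\<dots> = (LINT w|lborel. exp (- (\<i> * complex_of_real (y * x))) * \<psi> x * (indicator {0..} w *\<^sub>R exp (- (?z * complex_of_real w))))"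
      by (rule integral_mult_right_zero[symmetric])
    also have "\<dots> = (LINT w|lborel. ?E w * \<psi> (x + 0 * w) * ?k w x)"
    proof (intro Bochner_Integration.integral_cong refl)
      fix w
      have "exp (- (\<i> * complex_of_real (y * x))) * exp (- (?z * complex_of_real w)) =
          exp (- (complex_of_real \<alpha> * complex_of_real w)) * ?k w x"
        unfolding exp_add[symmetric] by (rule arg_cong[where f = exp]) (simp add: algebra_simps)
      then show "exp (- (\<i> * complex_of_real (y * x))) * \<psi> x * (indicator {0..} w *\<^sub>R exp (- (?z * complex_of_real w)))
        = ?E w * \<psi> (x + 0 * w) * ?k w x"
        unfolding scaleR_conv_of_real by (simp only: mult_zero_left mult_zero_right add_0_right mult_ac)
    qed
    finally show "exp (- (\<i> * complex_of_real (y * x))) * boundary_div \<psi> x = (LINT w|lborel. ?E w * \<psi> (x + 0 * w) * ?k w x)" .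
  qed
  also have "\<dots> = (LINT w|lborel. LINT x|lborel. ?E w * \<psi> (x + 0 * w) * ?k w x)"
    using Fubini_pair_shift[OF test_fun_integrable[OF \<psi>] Eint k, of 0]
    by (simp add: norm_cis_minus del: of_real_mult of_real_add)
  also have "\<dots> = (LINT w|lborel. ?E w * fourier \<psi> (y + w))"
    unfolding fourier_def integral_mult_right_zero[symmetric] by (simp only: mult_zero_left mult_zero_right add_0_right mult_ac)
  finally show ?thesis .
qed

text \<open>\<open>boundary_limit\<close> presupposes a bound, so the argument stays at sigma >
  alpha, where non-negative transforms allow everything outside a window \<open>{h..h + d1}\<close>
  to be discarded up to a constant. In the window S is at least S(h), and letting sigma tend to
  alpha bounds S(h) by a multiple of exp(alpha h).\<close>

lemma remainder_bounded:
  assumes lpf: "lpf_boundary F \<alpha> U" and "0 \<in> U"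
  obtains B where "\<And>x. \<bar>remainder x\<bar> \<le> B"
proof -
  obtain V G where V: "open V" "0 \<in> V" and "V \<subseteq> U"
    and G: "\<And>\<phi> h. test_fun V \<phi> \<Longrightarrow>
       ((\<lambda>\<sigma>. LINT x|lborel. F (Complex \<sigma> x) * (exp (\<i> * complex_of_real (h * x)) * \<phi> x)) \<longlongrightarrow> G \<phi> h) (at_right \<alpha>)"
      "\<And>\<phi>. test_fun V \<phi> \<Longrightarrow> \<exists>C. \<forall>h. cmod (G \<phi> h) \<le> C"
    and "\<And>\<phi>. test_fun V \<phi> \<Longrightarrow> (G \<phi> \<longlongrightarrow> 0) at_top"
    by (rule lpf_boundary_local[OF assms], rule that)
  obtain e where e: "e > 0" "ball 0 e \<subseteq> V" using V open_contains_ball by metis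
  obtain \<phi>0 k d \<kappa> where k: "test_fun {-2..2} \<phi>0" "\<And>x. fourier \<phi>0 x = complex_of_real (k x)" "\<And>x. k x \<ge> 0"
      "d > 0" "\<kappa> > 0" "\<And>x. \<bar>x\<bar> \<le> d \<Longrightarrow> k x \<ge> \<kappa>" using positive_kernel by metis
  \<comment> \<open>The dilation shrinks the support \<open>{-2..2}\<close> of the kernel to radius
    \<open>e / 2\<close>.\<close>
  define p where "p = 4 / e"
  have p: "p > 0" using e(1) by (simp add: p_def)
  define \<psi> where "\<psi> = (\<lambda>x. \<phi>0 (p * x + 0))"
  have \<psi>V: "test_fun V \<psi>"
    unfolding \<psi>_def
  proof (rule test_fun_mono[OF test_fun_scale[OF k(1)]])
    show "{x. p * x + 0 \<in> {-2..2}} \<subseteq> V"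
    proof
      fix x assume "x \<in> {x. p * x + 0 \<in> {-2..2}}"
      then have "\<bar>p * x\<bar> \<le> 2" by (simp add: abs_le_iff)
      then have "\<bar>x\<bar> \<le> e / 2" using e(1) by (simp add: p_def abs_mult field_simps)
      then have "x \<in> ball 0 e" using e(1) by simp
      then show "x \<in> V" using e(2) by blast
    qed
  qed (use p in simp)
  have \<psi>: "test_fun UNIV \<psi>" by (rule test_fun_mono[OF \<psi>V]) simp
  define k1 where "k1 y = k (y / p) / p" for y
  have four: "fourier \<psi> y = complex_of_real (k1 y)" for y
    using fourier_affine[of p \<phi>0 "y / p" 0] p k(2)[of "y / p"] by (simp add: \<psi>_def k1_def field_simps)
  have k1_nonneg: "k1 y \<ge> 0" for y using k(3) p by (simp add: k1_def)
  define d1 where "d1 = d * p"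
  define \<kappa>1 where "\<kappa>1 = \<kappa> / p"
  have d1: "d1 > 0" and \<kappa>1: "\<kappa>1 > 0" using k(4,5) p by (simp_all add: d1_def \<kappa>1_def)
  have k1_low: "k1 y \<ge> \<kappa>1" if "\<bar>y\<bar> \<le> d1" for y
  proof -
    have "\<bar>y / p\<bar> \<le> d" using that p by (simp add: d1_def field_simps)
    then show ?thesis unfolding k1_def \<kappa>1_def using k(6) p by (intro divide_right_mono) auto
  qed
  define \<phi> where "\<phi> = boundary_div \<psi>"
  have \<phi>V: "test_fun V \<phi>" unfolding \<phi>_def by (rule test_fun_boundary_div[OF \<psi>V])
  have \<phi>: "test_fun UNIV \<phi>" unfolding \<phi>_def by (rule test_fun_boundary_div[OF \<psi>])
  define q where "q y = (LINT w|lborel. indicator {0..} w * exp (- (\<alpha> * w)) * k1 (y + w))" for y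
  have q: "fourier \<phi> y = complex_of_real (q y)" for y
  proof -
    have "indicator {0..} w *\<^sub>R exp (- (complex_of_real \<alpha> * complex_of_real w)) * complex_of_real (k1 (y + w)) =
       complex_of_real (indicator {0..} w * exp (- (\<alpha> * w)) * k1 (y + w))" for w
      by (simp add: scaleR_conv_of_real exp_of_real[symmetric])
    then show ?thesis unfolding \<phi>_def fourier_boundary_div[OF \<psi>] four q_def by (simp only: integral_complex_of_real)
  qed
  have q_nonneg: "q y \<ge> 0" for y
    unfolding q_def using k1_nonneg by (intro Bochner_Integration.integral_nonneg) simp
  have k1_int: "integrable lborel k1" and q_int: "integrable lborel q"
  proof -
    have "fourier \<psi> = (\<lambda>x. complex_of_real (k1 x))" "fourier \<phi> = (\<lambda>x. complex_of_real (q x))" using four q by blast+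
    then show "integrable lborel k1" "integrable lborel q"
      using fourier_integrable[OF \<psi>] fourier_integrable[OF \<phi>] by (simp_all add: complex_of_real_integrable_eq)
  qed
  have [measurable]: "k1 \<in> borel_measurable borel" "q \<in> borel_measurable borel" using k1_int q_int by auto
  define Q where "Q = (LINT x|lborel. cmod (\<phi> x)) + (LINT x|lborel. cmod (\<psi> x))"
  have Qk: "k1 y \<le> Q" and Qq: "q y \<le> Q" for y
  proof -
    have i: "(LINT x|lborel. cmod (\<phi> x)) \<ge> 0" "(LINT x|lborel. cmod (\<psi> x)) \<ge> 0" by simp_all
    have "\<bar>k1 y\<bar> \<le> (LINT x|lborel. cmod (\<psi> x))" using norm_fourier_le[of \<psi> y] unfolding four norm_of_real .
    moreover have "\<bar>q y\<bar> \<le> (LINT x|lborel. cmod (\<phi> x))" using norm_fourier_le[of \<phi> y] unfolding q norm_of_real .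
    ultimately show "k1 y \<le> Q" "q y \<le> Q" using i unfolding Q_def by linarith+
  qed
  have Q0: "Q \<ge> 0" using Qk[of 0] k1_nonneg[of 0] by linarith
  obtain T where T: "T \<ge> 0" "\<And>x. \<bar>trend x\<bar> \<le> T" using trend_bounded by blast
  \<comment> \<open>On the half line \<open>remainder x + C0\<close> is non-negative:
    \<open>T\<close> absorbs the trend, and \<open>\<bar>S 0\<bar>\<close> a negative start of
    \<open>S\<close>.\<close>
  define C0 where "C0 = T + \<bar>S 0\<bar>"
  have C0: "C0 \<ge> 0" using T(1) by (simp add: C0_def)
  \<comment> \<open>Collects what is lost outside the window: the shift by \<open>C0\<close> against
    the full mass of both kernels, and the term with \<open>trend 0\<close>.\<close>
  define C1 where "C1 = C0 * ((LINT u|lborel. k1 u) + (LINT u|lborel. q u)) + T * Q"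
  obtain C2 where C2: "\<And>h. cmod (G \<phi> h) \<le> C2" using G(2)[OF \<phi>V] by metis
  have exp_le: "exp (- (\<delta> * u)) \<le> 1" if "\<delta> \<ge> 0" "u \<ge> 0" for \<delta> u :: real using that by simp
  have main: "exp (- (\<alpha> * (h + d1))) * S h * (\<kappa>1 * d1) \<le> C1 + C2" if h: "h \<ge> 0" "S h \<ge> 0" for h
  proof -
    let ?I = "\<lambda>\<sigma>. LINT x|lborel. F (Complex \<sigma> x) * (exp (\<i> * complex_of_real (h * x)) * \<phi> x)"
    let ?\<phi> = "\<lambda>x. exp (\<i> * complex_of_real (h * x)) * \<phi> x"
    have \<phi>h: "test_fun UNIV ?\<phi>" by (rule test_fun_mult[OF \<phi> smooth_cis])
    have bm: "boundary_mult ?\<phi> = (\<lambda>x. exp (\<i> * complex_of_real (h * x)) * \<psi> x)"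
      unfolding boundary_mult_modulation unfolding \<phi>_def boundary_mult_div ..
    have low: "exp (- ((\<sigma> - \<alpha>) * (h + d1))) * (exp (- (\<alpha> * (h + d1))) * S h * (\<kappa>1 * d1)) - C1 \<le> Re (?I \<sigma>)"
      if \<sigma>: "\<sigma> > \<alpha>" "\<sigma> < \<alpha> + 1" for \<sigma>
    proof -
      define \<delta> where "\<delta> = \<sigma> - \<alpha>"
      have \<delta>: "\<delta> > 0" "\<delta> \<le> 1" using \<sigma> by (auto simp: \<delta>_def)
      let ?K = "\<lambda>u. k1 (u - h) + \<delta> * q (u - h)"
      let ?c = "exp (- (\<delta> * (h + d1))) * (exp (- (\<alpha> * (h + d1))) * S h * \<kappa>1)"
      have shift_int: "integrable lborel (\<lambda>u. f (u - h))" if "integrable lborel f" for f :: "real \<Rightarrow> real"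
        using lborel_integrable_real_affine[OF that, of 1 "-h"] by simp
      have shift_val: "(LINT u|lborel. f (u - h)) = (LINT u|lborel. f u)" for f :: "real \<Rightarrow> real"
        using lborel_integral_real_affine[of 1 f "-h"] by simp
      have "?I \<sigma> = (LINT u|lborel. complex_of_real (exp (- (\<delta> * u)) * remainder u * ?K u)) + complex_of_real (trend 0 * q (- h))"
        unfolding boundary_pairing[OF \<phi>h \<sigma>(1)] bm fourier_modulation four q \<delta>_def[symmetric] by simp
      then have "?I \<sigma> = complex_of_real ((LINT u|lborel. exp (- (\<delta> * u)) * remainder u * ?K u) + trend 0 * q (- h))"
        by (simp only: integral_complex_of_real of_real_add)
      then have I: "Re (?I \<sigma>) = (LINT u|lborel. exp (- (\<delta> * u)) * remainder u * ?K u) + trend 0 * q (- h)" by simp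
      \<comment> \<open>As \<open>\<delta> \<le> 1\<close>, these bounds are uniform in
        sigma.\<close>
      have K0: "0 \<le> ?K u" and K1: "?K u \<le> k1 (u - h) + q (u - h)" for u
        using k1_nonneg[of "u - h"] q_nonneg[of "u - h"] \<delta> by (simp_all add: mult_le_cancel_right1 mult_left_le_one_le)
      have K2: "?K u \<le> Q + Q" for u using K1[of u] Qk[of "u - h"] Qq[of "u - h"] by linarith
      have iL: "integrable lborel (\<lambda>u. ?c * indicator {h..h + d1} u - C0 * (k1 (u - h) + q (u - h)))"
        by (intro Bochner_Integration.integrable_diff integrable_mult_right Bochner_Integration.integrable_add
            shift_int[OF k1_int] shift_int[OF q_int] integrable_real_indicator) (simp_all add: emeasure_lborel_Icc_eq)
      have iR: "integrable lborel (\<lambda>u. exp (- (\<delta> * u)) * remainder u * ?K u)"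
      proof (rule Bochner_Integration.integrable_bound)
        have "integrable lborel (\<lambda>u. norm (complex_of_real (remainder u) * exp (- (complex_of_real \<delta> * complex_of_real u))))"
          by (rule integrable_norm[OF remainder_exp_integrable]) (simp add: \<delta>)
        then have "integrable lborel (\<lambda>u. \<bar>remainder u\<bar> * exp (- (\<delta> * u)))"
          by (simp add: norm_mult norm_exp_eq_Re)
        then show "integrable lborel (\<lambda>u. (\<bar>remainder u\<bar> * exp (- (\<delta> * u))) * (Q + Q))" by (rule integrable_mult_left)
        show "AE u in lborel. norm (exp (- (\<delta> * u)) * remainder u * ?K u) \<le> norm ((\<bar>remainder u\<bar> * exp (- (\<delta> * u))) * (Q + Q))"
        proof (rule AE_I2)
          fix u
          have "norm (exp (- (\<delta> * u)) * remainder u * ?K u) = (\<bar>remainder u\<bar> * exp (- (\<delta> * u))) * ?K u"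
            using K0[of u] by (simp add: abs_mult mult_ac)
          also have "\<dots> \<le> (\<bar>remainder u\<bar> * exp (- (\<delta> * u))) * (Q + Q)" by (intro mult_left_mono K2) simp
          finally show "norm (exp (- (\<delta> * u)) * remainder u * ?K u) \<le> norm ((\<bar>remainder u\<bar> * exp (- (\<delta> * u))) * (Q + Q))"
            using Q0 by (simp add: abs_mult)
        qed
      qed measurable
      \<comment> \<open>Adding \<open>C0\<close> makes the integrand non-negative, so that only the
        window has to be kept; there monotonicity of \<open>S\<close> and the lower bound
        \<open>\<kappa>1\<close> of the kernel apply.\<close>
      have pt: "?c * indicator {h..h + d1} u - C0 * (k1 (u - h) + q (u - h)) \<le> exp (- (\<delta> * u)) * remainder u * ?K u" for u
      proof (cases "u < 0")
        case True
        have "C0 * (k1 (u - h) + q (u - h)) \<ge> 0" using C0 k1_nonneg q_nonneg by simp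
        then show ?thesis using True h(1) by (simp add: remainder_neg indicator_def)
      next
        case False
        let ?E = "exp (- (\<delta> * u))"
        have E: "0 < ?E" "?E \<le> 1" using \<delta> False by auto
        have rem: "remainder u = exp (- \<alpha> * u) * S u - trend u" using False by (simp add: remainder_def)
        have "exp (- \<alpha> * u) * \<bar>S 0\<bar> \<le> 1 * \<bar>S 0\<bar>" using False alpha_pos by (intro mult_right_mono) auto
        moreover have "exp (- \<alpha> * u) * S u \<ge> exp (- \<alpha> * u) * (- \<bar>S 0\<bar>)" using S_lower[of u] by (intro mult_left_mono) auto
        ultimately have r0: "remainder u + C0 \<ge> 0" using T(2)[of u] unfolding rem C0_def by linarith
        have "?E * (C0 * ?K u) \<le> 1 * (C0 * (k1 (u - h) + q (u - h)))"
          using E C0 K0[of u] K1[of u] by (intro mult_mono mult_left_mono mult_nonneg_nonneg) auto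
        moreover have "?c * indicator {h..h + d1} u \<le> ?E * ((remainder u + C0) * ?K u)"
        proof (cases "u \<in> {h..h + d1}")
          case True
          have "S h \<le> S u" using True h(1) by (intro S_le) auto
          have e1: "exp (- (\<delta> * (h + d1))) \<le> ?E" using True \<delta> by simp
          have e2: "exp (- (\<alpha> * (h + d1))) \<le> exp (- \<alpha> * u)" using True alpha_pos by simp
          have "exp (- (\<alpha> * (h + d1))) * S h \<le> exp (- \<alpha> * u) * S u"
            using e2 \<open>S h \<le> S u\<close> h(2) by (intro mult_mono) auto
          also have "\<dots> \<le> remainder u + C0" using T(2)[of u] unfolding rem C0_def by linarith
          finally have s: "exp (- (\<alpha> * (h + d1))) * S h \<le> remainder u + C0" .
          have "\<bar>u - h\<bar> \<le> d1" using True by auto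
          then have "\<kappa>1 \<le> ?K u" using k1_low[of "u - h"] q_nonneg[of "u - h"] \<delta>(1) by (simp add: add_increasing2)
          then have "exp (- (\<delta> * (h + d1))) * (exp (- (\<alpha> * (h + d1))) * S h * \<kappa>1) \<le> ?E * ((remainder u + C0) * ?K u)"
            using e1 s \<kappa>1 h(2) r0 by (intro mult_mono mult_nonneg_nonneg) auto
          then show ?thesis using True by simp
        next
          case False
          then show ?thesis using E r0 K0[of u] by simp
        qed
        moreover have "?E * remainder u * ?K u = ?E * ((remainder u + C0) * ?K u) - ?E * (C0 * ?K u)"
          by (simp add: algebra_simps)
        ultimately show ?thesis by linarith
      qed
      have "(LINT u|lborel. ?c * indicator {h..h + d1} u - C0 * (k1 (u - h) + q (u - h))) =
          (LINT u|lborel. ?c * indicator {h..h + d1} u) - (LINT u|lborel. C0 * (k1 (u - h) + q (u - h)))"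
        by (intro Bochner_Integration.integral_diff integrable_mult_right Bochner_Integration.integrable_add
            shift_int[OF k1_int] shift_int[OF q_int] integrable_real_indicator) (simp_all add: emeasure_lborel_Icc_eq)
      also have "(LINT u|lborel. ?c * indicator {h..h + d1} u) = ?c * d1" using d1 by simp
      also have "(LINT u|lborel. C0 * (k1 (u - h) + q (u - h))) = C0 * ((LINT u|lborel. k1 u) + (LINT u|lborel. q u))"
        by (simp add: Bochner_Integration.integral_add[OF shift_int[OF k1_int] shift_int[OF q_int]] shift_val)
      finally have "?c * d1 - C0 * ((LINT u|lborel. k1 u) + (LINT u|lborel. q u)) \<le> (LINT u|lborel. exp (- (\<delta> * u)) * remainder u * ?K u)"
        using integral_mono[OF iL iR pt] by simp
      moreover have "trend 0 * q (- h) \<ge> - (T * Q)"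
      proof -
        have "\<bar>trend 0 * q (- h)\<bar> \<le> T * Q"
          unfolding abs_mult using T Qq[of "-h"] q_nonneg[of "-h"] by (intro mult_mono) auto
        then show ?thesis by (simp add: abs_le_iff)
      qed
      ultimately have "?c * d1 - C1 \<le> Re (?I \<sigma>)" unfolding I C1_def by linarith
      then show ?thesis unfolding \<delta>_def by (simp only: mult.assoc)
    qed
    have lim1: "((\<lambda>\<sigma>. Re (?I \<sigma>)) \<longlongrightarrow> Re (G \<phi> h)) (at_right \<alpha>)" by (intro tendsto_Re G(1)[OF \<phi>V])
    have "((\<lambda>\<sigma>. exp (- ((\<sigma> - \<alpha>) * (h + d1))) * (exp (- (\<alpha> * (h + d1))) * S h * (\<kappa>1 * d1)) - C1) \<longlongrightarrow>
        exp (- ((\<alpha> - \<alpha>) * (h + d1))) * (exp (- (\<alpha> * (h + d1))) * S h * (\<kappa>1 * d1)) - C1) (at_right \<alpha>)"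
      by (intro tendsto_intros)
    then have lim2: "((\<lambda>\<sigma>. exp (- ((\<sigma> - \<alpha>) * (h + d1))) * (exp (- (\<alpha> * (h + d1))) * S h * (\<kappa>1 * d1)) - C1) \<longlongrightarrow>
        exp (- (\<alpha> * (h + d1))) * S h * (\<kappa>1 * d1) - C1) (at_right \<alpha>)" by simp
    have "\<forall>\<^sub>F \<sigma> in at_right \<alpha>. exp (- ((\<sigma> - \<alpha>) * (h + d1))) * (exp (- (\<alpha> * (h + d1))) * S h * (\<kappa>1 * d1)) - C1 \<le> Re (?I \<sigma>)"
      by (rule eventually_at_rightI[of _ "\<alpha> + 1"]) (use low in auto)
    from tendsto_le[OF _ lim1 lim2 this]
    have "exp (- (\<alpha> * (h + d1))) * S h * (\<kappa>1 * d1) - C1 \<le> Re (G \<phi> h)" by simp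
    also have "\<dots> \<le> C2" using complex_Re_le_cmod[of "G \<phi> h"] C2[of h] by linarith
    finally show ?thesis by simp
  qed
  \<comment> \<open>The exponential factor replaces the weight at \<open>h + d1\<close> by the one
    at \<open>h\<close>.\<close>
  define C3 where "C3 = (C1 + C2) / (\<kappa>1 * d1) * exp (\<alpha> * d1)"
  have up: "exp (- \<alpha> * h) * S h \<le> \<bar>C3\<bar>" if h: "h \<ge> 0" for h
  proof (cases "S h \<ge> 0")
    case True
    have pos: "\<kappa>1 * d1 > 0" using \<kappa>1 d1 by simp
    have "exp (- (\<alpha> * (h + d1))) * S h \<le> (C1 + C2) / (\<kappa>1 * d1)"
      using main[OF h True] pos by (simp add: pos_le_divide_eq)
    then have "exp (- (\<alpha> * (h + d1))) * S h * exp (\<alpha> * d1) \<le> C3" unfolding C3_def by (intro mult_right_mono) auto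
    moreover have "exp (- (\<alpha> * (h + d1))) * exp (\<alpha> * d1) = exp (- \<alpha> * h)"
      unfolding exp_add[symmetric] by (rule arg_cong[where f = exp]) (simp add: algebra_simps)
    then have "exp (- (\<alpha> * (h + d1))) * S h * exp (\<alpha> * d1) = exp (- \<alpha> * h) * S h" by (simp add: mult_ac)
    ultimately show ?thesis by linarith
  next
    case False
    then have "exp (- \<alpha> * h) * S h \<le> 0" by (simp add: mult_nonneg_nonpos)
    then show ?thesis by linarith
  qed
  have "\<bar>remainder x\<bar> \<le> \<bar>C3\<bar> + C0" for x
  proof (cases "x < 0")
    case False
    have "exp (- \<alpha> * x) * \<bar>S 0\<bar> \<le> 1 * \<bar>S 0\<bar>" using False alpha_pos by (intro mult_right_mono) auto
    moreover have "exp (- \<alpha> * x) * S x \<ge> exp (- \<alpha> * x) * (- \<bar>S 0\<bar>)" using S_lower[of x] by (intro mult_left_mono) auto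
    moreover have "remainder x = exp (- \<alpha> * x) * S x - trend x" using False by (simp add: remainder_def)
    ultimately show ?thesis using up[of x] T(2)[of x] False unfolding C0_def by linarith
  qed (use C0 in \<open>simp add: remainder_neg\<close>)
  then show ?thesis using that by blast
qed

end

section \<open>The Tauberian and the Abelian theorem\<close>

context bounded_signal
begin

lemma pairing_cnj_neg: "pairing (\<lambda>x. cnj (\<phi> (- x))) h = cnj (pairing \<phi> h)"
proof -
  have "cnj (pairing \<phi> h) = (LINT x|lborel. cnj (complex_of_real (\<rho> x) * fourier \<phi> (x - h)))"
    unfolding pairing_def by (rule Bochner_Integration.integral_cnj[symmetric])
  then show ?thesis unfolding pairing_def fourier_cnj_neg by simp
qed

lemma regular_uminus:
  assumes "\<tau> \<in> regular" shows "- \<tau> \<in> regular"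
proof -
  obtain V where V: "open V" "\<tau> \<in> V" "\<And>\<psi>. test_fun V \<psi> \<Longrightarrow> vanishing \<psi>"
    using assms unfolding regular_def by blast
  have "vanishing \<psi>" if \<psi>: "test_fun (uminus ` V) \<psi>" for \<psi>
  proof -
    have "test_fun V (\<lambda>x. cnj (\<psi> (- x)))" using test_fun_cnj_neg[OF \<psi>] by (simp add: image_image)
    from V(3)[OF this] have "((\<lambda>h. cnj (pairing \<psi> h)) \<longlongrightarrow> 0) at_top"
      unfolding vanishing_def pairing_cnj_neg[abs_def] .
    from tendsto_cnj[OF this] show ?thesis unfolding vanishing_def by simp
  qed
  moreover have "open (uminus ` V)" "- \<tau> \<in> uminus ` V" using V(1,2) by (auto intro: open_negations)
  ultimately show ?thesis unfolding regular_def by blast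
qed

end

context laplace_asymptotics
begin

text \<open>Each exponential in \<open>trend\<close> has a frequency different from
  \<open>\<tau>\<close>, so its truncated integral is at most 2 divided by the distance of the two
  frequencies.\<close>

lemma trend_oscillation:
  assumes "\<tau> \<noteq> 0" "\<And>n. n \<in> {1..N} \<Longrightarrow> \<tau> \<noteq> t n" "\<And>n. n \<in> {1..N} \<Longrightarrow> \<tau> \<noteq> - t n"
  obtains C where "\<And>x. x \<ge> 0 \<Longrightarrow>
    integrable lborel (\<lambda>u. indicator {0..x} u *\<^sub>R (complex_of_real (trend u) * exp (- (\<i> * complex_of_real (\<tau> * u)))))"
    "\<And>x. x \<ge> 0 \<Longrightarrow>
    cmod (LINT u|lborel. indicator {0..x} u *\<^sub>R (complex_of_real (trend u) * exp (- (\<i> * complex_of_real (\<tau> * u))))) \<le> C"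
proof -
  let ?e = "\<lambda>\<omega> x u. indicator {0..x} u *\<^sub>R exp (\<i> * complex_of_real ((\<omega> - \<tau>) * u))"
  define J where "J \<omega> x = (LINT u|lborel. ?e \<omega> x u)" for \<omega> x
  have Jb: "has_bochner_integral lborel (?e \<omega> x) (J \<omega> x)" for \<omega> x
    unfolding J_def by (intro has_bochner_integral_integrable borel_integrable_compact continuous_intros) simp
  have Jn: "cmod (J \<omega> x) \<le> 2 / \<bar>\<omega> - \<tau>\<bar>" if "\<omega> \<noteq> \<tau>" "x \<ge> 0" for \<omega> x
  proof -
    let ?c = "\<i> * complex_of_real (\<omega> - \<tau>)"
    have c: "?c \<noteq> 0" using that(1) by simp
    have der: "((\<lambda>u. 1 / ?c * exp (\<i> * complex_of_real ((\<omega> - \<tau>) * u))) has_vector_derivative exp (\<i> * complex_of_real ((\<omega> - \<tau>) * u))) (at u)" for u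
      using has_vector_derivative_mult_right[OF has_vector_derivative_cis, of "1 / ?c" "\<omega> - \<tau>" u] c
      by (simp del: of_real_diff of_real_mult add: mult.assoc[symmetric])
    have "J \<omega> x = 1 / ?c * exp (\<i> * complex_of_real ((\<omega> - \<tau>) * x)) - 1 / ?c * exp (\<i> * complex_of_real ((\<omega> - \<tau>) * 0))"
      unfolding J_def using that(2)
      by (intro integral_FTC_Icc has_vector_derivative_at_within[OF der] continuous_intros)
    also have "\<dots> = (exp (\<i> * complex_of_real ((\<omega> - \<tau>) * x)) - 1) / ?c" by (simp add: diff_divide_distrib)
    finally have "cmod (J \<omega> x) = cmod (exp (\<i> * complex_of_real ((\<omega> - \<tau>) * x)) - 1) / cmod ?c" by (simp only: norm_divide)
    also have "cmod ?c = \<bar>\<omega> - \<tau>\<bar>" unfolding norm_mult norm_of_real by simp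
    also have "cmod (exp (\<i> * complex_of_real ((\<omega> - \<tau>) * x)) - 1) \<le> 2"
      using norm_triangle_ineq4[of "exp (\<i> * complex_of_real ((\<omega> - \<tau>) * x))" 1] by (simp only: norm_exp_i_times norm_one)
    finally show ?thesis by (simp add: divide_right_mono)
  qed
  let ?a = "\<lambda>n. exp (\<i> * complex_of_real (\<theta> n)) / (complex_of_real \<alpha> + \<i> * complex_of_real (t n))"
  let ?b = "\<lambda>n. exp (- (\<i> * complex_of_real (\<theta> n))) / (complex_of_real \<alpha> + \<i> * complex_of_real (- t n))"
  let ?r0 = "complex_of_real (r 0) / complex_of_real \<alpha>"
  have m: "exp (\<i> * complex_of_real ((\<omega> - \<tau>) * u)) = exp (\<i> * complex_of_real (\<omega> * u)) * exp (- (\<i> * complex_of_real (\<tau> * u)))" for \<omega> u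
    unfolding exp_add[symmetric] by (rule arg_cong[where f = exp]) (simp add: algebra_simps)
  have has: "has_bochner_integral lborel (\<lambda>u. indicator {0..x} u *\<^sub>R (complex_of_real (trend u) * exp (- (\<i> * complex_of_real (\<tau> * u)))))
     (?r0 * J 0 x + (\<Sum>n=1..N. complex_of_real (r n) * (?a n * J (t n) x + ?b n * J (- t n) x)))" for x
    by (rule trend_combination[OF Jb[unfolded m]])
  define C where "C = cmod ?r0 * (2 / \<bar>0 - \<tau>\<bar>) +
     (\<Sum>n=1..N. \<bar>r n\<bar> * (cmod (?a n) * (2 / \<bar>t n - \<tau>\<bar>) + cmod (?b n) * (2 / \<bar>- t n - \<tau>\<bar>)))"
  have bd: "cmod (?r0 * J 0 x + (\<Sum>n=1..N. complex_of_real (r n) * (?a n * J (t n) x + ?b n * J (- t n) x))) \<le> C" if x: "x \<ge> 0" for x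
    unfolding C_def
  proof (rule order_trans[OF norm_triangle_ineq add_mono])
    show "cmod (?r0 * J 0 x) \<le> cmod ?r0 * (2 / \<bar>0 - \<tau>\<bar>)"
      unfolding norm_mult by (intro mult_left_mono Jn x) (use assms(1) in auto)
    show "cmod (\<Sum>n=1..N. complex_of_real (r n) * (?a n * J (t n) x + ?b n * J (- t n) x)) \<le>
       (\<Sum>n=1..N. \<bar>r n\<bar> * (cmod (?a n) * (2 / \<bar>t n - \<tau>\<bar>) + cmod (?b n) * (2 / \<bar>- t n - \<tau>\<bar>)))"
    proof (rule sum_norm_le)
      fix n assume n: "n \<in> {1..N}"
      have "cmod (?a n * J (t n) x + ?b n * J (- t n) x) \<le> cmod (?a n * J (t n) x) + cmod (?b n * J (- t n) x)"
        by (rule norm_triangle_ineq)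
      also have "\<dots> \<le> cmod (?a n) * (2 / \<bar>t n - \<tau>\<bar>) + cmod (?b n) * (2 / \<bar>- t n - \<tau>\<bar>)"
        unfolding norm_mult[of "?a n"] norm_mult[of "?b n"]
        by (intro add_mono mult_left_mono Jn x norm_ge_zero) (use assms(2,3)[OF n] in auto)
      finally show "cmod (complex_of_real (r n) * (?a n * J (t n) x + ?b n * J (- t n) x)) \<le>
          \<bar>r n\<bar> * (cmod (?a n) * (2 / \<bar>t n - \<tau>\<bar>) + cmod (?b n) * (2 / \<bar>- t n - \<tau>\<bar>))"
        unfolding norm_mult[of "complex_of_real (r n)"] norm_of_real by (rule mult_left_mono) simp
    qed
  qed
  show ?thesis
  proof (rule that[of C])
    fix x :: real assume x: "x \<ge> 0"
    show "integrable lborel (\<lambda>u. indicator {0..x} u *\<^sub>R (complex_of_real (trend u) * exp (- (\<i> * complex_of_real (\<tau> * u)))))"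
      using has[of x] unfolding has_bochner_integral_iff by (rule conjunct1)
    show "cmod (LINT u|lborel. indicator {0..x} u *\<^sub>R (complex_of_real (trend u) * exp (- (\<i> * complex_of_real (\<tau> * u))))) \<le> C"
      unfolding has_bochner_integral_integral_eq[OF has] by (rule bd[OF x])
  qed
qed

text \<open>By parts, the Stieltjes integral is w = alpha + i tau times the integral of S(u) exp(-w
  u), up to terms bounded because remainder and trend are. Dividing by w and subtracting the bounded
  contribution of the trend leaves the remainder.\<close>

lemma remainder_fourier_bounded:
  assumes B: "\<And>x. \<bar>remainder x\<bar> \<le> B"
    and \<tau>: "\<tau> \<noteq> 0" "\<And>n. n \<in> {1..N} \<Longrightarrow> \<tau> \<noteq> t n" "\<And>n. n \<in> {1..N} \<Longrightarrow> \<tau> \<noteq> - t n"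
    and M: "\<And>x. x > 0 \<Longrightarrow>
      cmod (rs_integral (\<lambda>u. exp (- complex_of_real (\<alpha> * u) - \<i> * complex_of_real (\<tau> * u))) S 0 x) < M"
  shows "\<exists>M. \<forall>x\<ge>0. cmod (fourier (\<lambda>u. complex_of_real (indicator {0..x} u * remainder u)) \<tau>) \<le> M"
proof -
  obtain C where C: "\<And>x. x \<ge> 0 \<Longrightarrow>
    integrable lborel (\<lambda>u. indicator {0..x} u *\<^sub>R (complex_of_real (trend u) * exp (- (\<i> * complex_of_real (\<tau> * u)))))"
    "\<And>x. x \<ge> 0 \<Longrightarrow>
    cmod (LINT u|lborel. indicator {0..x} u *\<^sub>R (complex_of_real (trend u) * exp (- (\<i> * complex_of_real (\<tau> * u))))) \<le> C"
    by (rule trend_oscillation[OF \<tau>(1)], erule \<tau>(2), erule \<tau>(3), rule that)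
  obtain T where T: "T \<ge> 0" "\<And>x. \<bar>trend x\<bar> \<le> T" using trend_bounded by blast
  define w where "w = complex_of_real \<alpha> + \<i> * complex_of_real \<tau>"
  have w: "cmod w > 0" using alpha_plus_ne_0[of \<tau>] by (simp add: w_def)
  have w_exp: "exp (- complex_of_real (\<alpha> * u) - \<i> * complex_of_real (\<tau> * u)) = exp (- (w * complex_of_real u))" for u
    by (rule arg_cong[where f = exp]) (simp add: w_def algebra_simps)
  have B0: "B \<ge> 0" using B[of 0] by linarith
  define D where "D = (M + (B + T) + \<bar>S 0\<bar>) / cmod w"
  have C0: "C \<ge> 0" using C(2)[of 0] norm_ge_zero order_trans by blast
  have M0: "M \<ge> 0" using M[of 1] norm_ge_zero less_imp_le order_trans by (metis zero_less_one)
  have D0: "D \<ge> 0" unfolding D_def using M0 B0 T(1) by simp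
  have "cmod (fourier (\<lambda>u. complex_of_real (indicator {0..x} u * remainder u)) \<tau>) \<le> D + C" if x: "x \<ge> 0" for x
  \<comment> \<open>The hypothesis speaks about positive \<open>x\<close>; at 0 the integral extends
    over a null set.\<close>
  proof (cases "x = 0")
    case True
    have "AE u in lborel. exp (- (\<i> * complex_of_real (\<tau> * u))) * complex_of_real (indicator {0..x} u * remainder u) = 0"
      using AE_lborel_singleton[of 0] by eventually_elim (simp add: True indicator_def)
    then have "fourier (\<lambda>u. complex_of_real (indicator {0..x} u * remainder u)) \<tau> = 0"
      unfolding fourier_def by (rule integral_eq_zero_AE)
    then show ?thesis using D0 C0 by simp
  next
    case False
    then have x': "x > 0" using x by simp
    let ?t = "\<lambda>u. indicator {0..x} u *\<^sub>R (complex_of_real (trend u) * exp (- (\<i> * complex_of_real (\<tau> * u))))"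
    let ?s = "\<lambda>u. indicator {0..x} u *\<^sub>R (complex_of_real (S u) * exp (- (w * complex_of_real u)))"
    have "exp (- (\<i> * complex_of_real (\<tau> * u))) * complex_of_real (indicator {0..x} u * remainder u) = ?s u - ?t u" for u
    proof (cases "u \<in> {0..x}")
      case True
      have "exp (- (w * complex_of_real u)) = complex_of_real (exp (- \<alpha> * u)) * exp (- (\<i> * complex_of_real (\<tau> * u)))"
        unfolding exp_of_real[symmetric] exp_add[symmetric] by (rule arg_cong[where f = exp]) (simp add: w_def algebra_simps)
      then show ?thesis using True by (simp add: remainder_def algebra_simps)
    qed simp
    then have "fourier (\<lambda>u. complex_of_real (indicator {0..x} u * remainder u)) \<tau> = (LINT u|lborel. ?s u) - (LINT u|lborel. ?t u)"
      unfolding fourier_def by (simp only: Bochner_Integration.integral_diff[OF S_exp_integrable_on C(1)[OF x]])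
    also have "(LINT u|lborel. ?s u) = partial_transform w x" by (rule partial_transform_eq) simp
    finally have eq: "fourier (\<lambda>u. complex_of_real (indicator {0..x} u * remainder u)) \<tau> = partial_transform w x - (LINT u|lborel. ?t u)" .
    have "w * partial_transform w x = rs_integral (\<lambda>u. exp (- (w * complex_of_real u))) S 0 x
        - exp (- (w * complex_of_real x)) * complex_of_real (S x) + complex_of_real (S 0)"
      unfolding rs_integral_0_eq[OF x'] by simp
    then have "cmod (w * partial_transform w x) \<le> cmod (rs_integral (\<lambda>u. exp (- (w * complex_of_real u))) S 0 x)
        + cmod (exp (- (w * complex_of_real x)) * complex_of_real (S x)) + cmod (complex_of_real (S 0))"
      by (simp only:) (intro order_trans[OF norm_triangle_ineq] add_right_mono norm_triangle_ineq4)
    also have "cmod (rs_integral (\<lambda>u. exp (- (w * complex_of_real u))) S 0 x) \<le> M"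
      using M[OF x'] unfolding w_exp by simp
    also have "cmod (exp (- (w * complex_of_real x)) * complex_of_real (S x)) = \<bar>remainder x + trend x\<bar>"
      using x by (simp add: norm_mult norm_exp_eq_Re w_def remainder_def abs_mult)
    also have "\<dots> \<le> B + T" using B[of x] T(2)[of x] by linarith
    finally have "cmod w * cmod (partial_transform w x) \<le> M + (B + T) + \<bar>S 0\<bar>" by (simp add: norm_mult)
    then have "cmod (partial_transform w x) \<le> D" unfolding D_def using w by (simp add: field_simps)
    then show ?thesis unfolding eq using C(2)[OF x] norm_triangle_ineq4[of "partial_transform w x" "LINT u|lborel. ?t u"] by linarith
  qed
  then show ?thesis by blast
qed

theorem tauberian:
  assumes E: "closed E" "E \<in> null_sets lborel"
    and lpf: "lpf_boundary F \<alpha> (- E)"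
    and E0: "0 \<notin> E" and En: "\<And>n. n \<in> {1..N} \<Longrightarrow> t n \<notin> E"
    and M: "\<And>\<tau>. \<tau> \<in> E \<Longrightarrow> \<exists>M>0. \<forall>x>0.
       cmod (rs_integral (\<lambda>u. exp (- complex_of_real (\<alpha> * u) - \<i> * complex_of_real (\<tau> * u))) S 0 x) < M"
  shows "(remainder \<longlongrightarrow> 0) at_top"
proof -
  obtain B where B: "\<And>x. \<bar>remainder x\<bar> \<le> B" using remainder_bounded[OF lpf] E0 by auto
  have B0: "B \<ge> 0" using B[of 0] by linarith
  interpret bs: bounded_signal remainder B
    by unfold_locales (auto simp: B remainder_neg)
  have reg: "- E \<subseteq> bs.regular"
  proof
    fix t0 assume "t0 \<in> - E"
    obtain V G where V: "open V" "t0 \<in> V" and "V \<subseteq> - E"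
      and G: "\<And>\<phi> h. test_fun V \<phi> \<Longrightarrow>
       ((\<lambda>\<sigma>. LINT x|lborel. F (Complex \<sigma> x) * (exp (\<i> * complex_of_real (h * x)) * \<phi> x)) \<longlongrightarrow> G \<phi> h) (at_right \<alpha>)"
      and "\<And>\<phi>. test_fun V \<phi> \<Longrightarrow> \<exists>C. \<forall>h. cmod (G \<phi> h) \<le> C"
      and G0: "\<And>\<phi>. test_fun V \<phi> \<Longrightarrow> (G \<phi> \<longlongrightarrow> 0) at_top"
      by (rule lpf_boundary_local[OF lpf \<open>t0 \<in> - E\<close>], rule that)
    have "bs.vanishing \<psi>" if \<psi>V: "test_fun V \<psi>" for \<psi>
    proof -
      define \<phi> where "\<phi> = boundary_div \<psi>"
      have \<phi>V: "test_fun V \<phi>" unfolding \<phi>_def by (rule test_fun_boundary_div[OF \<psi>V])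
      have \<phi>: "test_fun UNIV \<phi>" by (rule test_fun_mono[OF \<phi>V]) simp
      \<comment> \<open>Two evaluations of the same boundary limit are compared: the one given by
        the hypothesis and the one computed from the bounded remainder. The constant
        \<open>trend 0\<close> contributes only a decaying transform.\<close>
      have eq: "bs.pairing \<psi> h = G \<phi> h - complex_of_real (trend 0) * fourier \<phi> (- h)" for h
      proof -
        let ?\<phi> = "\<lambda>x. exp (\<i> * complex_of_real (h * x)) * \<phi> x"
        have \<phi>h: "test_fun UNIV ?\<phi>" by (rule test_fun_mult[OF \<phi> smooth_cis])
        have bm: "boundary_mult ?\<phi> = (\<lambda>x. exp (\<i> * complex_of_real (h * x)) * \<psi> x)"
          unfolding boundary_mult_modulation unfolding \<phi>_def boundary_mult_div ..
        have "((\<lambda>\<sigma>. LINT x|lborel. F (Complex \<sigma> x) * ?\<phi> x) \<longlongrightarrow>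
            bs.pairing \<psi> h + complex_of_real (trend 0) * fourier \<phi> (0 - h)) (at_right \<alpha>)"
          using boundary_limit[OF \<phi>h B] unfolding bm fourier_modulation bs.pairing_def .
        from tendsto_unique[OF trivial_limit_at_right_real G[OF \<phi>V] this]
        show ?thesis by simp
      qed
      have "((\<lambda>h. fourier \<phi> (- h)) \<longlongrightarrow> 0) at_top"
        by (rule filterlim_compose[OF fourier_tendsto_0[OF \<phi>]])
           (rule filterlim_at_bot_imp_at_infinity[OF filterlim_uminus_at_bot_at_top])
      then have "((\<lambda>h. G \<phi> h - complex_of_real (trend 0) * fourier \<phi> (- h)) \<longlongrightarrow> 0 - 0) at_top"
        by (intro tendsto_diff G0[OF \<phi>V] tendsto_mult_right_zero)
      then show ?thesis unfolding bs.vanishing_def eq[abs_def] by simp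
    qed
    then show "t0 \<in> bs.regular" using V unfolding bs.regular_def by blast
  qed
  \<comment> \<open>A frequency whose negative lies outside \<open>E\<close> is regular by symmetry.
    For \<open>\<tau>\<close> in \<open>E'\<close> both signs lie in \<open>E\<close>, so
    \<open>\<tau>\<close> avoids 0 and all \<open>t n\<close> and \<open>- t n\<close>.\<close>
  define E' where "E' = E \<inter> uminus ` E"
  have "bs.regular = UNIV"
  proof (rule bs.null_set_removal)
    have "closed (uminus ` E)" using E(1) by (rule closed_negations)
    then show "E' \<in> null_sets lborel"
      unfolding E'_def by (intro null_sets_subset[OF E(2)]) (use E(1) in auto)
    show "- E' \<subseteq> bs.regular"
    proof
      fix \<tau> assume "\<tau> \<in> - E'"
      then consider "\<tau> \<in> - E" | "- \<tau> \<in> - E" unfolding E'_def by (force simp: image_iff)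
      then show "\<tau> \<in> bs.regular"
      proof cases
        case 2
        then have "- \<tau> \<in> bs.regular" using reg by blast
        from bs.regular_uminus[OF this] show ?thesis by simp
      qed (use reg in blast)
    qed
    fix \<tau> assume "\<tau> \<in> E'"
    then have \<tau>: "\<tau> \<in> E" "- \<tau> \<in> E" unfolding E'_def by auto
    obtain Mt where Mt: "\<And>x. x > 0 \<Longrightarrow>
       cmod (rs_integral (\<lambda>u. exp (- complex_of_real (\<alpha> * u) - \<i> * complex_of_real (\<tau> * u))) S 0 x) < Mt"
      using M[OF \<tau>(1)] by blast
    show "\<exists>M. \<forall>x\<ge>0. cmod (fourier (\<lambda>u. complex_of_real (indicator {0..x} u * remainder u)) \<tau>) \<le> M"
    proof (rule remainder_fourier_bounded[OF B _ _ _ Mt])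
      show "\<tau> \<noteq> 0" using \<tau> E0 by auto
      show "\<tau> \<noteq> t n" if "n \<in> {1..N}" for n using \<tau> En[OF that] by auto
      show "\<tau> \<noteq> - t n" if "n \<in> {1..N}" for n using \<tau> En[OF that] by auto
    qed
  qed
  then have van: "bs.vanishing \<phi>" if "test_fun UNIV \<phi>" for \<phi>
    using bs.vanishing_if_regular[of \<phi>] that by simp
  obtain T where T: "T \<ge> 0" "\<And>x. \<bar>trend x\<bar> \<le> T" using trend_bounded by blast
  obtain L where L: "L \<ge> 0" "\<And>x y. \<bar>trend x - trend y\<bar> \<le> L * \<bar>x - y\<bar>" using trend_lipschitz by blast
  show ?thesis
  proof (rule bs.one_sided_tauberian[OF van])
    \<comment> \<open>Since \<open>S\<close> is non-decreasing,
      \<open>exp (- \<alpha> * x) * S x\<close> can fall only through its exponential factor, at a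
      rate of at most \<open>\<alpha>\<close> times its bound \<open>B + T\<close>; \<open>L\<close>
      is a Lipschitz constant of the trend, and 1 secures positivity.\<close>
    show "0 < \<alpha> * (B + T) + L + 1" using alpha_pos B0 T(1) L(1) by (simp add: add_nonneg_pos)
    fix x y :: real assume xy: "0 \<le> x" "x \<le> y"
    let ?\<tau> = "\<lambda>x. exp (- \<alpha> * x) * S x"
    have rem: "remainder x = ?\<tau> x - trend x" "remainder y = ?\<tau> y - trend y" using xy by (auto simp: remainder_def)
    have "\<bar>?\<tau> x\<bar> \<le> B + T" using B[of x] T(2)[of x] rem(1) by linarith
    have "?\<tau> y \<ge> exp (- \<alpha> * y) * S x" using S_le[OF xy] by (intro mult_left_mono) auto
    moreover have "exp (- \<alpha> * y) * S x = exp (- \<alpha> * (y - x)) * ?\<tau> x"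
      unfolding mult.assoc[symmetric] exp_add[symmetric] by (simp add: algebra_simps)
    moreover have "- ((1 - exp (- \<alpha> * (y - x))) * ?\<tau> x) = exp (- \<alpha> * (y - x)) * ?\<tau> x - ?\<tau> x"
      by (simp only: left_diff_distrib mult_1_left minus_diff_eq)
    ultimately have "?\<tau> y - ?\<tau> x \<ge> - ((1 - exp (- \<alpha> * (y - x))) * ?\<tau> x)" by linarith
    moreover have "\<bar>(1 - exp (- \<alpha> * (y - x))) * ?\<tau> x\<bar> \<le> (\<alpha> * (y - x)) * (B + T)"
      unfolding abs_mult[of "1 - exp (- \<alpha> * (y - x))"]
    proof (rule mult_mono)
      have "1 - exp (- \<alpha> * (y - x)) \<le> \<alpha> * (y - x)" using exp_ge_add_one_self[of "- \<alpha> * (y - x)"] by linarith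
      moreover have "exp (- \<alpha> * (y - x)) \<le> 1" using alpha_pos xy by simp
      ultimately show "\<bar>1 - exp (- \<alpha> * (y - x))\<bar> \<le> \<alpha> * (y - x)" by linarith
    qed (use \<open>\<bar>?\<tau> x\<bar> \<le> B + T\<close> alpha_pos xy in auto)
    moreover have "\<bar>trend y - trend x\<bar> \<le> L * (y - x)" using L(2)[of y x] xy by simp
    ultimately have "remainder y - remainder x \<ge> - ((\<alpha> * (y - x)) * (B + T)) - L * (y - x)"
      unfolding rem by linarith
    moreover have "- (\<alpha> * (B + T) + L + 1) * (y - x) \<le> - ((\<alpha> * (y - x)) * (B + T)) - L * (y - x)"
      using xy by (simp add: algebra_simps)
    ultimately show "- (\<alpha> * (B + T) + L + 1) * (y - x) \<le> remainder y - remainder x" by linarith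
  qed
qed

section \<open>From decay of the remainder to boundary behaviour\<close>

theorem abelian:
  assumes lim: "(remainder \<longlongrightarrow> 0) at_top"
  shows "lpf_boundary F \<alpha> UNIV"
proof -
  obtain T where T: "T \<ge> 0" "\<And>x. \<bar>trend x\<bar> \<le> T" using trend_bounded by blast
  have "\<forall>\<^sub>F x in at_top. dist (remainder x) 0 < 1" using lim by (rule tendstoD) simp
  then obtain X where X: "\<And>x. x \<ge> X \<Longrightarrow> \<bar>remainder x\<bar> < 1" unfolding eventually_at_top_linorder by auto
  \<comment> \<open>The remainder is below 1 beyond \<open>X\<close>, and before it
    \<open>S_var X\<close> bounds \<open>S\<close>; the summand with the absolute value spares a
    discussion of signs.\<close>
  define B where "B = 1 + S_var X + \<bar>S_var X\<bar> + T"
  have B: "\<bar>remainder x\<bar> \<le> B" for x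
  proof -
    consider "x < 0" | "x \<ge> X" | "0 \<le> x" "x < X" by linarith
    then show ?thesis
    proof cases
      case 3
      have "exp (- \<alpha> * x) * \<bar>S x\<bar> \<le> 1 * S_var X"
        using 3 alpha_pos abs_S_le[of x X] by (intro mult_mono) auto
      then have "\<bar>exp (- \<alpha> * x) * S x\<bar> \<le> S_var X" by (simp add: abs_mult)
      moreover have "remainder x = exp (- \<alpha> * x) * S x - trend x" using 3 by (simp add: remainder_def)
      ultimately show ?thesis using T(2)[of x] abs_ge_zero[of "S_var X"] unfolding B_def by linarith
    next
      case 1
      then show ?thesis using T(1) abs_ge_minus_self[of "S_var X"] by (simp add: B_def remainder_neg)
    next
      case 2
      then show ?thesis using X[OF 2] T(1) abs_ge_minus_self[of "S_var X"] unfolding B_def by linarith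
    qed
  qed
  have B0: "B \<ge> 0" using B[of 0] by linarith
  interpret bs: bounded_signal remainder B
    by unfold_locales (auto simp: B remainder_neg)
  have rem_inf: "(remainder \<longlongrightarrow> 0) at_infinity"
  proof -
    have "\<forall>\<^sub>F x in at_bot. 0 = remainder x"
      using eventually_gt_at_bot[of 0] by eventually_elim (simp add: remainder_neg)
    then have "(remainder \<longlongrightarrow> 0) at_bot" by (rule Lim_transform_eventually[rotated]) simp
    then show ?thesis unfolding at_infinity_eq_at_top_bot using lim by (rule filterlim_sup[rotated])
  qed
  define G where "G \<phi> = (LINT u|lborel. complex_of_real (remainder u) * fourier (boundary_mult \<phi>) u)
     + complex_of_real (trend 0) * fourier \<phi> 0" for \<phi>
  obtain c where c: "c \<noteq> 0" "\<And>f g x. test_fun UNIV f \<Longrightarrow> test_fun UNIV g \<Longrightarrow>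
       c * fourier (\<lambda>t. f t * g t) x = (LINT y|lborel. fourier f (x - y) * fourier g y)"
    using fourier_mult by metis
  have "coincides_with_pseudofunction_on {t0 - 1<..<t0 + 1} G" for t0
  proof -
    obtain \<eta> where \<eta>: "test_fun UNIV \<eta>" "\<And>x. t0 - 1 \<le> x \<Longrightarrow> x \<le> t0 + 1 \<Longrightarrow> \<eta> x = 1"
      using test_fun_cutoff[of "t0 - 1" "t0 + 1"] by metis
    \<comment> \<open>On the interval \<open>\<eta>\<close> is 1, so
      \<open>boundary_mult \<phi>\<close> is the product of \<open>m\<close> and
      \<open>\<phi>\<close>, and its transform is a convolution with the fixed integrable transform
      of \<open>m\<close>.\<close>
    define m where "m = boundary_mult \<eta>"
    have m: "test_fun UNIV m" unfolding m_def by (rule test_fun_boundary_mult[OF \<eta>(1)])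
    note [measurable] = fourier_measurable[OF m] fourier_measurable[OF \<eta>(1)]
    define g1 where "g1 y = bs.pairing m y + complex_of_real (trend 0) * fourier \<eta> (- y)" for y
    \<comment> \<open>The reflection and the factor \<open>2 * pi / c\<close> match the
      normalisation in \<open>coincides_with_pseudofunction_on\<close>.\<close>
    define g where "g x = complex_of_real (2 * pi) / c * g1 (- x)" for x
    have pm [measurable]: "bs.pairing m \<in> borel_measurable borel"
    proof -
      have "(\<lambda>(y, u). complex_of_real (remainder u) * fourier m (u - y)) \<in> borel_measurable (borel \<Otimes>\<^sub>M lborel)"
        by measurable
      then show ?thesis unfolding bs.pairing_def[abs_def] by (rule lborel.borel_measurable_lebesgue_integral)
    qed
    have gm: "g \<in> borel_measurable lborel" unfolding g_def[abs_def] g1_def by measurable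
    have pb: "cmod (bs.pairing m y) \<le> B * fourier_norm m" for y
    proof -
      have "cmod (bs.pairing m y) \<le> (LINT u|lborel. B * cmod (fourier m (u - y)))"
        unfolding bs.pairing_def
      proof (rule order_trans[OF integral_norm_bound integral_mono])
        show "integrable lborel (\<lambda>u. cmod (complex_of_real (remainder u) * fourier m (u - y)))"
          by (rule integrable_norm[OF bs.pairing_integrable[OF m]])
        show "integrable lborel (\<lambda>u. B * cmod (fourier m (u - y)))"
          by (intro integrable_mult_right integrable_norm[OF fourier_shift_integrable[OF m]])
        show "cmod (complex_of_real (remainder u) * fourier m (u - y)) \<le> B * cmod (fourier m (u - y))" for u
          unfolding norm_mult norm_of_real by (intro mult_right_mono B) simp
      qed
      also have "\<dots> = B * fourier_norm m"
        using lborel_integral_real_affine[of 1 "\<lambda>u. cmod (fourier m u)" "-y"] by (simp add: fourier_norm_def)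
      finally show ?thesis .
    qed
    have gb: "bounded (range g)"
      unfolding bounded_iff
    proof (intro exI ballI)
      fix z assume "z \<in> range g"
      then obtain x where z: "z = g x" by blast
      have "cmod (g1 (- x)) \<le> B * fourier_norm m + \<bar>trend 0\<bar> * (LINT x|lborel. cmod (\<eta> x))"
        unfolding g1_def
      proof (rule order_trans[OF norm_triangle_ineq add_mono[OF pb]])
        show "cmod (complex_of_real (trend 0) * fourier \<eta> (- (- x))) \<le> \<bar>trend 0\<bar> * (LINT x|lborel. cmod (\<eta> x))"
          unfolding norm_mult norm_of_real by (intro mult_left_mono norm_fourier_le) simp
      qed
      then show "norm z \<le> cmod (complex_of_real (2 * pi) / c) * (B * fourier_norm m + \<bar>trend 0\<bar> * (LINT x|lborel. cmod (\<eta> x)))"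
        unfolding z g_def norm_mult by (intro mult_left_mono) auto
    qed
    \<comment> \<open>Translation by \<open>s * h\<close> samples the remainder near either end of
      the line; it tends to 0 at plus infinity by assumption and vanishes on the negative half
      line.\<close>
    have plim: "((\<lambda>h. bs.pairing m (s * h)) \<longlongrightarrow> 0) at_top" if s: "s = 1 \<or> s = - 1" for s
    proof -
      have "((\<lambda>h. LINT v|lborel. complex_of_real (remainder (v + s * h)) * fourier m v) \<longlongrightarrow> (LINT v|(lborel :: real measure). 0)) at_top"
      proof (rule integral_dominated_convergence_at_top)
        show "integrable lborel (\<lambda>v. B * cmod (fourier m v))" using fourier_integrable[OF m] by simp
        show "\<forall>\<^sub>F h in at_top. AE v in lborel. cmod (complex_of_real (remainder (v + s * h)) * fourier m v) \<le> B * cmod (fourier m v)"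
          unfolding norm_mult norm_of_real using B by (intro always_eventually allI AE_I2 mult_right_mono) auto
        show "AE v in lborel. ((\<lambda>h. complex_of_real (remainder (v + s * h)) * fourier m v) \<longlongrightarrow> 0) at_top"
        proof (rule AE_I2)
          fix v :: real
          have "filterlim (\<lambda>h. v + s * h) at_infinity at_top"
          proof -
            have 1: "filterlim (\<lambda>h. c + h) at_top at_top" for c :: real
              by (rule filterlim_tendsto_add_at_top[OF tendsto_const filterlim_ident])
            show ?thesis
            proof (cases "s = 1")
              case True
              then show ?thesis using filterlim_at_top_imp_at_infinity[OF 1[of v]] by simp
            next
              case False
              then have "s = - 1" using s by simp
              moreover have "filterlim (\<lambda>h. - (- v + h)) at_bot at_top"
                using 1[of "- v"] unfolding filterlim_uminus_at_bot minus_minus .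
              moreover have "(\<lambda>h. - (- v + h)) = (\<lambda>h. v + (- 1) * h)" by auto
              ultimately show ?thesis using filterlim_at_bot_imp_at_infinity by metis
            qed
          qed
          then have "((\<lambda>h. remainder (v + s * h)) \<longlongrightarrow> 0) at_top" by (rule filterlim_compose[OF rem_inf])
          then have "((\<lambda>h. complex_of_real (remainder (v + s * h))) \<longlongrightarrow> complex_of_real 0) at_top" by (rule tendsto_of_real)
          then show "((\<lambda>h. complex_of_real (remainder (v + s * h)) * fourier m v) \<longlongrightarrow> 0) at_top"
            by (intro tendsto_mult_left_zero) simp
        qed
      qed measurable
      moreover have "bs.pairing m (s * h) = (LINT v|lborel. complex_of_real (remainder (v + s * h)) * fourier m v)" for h
        unfolding bs.pairing_def
        using lborel_integral_real_affine[of 1 "\<lambda>u. complex_of_real (remainder u) * fourier m (u - s * h)" "s * h"]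
        by (simp add: add.commute)
      ultimately show ?thesis by simp
    qed
    have gl: "(g \<longlongrightarrow> 0) at_infinity"
    proof -
      have "(bs.pairing m \<longlongrightarrow> 0) at_top" using plim[of 1] by simp
      moreover have "(bs.pairing m \<longlongrightarrow> 0) at_bot" using plim[of "-1"] unfolding filterlim_at_bot_mirror by simp
      ultimately have "(bs.pairing m \<longlongrightarrow> 0) at_infinity" unfolding at_infinity_eq_at_top_bot by (rule filterlim_sup)
      moreover have neg: "filterlim uminus at_infinity (at_infinity :: real filter)"
      proof -
        have "filterlim (\<lambda>x::real. norm (- x)) at_top at_infinity"
          using filterlim_norm_at_top[where 'a = real] by (simp only: norm_minus_cancel)
        then show ?thesis unfolding filterlim_at_infinity_conv_norm_at_top .
      qed
      ultimately have 1: "((\<lambda>x. bs.pairing m (- x)) \<longlongrightarrow> 0) at_infinity" by (rule filterlim_compose)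
      have "((\<lambda>x. complex_of_real (2 * pi) / c * (bs.pairing m (- x) + complex_of_real (trend 0) * fourier \<eta> x)) \<longlongrightarrow>
          complex_of_real (2 * pi) / c * (0 + complex_of_real (trend 0) * 0)) at_infinity"
        by (intro tendsto_mult tendsto_add tendsto_const 1 fourier_tendsto_0[OF \<eta>(1)])
      then show ?thesis unfolding g_def[abs_def] g1_def by simp
    qed
    have val: "G \<phi> = (LINT x|lborel. g x * fourier \<phi> (- x)) / complex_of_real (2 * pi)"
      if \<phi>V: "test_fun {t0 - 1<..<t0 + 1} \<phi>" for \<phi>
    proof -
      have \<phi>: "test_fun UNIV \<phi>" by (rule test_fun_mono[OF \<phi>V]) simp
      note [measurable] = fourier_measurable[OF \<phi>]
      have "\<eta> x * \<phi> x = \<phi> x" for x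
      proof (cases "x \<in> supp \<phi>")
        case True
        have "supp \<phi> \<subseteq> {t0 - 1<..<t0 + 1}" using \<phi>V unfolding test_fun_iff by blast
        then have "x \<in> {t0 - 1<..<t0 + 1}" using True by blast
        then show ?thesis using \<eta>(2)[of x] by simp
      next
        case False
        then have "\<phi> x = 0" by (rule zero_outside_supp[of x \<phi>])
        then show ?thesis by simp
      qed
      then have e\<phi>: "(\<lambda>x. \<eta> x * \<phi> x) = \<phi>" and m\<phi>: "(\<lambda>x. m x * \<phi> x) = boundary_mult \<phi>"
        unfolding m_def boundary_mult_def by (auto simp: mult.assoc)
      have f1: "c * fourier (boundary_mult \<phi>) u = (LINT y|lborel. fourier m (u - y) * fourier \<phi> y)" for u
        using c(2)[OF m \<phi>, of u] unfolding m\<phi> .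
      have f2: "c * fourier \<phi> 0 = (LINT y|lborel. fourier \<eta> (- y) * fourier \<phi> y)"
        using c(2)[OF \<eta>(1) \<phi>, of 0] unfolding e\<phi> by simp
      \<comment> \<open>The exchange of integrals is stated for kernels bounded by 1, so the
        remainder is divided by \<open>b\<close>; the summand 1 keeps \<open>b\<close>
        positive.\<close>
      define b where "b = B + 1"
      have b: "b > 0" using B0 by (simp add: b_def)
      let ?k = "\<lambda>z :: real \<times> real. complex_of_real (remainder (snd z) / b)"
      have k: "?k \<in> borel_measurable (lborel \<Otimes>\<^sub>M lborel)" by measurable
      have k1: "cmod (?k z) \<le> 1" for z
        using B[of "snd z"] b by (simp add: abs_divide b_def del: of_real_divide)
      note pair = integrable_pair_shift[OF fourier_integrable[OF m] fourier_integrable[OF \<phi>] k k1, of "-1"]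
      note fub = Fubini_pair_shift[OF fourier_integrable[OF m] fourier_integrable[OF \<phi>] k k1, of "-1"]
      have in1: "(LINT y|lborel. fourier \<phi> y * fourier m (u + - 1 * y) * ?k (y, u)) = complex_of_real (remainder u) / b * (c * fourier (boundary_mult \<phi>) u)" for u
        unfolding f1 integral_mult_right_zero[symmetric] by (simp add: mult_ac)
      have in2: "(LINT u|lborel. fourier \<phi> y * fourier m (u + - 1 * y) * ?k (y, u)) = fourier \<phi> y * bs.pairing m y / b" for y
      proof -
        have "(LINT u|lborel. fourier \<phi> y * fourier m (u + - 1 * y) * ?k (y, u)) =
            (LINT u|lborel. fourier \<phi> y / b * (complex_of_real (remainder u) * fourier m (u - y)))"
          by (simp add: mult_ac)
        also have "\<dots> = fourier \<phi> y / b * bs.pairing m y" unfolding bs.pairing_def by (rule integral_mult_right_zero)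
        finally show ?thesis by simp
      qed
      have "(LINT u|lborel. complex_of_real (remainder u) / b * (c * fourier (boundary_mult \<phi>) u)) = (LINT y|lborel. fourier \<phi> y * bs.pairing m y / b)"
        using fub unfolding in1 in2 .
      moreover have "(LINT u|lborel. complex_of_real (remainder u) / b * (c * fourier (boundary_mult \<phi>) u)) =
          (LINT u|lborel. (c / b) * (complex_of_real (remainder u) * fourier (boundary_mult \<phi>) u))" by (simp add: mult_ac)
      ultimately have "(c / b) * (LINT u|lborel. complex_of_real (remainder u) * fourier (boundary_mult \<phi>) u) =
         (LINT y|lborel. fourier \<phi> y * bs.pairing m y) / b" using b by simp
      then have A: "c * (LINT u|lborel. complex_of_real (remainder u) * fourier (boundary_mult \<phi>) u) =
         (LINT y|lborel. fourier \<phi> y * bs.pairing m y)" using b by (simp add: field_simps)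
      have i1: "integrable lborel (\<lambda>y. fourier \<phi> y * bs.pairing m y)"
      proof (rule Bochner_Integration.integrable_bound)
        show "integrable lborel (\<lambda>y. cmod (fourier \<phi> y) * (B * fourier_norm m))" using fourier_integrable[OF \<phi>] by simp
        show "AE y in lborel. norm (fourier \<phi> y * bs.pairing m y) \<le> norm (cmod (fourier \<phi> y) * (B * fourier_norm m))"
          unfolding norm_mult[of "fourier \<phi> _"] using pb B0 fourier_norm_nonneg[of m]
          by (intro AE_I2) (simp add: abs_mult mult_left_mono)
      qed measurable
      have i2: "integrable lborel (\<lambda>y. complex_of_real (trend 0) * (fourier \<eta> (- y) * fourier \<phi> y))"
      proof (rule integrable_mult_right, rule Bochner_Integration.integrable_bound)
        show "integrable lborel (\<lambda>y. (LINT x|lborel. cmod (\<eta> x)) * cmod (fourier \<phi> y))" using fourier_integrable[OF \<phi>] by simp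
        show "AE y in lborel. norm (fourier \<eta> (- y) * fourier \<phi> y) \<le> norm ((LINT x|lborel. cmod (\<eta> x)) * cmod (fourier \<phi> y))"
          using norm_fourier_le[of \<eta>] by (intro AE_I2) (simp add: norm_mult abs_mult mult_right_mono)
      qed measurable
      have "c * G \<phi> = (LINT y|lborel. fourier \<phi> y * bs.pairing m y) + complex_of_real (trend 0) * (LINT y|lborel. fourier \<eta> (- y) * fourier \<phi> y)"
        unfolding G_def distrib_left A f2[symmetric] by simp
      also have "\<dots> = (LINT y|lborel. fourier \<phi> y * bs.pairing m y + complex_of_real (trend 0) * (fourier \<eta> (- y) * fourier \<phi> y))"
        using i1 i2 by simp
      also have "\<dots> = (LINT y|lborel. g1 y * fourier \<phi> y)" by (simp add: g1_def algebra_simps)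
      finally have cG: "c * G \<phi> = (LINT y|lborel. g1 y * fourier \<phi> y)" .
      have "(LINT x|lborel. g x * fourier \<phi> (- x)) = (LINT y|lborel. complex_of_real (2 * pi) / c * (g1 y * fourier \<phi> y))"
        using lborel_integral_real_affine[of "-1" "\<lambda>x. g x * fourier \<phi> (- x)" 0] by (simp add: g_def mult.assoc)
      also have "\<dots> = complex_of_real (2 * pi) / c * (c * G \<phi>)" unfolding cG by (rule integral_mult_right_zero)
      finally show ?thesis using c(1) by simp
    qed
    show ?thesis
      unfolding coincides_with_pseudofunction_on_def using gm gb gl val by blast
  qed
  note co = this
  have "local_pseudofunction UNIV G"
    unfolding local_pseudofunction_def
  proof
    fix t0 :: real
    show "\<exists>V. open V \<and> t0 \<in> V \<and> V \<subseteq> UNIV \<and> coincides_with_pseudofunction_on V G"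
      by (rule exI[of _ "{t0 - 1<..<t0 + 1}"]) (simp add: co)
  qed
  moreover have "((\<lambda>\<sigma>. LINT x|lborel. F (Complex \<sigma> x) * \<phi> x) \<longlongrightarrow> G \<phi>) (at_right \<alpha>)" if "test_fun UNIV \<phi>" for \<phi>
    unfolding G_def by (rule boundary_limit[OF that B])
  ultimately show ?thesis unfolding lpf_boundary_def by blast
qed

end

theorem theorem5p4:
  fixes S :: "real \<Rightarrow> real" and \<alpha> :: real and N :: nat
    and r \<theta> t :: "nat \<Rightarrow> real"
  assumes mono: "mono_on {0..} S"
    and neg: "\<forall>x<0. S x = 0"
    and alpha_pos: "\<alpha> > 0"
    and conv: "\<forall>s. Re s > \<alpha> \<longrightarrow> laplace_converges S s"
    and t_pos: "\<forall>n\<in>{1..N}. t n > 0"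
  defines "F \<equiv> (\<lambda>s. laplace_stieltjes S s - complex_of_real (r 0) / (s - complex_of_real \<alpha>)
      - (\<Sum>n=1..N. complex_of_real (r n) *
           (exp (\<i> * complex_of_real (\<theta> n)) / (s - complex_of_real \<alpha> - \<i> * complex_of_real (t n))
          + exp (- (\<i> * complex_of_real (\<theta> n))) / (s - complex_of_real \<alpha> + \<i> * complex_of_real (t n)))))"
    and "Asym \<equiv> ((\<lambda>x. exp (- \<alpha> * x) * S x
      - (r 0 / \<alpha> + 2 * (\<Sum>n=1..N. r n * cos (t n * x + \<theta> n - arctan (t n / \<alpha>))
                                    / sqrt (\<alpha>\<^sup>2 + (t n)\<^sup>2)))) \<longlongrightarrow> 0) at_top"
  shows "(\<forall>E::real set. closed E \<and> E \<in> null_sets lborel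
            \<and> lpf_boundary F \<alpha> (- E)
            \<and> 0 \<notin> E \<and> (\<forall>n\<in>{1..N}. t n \<notin> E)
            \<and> (\<forall>\<tau>\<in>E. \<exists>M>0. \<forall>x>0.
                 norm (rs_integral (\<lambda>u. exp (- complex_of_real (\<alpha> * u) - \<i> * complex_of_real (\<tau> * u))) S 0 x) < M)
          \<longrightarrow> Asym)
       \<and> (Asym \<longrightarrow> lpf_boundary F \<alpha> UNIV)"
proof -
  interpret la: laplace_asymptotics S \<alpha> N r \<theta> t
    by unfold_locales (use mono neg alpha_pos conv in auto)
  have F: "F = la.F" by (rule ext) (simp only: F_def la.F_def)
  have "\<forall>\<^sub>F x in at_top. exp (- \<alpha> * x) * S x
      - (r 0 / \<alpha> + 2 * (\<Sum>n=1..N. r n * cos (t n * x + \<theta> n - arctan (t n / \<alpha>)) / sqrt (\<alpha>\<^sup>2 + (t n)\<^sup>2)))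
      = la.remainder x"
    \<comment> \<open>\<open>la.remainder\<close> is set to 0 on the negative half line, so the two
      expressions are compared from 0 onwards.\<close>
    using eventually_ge_at_top[of 0] by eventually_elim (simp add: la.remainder_def la.trend_def)
  then have Asym: "Asym \<longleftrightarrow> (la.remainder \<longlongrightarrow> 0) at_top"
    unfolding Asym_def by (rule tendsto_cong)
  show ?thesis
    unfolding F Asym
  proof (intro conjI allI impI)
    fix E :: "real set"
    assume "closed E \<and> E \<in> null_sets lborel \<and> lpf_boundary la.F \<alpha> (- E)
            \<and> 0 \<notin> E \<and> (\<forall>n\<in>{1..N}. t n \<notin> E)
            \<and> (\<forall>\<tau>\<in>E. \<exists>M>0. \<forall>x>0.
                 norm (rs_integral (\<lambda>u. exp (- complex_of_real (\<alpha> * u) - \<i> * complex_of_real (\<tau> * u))) S 0 x) < M)"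
    then show "(la.remainder \<longlongrightarrow> 0) at_top"
      by (intro la.tauberian[of E]) blast+
  qed (rule la.abelian)
qed

end
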